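(* Let $R$ be a commutative algebra over a field $\Bbbk$. Let $\mathcal F^\bullet$ be a filtration on $D_{R|\Bbbk}$ that is linearly dominated by the order filtration. Suppose that $(D_{R|\Bbbk},\mathcal F^\bullet)$ is linearly simple with finite dimension and finite positive multiplicity. If $M$ is a holonomic (left) $D_{R|\Bbbk}$-module, then the following hold. (i) $M_f$ is holonomic for every $f\in R$. (ii) $H^j_I(M)$ is holonomic for every finitely generated ideal $I\subseteq R$ and every $j\in\mathbb N$.
   Context: Differential operators: $D^0_{R|\Bbbk}$ is the set of multiplications by elements of $R$; $D^i_{R|\Bbbk}=\{\delta\in\operatorname{End}_\Bbbk(R):[\delta,r]\in D^{i-1}_{R|\Bbbk}\ \forall r\in R\}$; $D_{R|\Bbbk}=\bigcup_iD^i_{R|\Bbbk}$. A filtration on a $\Bbbk$-algebra $A$ is an ascending exhaustive sequence $(\mathcal F^i)_{i\in\mathbb N}$ of finite-dimensional $\Bbbk$-subspaces with $\mathcal F^0=\Bbbk$ and $\mathcal F^i\mathcal F^j\subseteq\mathcal F^{i+j}$. A filtration $\mathcal F^\bullet$ on $D_{R|\Bbbk}$ is linearly dominated by the order filtration if there is a positive integer $C$ with $\mathcal F^i\subseteq D^{Ci}_{R|\Bbbk}$ for all $i$. A compatible filtration on a left $A$-module is an ascending exhaustive sequence of finite-dimensional subspaces $\mathcal G^i$ with $\mathcal F^i\mathcal G^j\subseteq\mathcal G^{i+j}$. $\operatorname{Dim}(\mathcal G^\bullet)=\inf\{t\ge0:\exists C,\ \dim_\Bbbk\mathcal G^i\le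 Ci^t\ \forall i\gg0\}$; if $d=\operatorname{Dim}(\mathcal G^\bullet)<\infty$, the multiplicity is $\operatorname e(\mathcal G^\bullet)=\limsup_i\dim_\Bbbk\mathcal G^i/i^d$. $(A,\mathcal F^\bullet)$ is linearly simple if there is a positive integer $C$ such that $1\in\mathcal F^{Ci}\delta\mathcal F^{Ci}$ for all $i\in\mathbb N$ and all nonzero $\delta\in\mathcal F^i$. For linearly simple $(A,\mathcal F^\bullet)$ of finite dimension and positive finite multiplicity, a nonzero $A$-module is holonomic if it admits a compatible filtration of dimension $\frac12\operatorname{Dim}(\mathcal F^\bullet)$ and finite multiplicity; the zero module is holonomic by convention. For a left $D_{R|\Bbbk}$-module $M$, the localization $M_f$ is a $D_{R|\Bbbk}$-module via $\delta(v/f^t)=\delta(v)/f^t$ for $\delta$ of order $0$ and inductively on the order $\delta(v/f^t)=(\delta(v)-[\delta,f^t](v/f^t))/f^t$. $H^j_I(M)$ is the $j$-th Čech cohomology of $M$ with respect to any finite generating sequence of $I$ (independent of the choice), with the induced $D_{R|\Bbbk}$-module structure. *)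

theory Defs
  imports
    Complex_Main
    "HOL-Library.Extended_Real"
    "HOL-Library.Liminf_Limsup"
    "HOL-Algebra.Ideal"
    "HOL-Algebra.Module"
    "Jordan_Normal_Form.Missing_VectorSpace"
begin

section \<open>Left modules over a not necessarily commutative ring\<close>

text \<open>\<^locale>\<open>Module.module\<close> requires a commutative ring of scalars; these are the same axioms
  over an arbitrary ring.\<close>

locale left_module = A?: ring A + M?: abelian_group M
  for A :: "('a, 'x) ring_scheme" (structure) and M :: "('a, 'm, 'z) module_scheme" (structure) +
  assumes smult_closed [simp, intro]:
      "\<lbrakk>a \<in> carrier A; x \<in> carrier M\<rbrakk> \<Longrightarrow> a \<odot>\<^bsub>M\<^esub> x \<in> carrier M"
    and smult_l_distr:
      "\<lbrakk>a \<in> carrier A; b \<in> carrier A; x \<in> carrier M\<rbrakk> \<Longrightarrow>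
        (a \<oplus>\<^bsub>A\<^esub> b) \<odot>\<^bsub>M\<^esub> x = a \<odot>\<^bsub>M\<^esub> x \<oplus>\<^bsub>M\<^esub> b \<odot>\<^bsub>M\<^esub> x"
    and smult_r_distr:
      "\<lbrakk>a \<in> carrier A; x \<in> carrier M; y \<in> carrier M\<rbrakk> \<Longrightarrow>
        a \<odot>\<^bsub>M\<^esub> (x \<oplus>\<^bsub>M\<^esub> y) = a \<odot>\<^bsub>M\<^esub> x \<oplus>\<^bsub>M\<^esub> a \<odot>\<^bsub>M\<^esub> y"
    and smult_assoc:
      "\<lbrakk>a \<in> carrier A; b \<in> carrier A; x \<in> carrier M\<rbrakk> \<Longrightarrow>
        (a \<otimes>\<^bsub>A\<^esub> b) \<odot>\<^bsub>M\<^esub> x = a \<odot>\<^bsub>M\<^esub> (b \<odot>\<^bsub>M\<^esub> x)"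
    and smult_one [simp]:
      "x \<in> carrier M \<Longrightarrow> \<one>\<^bsub>A\<^esub> \<odot>\<^bsub>M\<^esub> x = x"

text \<open>The quotient of a left module by a submodule, realised on the additive cosets. The ring
  fields \<open>mult\<close> and \<open>one\<close> of the record are irrelevant for modules and left unspecified, here and
  below.\<close>

definition quot_module ::
    "('a, 'm, 'z) module_scheme \<Rightarrow> 'm set \<Rightarrow> ('a, 'm set) module" where
  "quot_module M N =
     \<lparr>carrier = a_rcosets\<^bsub>M\<^esub> N, mult = undefined, one = undefined,
      zero = N, add = set_add M,
      smult = (\<lambda>a X. the_elem ((\<lambda>x. N +>\<^bsub>M\<^esub> (a \<odot>\<^bsub>M\<^esub> x)) ` X))\<rparr>"


section \<open>Filtrations\<close>

text \<open>In this section \<open>K\<close> is a field and \<open>A\<close> a (not necessarily commutative) algebra over it,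
  given by a record carrying both the ring operations and the scalar multiplication by \<open>K\<close>.\<close>

definition fin_dim_subspace ::
    "('k, 'x) ring_scheme \<Rightarrow> ('k, 'v, 'y) module_scheme \<Rightarrow> 'v set \<Rightarrow> bool" where
  "fin_dim_subspace K V W \<longleftrightarrow>
     VectorSpace.subspace K W V \<and> vectorspace.fin_dim K (V\<lparr>carrier := W\<rparr>)"

definition exhaustive_fin_dim_sequence ::
    "('k, 'x) ring_scheme \<Rightarrow> ('k, 'v, 'y) module_scheme \<Rightarrow> (nat \<Rightarrow> 'v set) \<Rightarrow> bool" where
  "exhaustive_fin_dim_sequence K V G \<longleftrightarrow>
     (\<forall>i. fin_dim_subspace K V (G i)) \<and>
     (\<forall>i. G i \<subseteq> G (Suc i)) \<and>
     (\<Union>i. G i) = carrier V"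

text \<open>The product of two subspaces is the span of the elementwise products, but since the
  right-hand sides of the inclusions below are subspaces it suffices to consider products of
  elements.\<close>

definition algebra_filtration ::
    "('k, 'x) ring_scheme \<Rightarrow> ('k, 'a, 'y) module_scheme \<Rightarrow> (nat \<Rightarrow> 'a set) \<Rightarrow> bool" where
  "algebra_filtration K A F \<longleftrightarrow>
     exhaustive_fin_dim_sequence K A F \<and>
     F 0 = {c \<odot>\<^bsub>A\<^esub> \<one>\<^bsub>A\<^esub> | c. c \<in> carrier K} \<and>
     (\<forall>i j. \<forall>a \<in> F i. \<forall>b \<in> F j. a \<otimes>\<^bsub>A\<^esub> b \<in> F (i + j))"

text \<open>The \<open>K\<close>-vector space underlying a left \<open>A\<close>-module.\<close>

definition restrict_scalars ::
    "('k, 'a, 'y) module_scheme \<Rightarrow> ('a, 'm, 'z) module_scheme \<Rightarrow> ('k, 'm) module" where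
  "restrict_scalars A M =
     \<lparr>carrier = carrier M, mult = undefined, one = undefined,
      zero = \<zero>\<^bsub>M\<^esub>, add = add M,
      smult = (\<lambda>c v. (c \<odot>\<^bsub>A\<^esub> \<one>\<^bsub>A\<^esub>) \<odot>\<^bsub>M\<^esub> v)\<rparr>"

definition compatible_filtration ::
    "('k, 'x) ring_scheme \<Rightarrow> ('k, 'a, 'y) module_scheme \<Rightarrow> (nat \<Rightarrow> 'a set) \<Rightarrow>
     ('a, 'm, 'z) module_scheme \<Rightarrow> (nat \<Rightarrow> 'm set) \<Rightarrow> bool" where
  "compatible_filtration K A F M G \<longleftrightarrow>
     exhaustive_fin_dim_sequence K (restrict_scalars A M) G \<and>
     (\<forall>i j. \<forall>a \<in> F i. \<forall>v \<in> G j. a \<odot>\<^bsub>M\<^esub> v \<in> G (i + j))"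

definition dim_at ::
    "('k, 'x) ring_scheme \<Rightarrow> ('k, 'v, 'y) module_scheme \<Rightarrow> (nat \<Rightarrow> 'v set) \<Rightarrow> nat \<Rightarrow> nat" where
  "dim_at K V G i = vectorspace.dim K (V\<lparr>carrier := G i\<rparr>)"

text \<open>The infimum is taken in the extended reals, so it is \<open>\<infinity>\<close> if no exponent is admissible.\<close>

definition filtration_dim ::
    "('k, 'x) ring_scheme \<Rightarrow> ('k, 'v, 'y) module_scheme \<Rightarrow> (nat \<Rightarrow> 'v set) \<Rightarrow> ereal" where
  "filtration_dim K V G =
     Inf {ereal t | t :: real. 0 \<le> t \<and>
       (\<exists>C :: real. \<forall>\<^sub>F i in sequentially. real (dim_at K V G i) \<le> C * real i powr t)}"

text \<open>Only meaningful if \<^term>\<open>filtration_dim K V G\<close> is finite.\<close>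

definition filtration_mult ::
    "('k, 'x) ring_scheme \<Rightarrow> ('k, 'v, 'y) module_scheme \<Rightarrow> (nat \<Rightarrow> 'v set) \<Rightarrow> ereal" where
  "filtration_mult K V G =
     limsup (\<lambda>i. ereal (real (dim_at K V G i) / real i powr real_of_ereal (filtration_dim K V G)))"

text \<open>The product \<open>F\<^bsup>C i\<^esup> \<delta> F\<^bsup>C i\<^esup>\<close> is a product of subspaces, hence the span of the
  products of elements.\<close>

definition linearly_simple ::
    "('k, 'x) ring_scheme \<Rightarrow> ('k, 'a, 'y) module_scheme \<Rightarrow> (nat \<Rightarrow> 'a set) \<Rightarrow> bool" where
  "linearly_simple K A F \<longleftrightarrow>
     (\<exists>C :: nat. 0 < C \<and>
       (\<forall>i. \<forall>\<delta> \<in> F i. \<delta> \<noteq> \<zero>\<^bsub>A\<^esub> \<longrightarrow>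
         \<one>\<^bsub>A\<^esub> \<in> module.span K A
           {a \<otimes>\<^bsub>A\<^esub> \<delta> \<otimes>\<^bsub>A\<^esub> b | a b. a \<in> F (C * i) \<and> b \<in> F (C * i)}))"

definition holonomic ::
    "('k, 'x) ring_scheme \<Rightarrow> ('k, 'a, 'y) module_scheme \<Rightarrow> (nat \<Rightarrow> 'a set) \<Rightarrow>
     ('a, 'm, 'z) module_scheme \<Rightarrow> bool" where
  "holonomic K A F M \<longleftrightarrow>
     left_module A M \<and>
     (carrier M = {\<zero>\<^bsub>M\<^esub>} \<or>
      (\<exists>G. compatible_filtration K A F M G \<and>
           filtration_dim K (restrict_scalars A M) G = filtration_dim K A F / 2 \<and>
           filtration_mult K (restrict_scalars A M) G < \<infinity>))"


section \<open>Differential operators\<close>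

text \<open>Endomorphisms of the \<open>K\<close>-vector space \<open>R\<close>, as functions extended by \<open>undefined\<close> outside
  the carrier of \<open>R\<close>.\<close>

definition End_algebra ::
    "('k, 'x) ring_scheme \<Rightarrow> ('k, 'r, 'y) module_scheme \<Rightarrow> ('k, 'r \<Rightarrow> 'r) module" where
  "End_algebra K R =
     \<lparr>carrier = module_hom K R R \<inter> extensional (carrier R),
      mult = compose (carrier R),
      one = (\<lambda>x \<in> carrier R. x),
      zero = (\<lambda>x \<in> carrier R. \<zero>\<^bsub>R\<^esub>),
      add = (\<lambda>\<phi> \<psi>. \<lambda>x \<in> carrier R. \<phi> x \<oplus>\<^bsub>R\<^esub> \<psi> x),
      smult = (\<lambda>c \<phi>. \<lambda>x \<in> carrier R. c \<odot>\<^bsub>R\<^esub> \<phi> x)\<rparr>"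

definition mult_op :: "('r, 'y) ring_scheme \<Rightarrow> 'r \<Rightarrow> 'r \<Rightarrow> 'r" where
  "mult_op R r = (\<lambda>x \<in> carrier R. r \<otimes>\<^bsub>R\<^esub> x)"

definition commutator :: "('a, 'y) ring_scheme \<Rightarrow> 'a \<Rightarrow> 'a \<Rightarrow> 'a" where
  "commutator A a b = a \<otimes>\<^bsub>A\<^esub> b \<ominus>\<^bsub>A\<^esub> b \<otimes>\<^bsub>A\<^esub> a"

primrec diff_ops_le ::
    "('k, 'x) ring_scheme \<Rightarrow> ('k, 'r, 'y) module_scheme \<Rightarrow> nat \<Rightarrow> ('r \<Rightarrow> 'r) set" where
  "diff_ops_le K R 0 = mult_op R ` carrier R"
| "diff_ops_le K R (Suc i) =
     {\<delta> \<in> carrier (End_algebra K R).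
        \<forall>r \<in> carrier R. commutator (End_algebra K R) \<delta> (mult_op R r) \<in> diff_ops_le K R i}"

definition diff_ops ::
    "('k, 'x) ring_scheme \<Rightarrow> ('k, 'r, 'y) module_scheme \<Rightarrow> ('k, 'r \<Rightarrow> 'r) module" where
  "diff_ops K R = (End_algebra K R)\<lparr>carrier := (\<Union>i. diff_ops_le K R i)\<rparr>"

definition diff_order ::
    "('k, 'x) ring_scheme \<Rightarrow> ('k, 'r, 'y) module_scheme \<Rightarrow> ('r \<Rightarrow> 'r) \<Rightarrow> nat" where
  "diff_order K R \<delta> = (LEAST i. \<delta> \<in> diff_ops_le K R i)"

definition linearly_dominated_by_order ::
    "('k, 'x) ring_scheme \<Rightarrow> ('k, 'r, 'y) module_scheme \<Rightarrow> (nat \<Rightarrow> ('r \<Rightarrow> 'r) set) \<Rightarrow> bool" where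
  "linearly_dominated_by_order K R F \<longleftrightarrow>
     (\<exists>C :: nat. 0 < C \<and> (\<forall>i. F i \<subseteq> diff_ops_le K R (C * i)))"


section \<open>Localization\<close>

text \<open>The action of \<open>R\<close> on a module over the differential operators.\<close>

definition ring_act ::
    "('r, 'y) ring_scheme \<Rightarrow> ('r \<Rightarrow> 'r, 'm, 'z) module_scheme \<Rightarrow> 'r \<Rightarrow> 'm \<Rightarrow> 'm" where
  "ring_act R M r v = mult_op R r \<odot>\<^bsub>M\<^esub> v"

text \<open>A pair \<open>(v, t)\<close> stands for the fraction \<open>v / f\<^sup>t\<close>; an element of the localization is an
  equivalence class of such pairs.\<close>

definition loc_rel ::
    "('r, 'y) ring_scheme \<Rightarrow> ('r \<Rightarrow> 'r, 'm, 'z) module_scheme \<Rightarrow> 'r \<Rightarrow>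
     (('m \<times> nat) \<times> ('m \<times> nat)) set" where
  "loc_rel R M f =
     {((v, t), (w, s)). v \<in> carrier M \<and> w \<in> carrier M \<and>
        (\<exists>u :: nat. ring_act R M (f [^]\<^bsub>R\<^esub> u) (ring_act R M (f [^]\<^bsub>R\<^esub> s) v) =
                    ring_act R M (f [^]\<^bsub>R\<^esub> u) (ring_act R M (f [^]\<^bsub>R\<^esub> t) w))}"

definition loc_frac ::
    "('r, 'y) ring_scheme \<Rightarrow> ('r \<Rightarrow> 'r, 'm, 'z) module_scheme \<Rightarrow> 'r \<Rightarrow> 'm \<times> nat \<Rightarrow>
     ('m \<times> nat) set" where
  "loc_frac R M f p = loc_rel R M f `` {p}"

text \<open>\<open>loc_act K R M f i \<delta> (v, t)\<close> is a numerator and denominator exponent of \<open>\<delta>(v / f\<^sup>t)\<close> for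
  \<open>\<delta>\<close> of order at most \<open>i\<close>. In the step, if \<open>[\<delta>, f\<^sup>t](v / f\<^sup>t) = w / f\<^sup>s\<close>, then
  \<open>(\<delta>(v) - [\<delta>, f\<^sup>t](v / f\<^sup>t)) / f\<^sup>t = (f\<^sup>s \<delta>(v) - w) / f\<^bsup>s + t\<^esup>\<close>.\<close>

primrec loc_act ::
    "('k, 'x) ring_scheme \<Rightarrow> ('k, 'r, 'y) module_scheme \<Rightarrow> ('r \<Rightarrow> 'r, 'm, 'z) module_scheme \<Rightarrow> 'r \<Rightarrow>
     nat \<Rightarrow> ('r \<Rightarrow> 'r) \<Rightarrow> 'm \<times> nat \<Rightarrow> 'm \<times> nat" where
  "loc_act K R M f 0 = (\<lambda>\<delta> (v, t). (\<delta> \<odot>\<^bsub>M\<^esub> v, t))"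
| "loc_act K R M f (Suc i) = (\<lambda>\<delta> (v, t).
     let (w, s) =
       loc_act K R M f i (commutator (End_algebra K R) \<delta> (mult_op R (f [^]\<^bsub>R\<^esub> t))) (v, t)
     in (ring_act R M (f [^]\<^bsub>R\<^esub> s) (\<delta> \<odot>\<^bsub>M\<^esub> v) \<ominus>\<^bsub>M\<^esub> w, s + t))"

text \<open>The operations are computed on arbitrary representatives: \<^const>\<open>the_elem\<close> extracts the
  common value.\<close>

definition localization ::
    "('k, 'x) ring_scheme \<Rightarrow> ('k, 'r, 'y) module_scheme \<Rightarrow> ('r \<Rightarrow> 'r, 'm, 'z) module_scheme \<Rightarrow> 'r \<Rightarrow>
     ('r \<Rightarrow> 'r, ('m \<times> nat) set) module" where
  "localization K R M f =
     \<lparr>carrier = (carrier M \<times> UNIV) // loc_rel R M f,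
      mult = undefined, one = undefined,
      zero = loc_frac R M f (\<zero>\<^bsub>M\<^esub>, 0),
      add = (\<lambda>X Y. the_elem
        {loc_frac R M f (ring_act R M (f [^]\<^bsub>R\<^esub> s) v \<oplus>\<^bsub>M\<^esub> ring_act R M (f [^]\<^bsub>R\<^esub> t) w, s + t)
          | v t w s. (v, t) \<in> X \<and> (w, s) \<in> Y}),
      smult = (\<lambda>\<delta> X. the_elem
        ((\<lambda>p. loc_frac R M f (loc_act K R M f (diff_order K R \<delta>) \<delta> p)) ` X))\<rparr>"

text \<open>The canonical map from the localization at \<open>g\<close> to the localization at \<open>g h\<close>, sending
  \<open>v / g\<^sup>t\<close> to \<open>h\<^sup>t v / (g h)\<^sup>t\<close>.\<close>

definition loc_map ::
    "('r, 'y) ring_scheme \<Rightarrow> ('r \<Rightarrow> 'r, 'm, 'z) module_scheme \<Rightarrow> 'r \<Rightarrow> 'r \<Rightarrow>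
     ('m \<times> nat) set \<Rightarrow> ('m \<times> nat) set" where
  "loc_map R M g h X =
     the_elem ((\<lambda>(v, t). loc_frac R M (g \<otimes>\<^bsub>R\<^esub> h) (ring_act R M (h [^]\<^bsub>R\<^esub> t) v, t)) ` X)"


section \<open>Cech cohomology\<close>

definition cech_index :: "'r list \<Rightarrow> nat \<Rightarrow> nat set set" where
  "cech_index fs j = {S. S \<subseteq> {..<length fs} \<and> card S = j}"

definition cech_prod :: "('r, 'y) ring_scheme \<Rightarrow> 'r list \<Rightarrow> nat set \<Rightarrow> 'r" where
  "cech_prod R fs S = finprod R (\<lambda>i. fs ! i) S"

text \<open>The summands are indexed by the sets \<open>S = {i\<^sub>1 < \<dots> < i\<^sub>j}\<close>, and the direct sum is the product
  since there are finitely many. In degree \<open>0\<close> the only summand is the localization at the empty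
  product \<open>1\<close>, which is canonically \<open>M\<close>.\<close>

definition cech_module ::
    "('k, 'x) ring_scheme \<Rightarrow> ('k, 'r, 'y) module_scheme \<Rightarrow> ('r \<Rightarrow> 'r, 'm, 'z) module_scheme \<Rightarrow>
     'r list \<Rightarrow> nat \<Rightarrow> ('r \<Rightarrow> 'r, nat set \<Rightarrow> ('m \<times> nat) set) module" where
  "cech_module K R M fs j =
     (let L = (\<lambda>S. localization K R M (cech_prod R fs S)) in
      \<lparr>carrier = (\<Pi>\<^sub>E S \<in> cech_index fs j. carrier (L S)),
       mult = undefined, one = undefined,
       zero = (\<lambda>S \<in> cech_index fs j. \<zero>\<^bsub>L S\<^esub>),
       add = (\<lambda>\<alpha> \<beta>. \<lambda>S \<in> cech_index fs j. \<alpha> S \<oplus>\<^bsub>L S\<^esub> \<beta> S),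
       smult = (\<lambda>\<delta> \<alpha>. \<lambda>S \<in> cech_index fs j. \<delta> \<odot>\<^bsub>L S\<^esub> \<alpha> S)\<rparr>)"

definition signed :: "('a, 'y) ring_scheme \<Rightarrow> nat \<Rightarrow> 'a \<Rightarrow> 'a" where
  "signed M n x = (if even n then x else \<ominus>\<^bsub>M\<^esub> x)"

definition cech_diff ::
    "('k, 'x) ring_scheme \<Rightarrow> ('k, 'r, 'y) module_scheme \<Rightarrow> ('r \<Rightarrow> 'r, 'm, 'z) module_scheme \<Rightarrow>
     'r list \<Rightarrow> nat \<Rightarrow> (nat set \<Rightarrow> ('m \<times> nat) set) \<Rightarrow> nat set \<Rightarrow> ('m \<times> nat) set" where
  "cech_diff K R M fs j \<alpha> =
     (\<lambda>T \<in> cech_index fs (Suc j).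
        let L = localization K R M (cech_prod R fs T) in
        finsum L
          (\<lambda>i. signed L (card {k \<in> T. k < i})
                 (loc_map R M (cech_prod R fs (T - {i})) (fs ! i) (\<alpha> (T - {i})))) T)"

definition cech_cocycles ::
    "('k, 'x) ring_scheme \<Rightarrow> ('k, 'r, 'y) module_scheme \<Rightarrow> ('r \<Rightarrow> 'r, 'm, 'z) module_scheme \<Rightarrow>
     'r list \<Rightarrow> nat \<Rightarrow> (nat set \<Rightarrow> ('m \<times> nat) set) set" where
  "cech_cocycles K R M fs j =
     {\<alpha> \<in> carrier (cech_module K R M fs j).
        cech_diff K R M fs j \<alpha> = \<zero>\<^bsub>cech_module K R M fs (Suc j)\<^esub>}"

definition cech_coboundaries ::
    "('k, 'x) ring_scheme \<Rightarrow> ('k, 'r, 'y) module_scheme \<Rightarrow> ('r \<Rightarrow> 'r, 'm, 'z) module_scheme \<Rightarrow>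
     'r list \<Rightarrow> nat \<Rightarrow> (nat set \<Rightarrow> ('m \<times> nat) set) set" where
  "cech_coboundaries K R M fs j =
     (case j of
        0 \<Rightarrow> {\<zero>\<^bsub>cech_module K R M fs 0\<^esub>}
      | Suc i \<Rightarrow> cech_diff K R M fs i ` carrier (cech_module K R M fs i))"

definition cech_cohomology ::
    "('k, 'x) ring_scheme \<Rightarrow> ('k, 'r, 'y) module_scheme \<Rightarrow> ('r \<Rightarrow> 'r, 'm, 'z) module_scheme \<Rightarrow>
     'r list \<Rightarrow> nat \<Rightarrow> ('r \<Rightarrow> 'r, (nat set \<Rightarrow> ('m \<times> nat) set) set) module" where
  "cech_cohomology K R M fs j =
     quot_module ((cech_module K R M fs j)\<lparr>carrier := cech_cocycles K R M fs j\<rparr>)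
       (cech_coboundaries K R M fs j)"

end

theory Submission
  imports Defs
begin

text \<open>
Write \<open>D\<close> for the ring of differential operators, \<open>d\<close> for the dimension of its filtration \<open>F\<close>, and
fix a filtration \<open>G\<close> of the holonomic module \<open>M\<close> with \<open>dim G\<^sup>i = O(i\<^bsup>d/2\<^esup>)\<close>.

The definition of holonomicity asks for a filtration whose dimension is exactly \<open>d/2\<close>. Only an upper
bound has to be checked: by Bernstein's inequality no compatible filtration of a nonzero module has
dimension less than \<open>d/2\<close>. Indeed, if \<open>G\<^bsup>i\<^sub>0\<^esup> \<noteq> 0\<close>, then linear simplicity, \<open>1 \<in> F\<^bsup>Ci\<^esup> \<delta> F\<^bsup>Ci\<^esup>\<close>, prevents a nonzero
\<open>\<delta> \<in> F\<^sup>i\<close> from annihilating \<open>G\<^bsup>Ci + i\<^sub>0\<^esup>\<close>. Hence \<open>F\<^sup>i\<close> embeds into the linear maps from \<open>G\<^bsup>Ci + i\<^sub>0\<^esup>\<close> to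
\<open>G\<^bsup>(C + 1)i + i\<^sub>0\<^esup>\<close>, and its dimension is at most the square of the dimension of some \<open>G\<^bsup>ci\<^esup>\<close>
(\<open>dim_le_square\<close>, \<open>bernstein_inequality\<close>). So a module is holonomic if and only if it has a compatible
filtration with \<open>O(i\<^bsup>d/2\<^esup>)\<close> growth (\<open>holonomic_iff\<close>), a condition that passes to submodules,
quotients and finite products.

For the localization, the recursive formula for the action of \<open>D\<close> on \<open>M\<^sub>f\<close> is replaced by a
characterisation: \<open>\<delta>(v/f\<^sup>t) = P v / f\<^sup>m\<close> whenever \<open>f\<^sup>m \<delta> = P f\<^sup>t\<close> in \<open>D\<close> (\<open>frac_act\<close>). Such \<open>m\<close> and \<open>P\<close>
exist because iterated commutators with \<open>f\<close> vanish, that is, the powers of \<open>f\<close> form an Ore set. The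
module axioms and the linearity of the maps between localizations are then short computations in
\<open>D\<close>. Moreover, if \<open>\<delta> \<in> F\<^sup>i\<close> has order at most \<open>n\<close> and \<open>f \<in> F\<^sup>a\<close>, then \<open>m = t + n\<close> and some
\<open>P \<in> F\<^bsup>i + an\<^esup>\<close> will do (\<open>ore_growth\<close>). Since \<open>F\<^sup>i\<close> consists of operators of order at most \<open>Ci\<close>, the
subspaces \<open>f\<^bsup>-Ci\<^esup> G\<^bsup>(1 + aC)i\<^esup>\<close> form a compatible filtration of \<open>M\<^sub>f\<close>. Up to the linear
change of index it grows no faster than \<open>G\<close>, so \<open>M\<^sub>f\<close> is holonomic.

Finally, the Cech complex is a complex of finite products of localizations with \<open>D\<close>-linear
differentials, so its cohomology is a subquotient of a holonomic module.
\<close>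

section \<open>Dimensions of subspaces\<close>

text \<open>Independent subsets of \<open>W\<close> have at most \<open>card B\<close> elements by the exchange lemma, so a maximal one
  exists and is a basis.\<close>

lemma fin_dim_subspaceI:
  assumes V: "vectorspace K V" and W: "submodule K W V"
    and B: "finite B" "B \<subseteq> carrier V" "W \<subseteq> module.span K V B"
  shows "fin_dim_subspace K V W" "vectorspace.dim K (V\<lparr>carrier := W\<rparr>) \<le> card B"
proof -
  interpret V: vectorspace K V by fact
  have subW: "VectorSpace.subspace K W V" using V W by (simp add: VectorSpace.subspace_def)
  interpret W: vectorspace K "V\<lparr>carrier := W\<rparr>" by (rule V.subspace_is_vs[OF subW])
  let ?S = "V.span B"
  have subS: "VectorSpace.subspace K ?S V" by (rule V.span_is_subspace[OF B(2)])
  have smS: "submodule K ?S V" using subS by simp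
  interpret S: vectorspace K "V\<lparr>carrier := ?S\<rparr>" by (rule V.subspace_is_vs[OF subS])
  have BS: "B \<subseteq> ?S" by (rule V.in_own_span[OF B(2)])
  have genS: "S.gen_set B" using V.span_li_not_depend(1)[OF BS smS] by simp
  have fdS: "S.fin_dim" unfolding S.fin_dim_def using B(1) BS genS by auto
  have dimS: "S.dim \<le> card B" using S.gen_ge_dim[OF B(1) _ genS] BS by simp
  have small: "finite A \<and> card A \<le> card B" if A: "A \<subseteq> W" "W.lin_indpt A" for A
  proof -
    have "V.lin_indpt A" using V.span_li_not_depend(2)[OF A(1) W] A(2) by simp
    moreover have AS: "A \<subseteq> ?S" using A(1) B(3) by auto
    ultimately have "S.lin_indpt A" using V.span_li_not_depend(2)[OF AS smS] by simp
    from S.li_le_dim[OF fdS _ this] AS dimS show ?thesis by simp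
  qed
  have "\<exists>A. finite A \<and> maximal A (\<lambda>S. S \<subseteq> carrier (V\<lparr>carrier := W\<rparr>) \<and> W.lin_indpt S)"
    apply (rule maximal_exists[where ?N="card B" and ?B="{}"])
    using small by (auto simp: W.lin_dep_def)
  then obtain A where A: "finite A" "maximal A (\<lambda>S. S \<subseteq> carrier (V\<lparr>carrier := W\<rparr>) \<and> W.lin_indpt S)"
    by blast
  from A have Ab: "W.basis A" by (intro W.max_li_is_basis) auto
  have "card A \<le> card B" using small[of A] Ab unfolding W.basis_def by auto
  then show "W.dim \<le> card B" using W.dim_basis[OF A(1) Ab] by simp
  have "W.fin_dim" unfolding W.fin_dim_def using A(1) Ab unfolding W.basis_def by auto
  then show "fin_dim_subspace K V W" using subW by (simp add: fin_dim_subspace_def)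
qed

lemma fin_dim_subspaceE:
  assumes "fin_dim_subspace K V W"
  obtains B where "finite B" "B \<subseteq> W" "W = module.span K V B"
    "card B = vectorspace.dim K (V\<lparr>carrier := W\<rparr>)"
proof -
  have subW: "VectorSpace.subspace K W V" and fd: "vectorspace.fin_dim K (V\<lparr>carrier := W\<rparr>)"
    using assms by (auto simp: fin_dim_subspace_def)
  interpret V: vectorspace K V using subW by (simp add: VectorSpace.subspace_def)
  interpret W: vectorspace K "V\<lparr>carrier := W\<rparr>" by (rule V.subspace_is_vs[OF subW])
  have smW: "submodule K W V" using subW by simp
  obtain B where B: "finite B" "W.basis B" using W.finite_basis_exists[OF fd] by blast
  have BW: "B \<subseteq> W" and g: "W.gen_set B" using B(2) unfolding W.basis_def by auto
  show thesis
    by (rule that[OF B(1) BW]) (use V.span_li_not_depend(1)[OF BW smW] g W.dim_basis[OF B] in auto)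
qed

lemma fin_dim_subspaceD:
  assumes "fin_dim_subspace K V W"
  shows "vectorspace K V" "submodule K W V" "W \<subseteq> carrier V"
  using assms by (auto simp: fin_dim_subspace_def VectorSpace.subspace_def submodule_def)

lemma fin_dim_subspace_subset:
  assumes W: "fin_dim_subspace K V W" and U: "submodule K U V" "U \<subseteq> W"
  shows "fin_dim_subspace K V U"
    "vectorspace.dim K (V\<lparr>carrier := U\<rparr>) \<le> vectorspace.dim K (V\<lparr>carrier := W\<rparr>)"
proof -
  obtain B where B: "finite B" "B \<subseteq> W" "W = module.span K V B"
    "card B = vectorspace.dim K (V\<lparr>carrier := W\<rparr>)" by (rule fin_dim_subspaceE[OF W])
  note * = fin_dim_subspaceI[OF fin_dim_subspaceD(1)[OF W] U(1) B(1)]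
  show "fin_dim_subspace K V U" "vectorspace.dim K (V\<lparr>carrier := U\<rparr>) \<le> vectorspace.dim K (V\<lparr>carrier := W\<rparr>)"
    using * B U(2) fin_dim_subspaceD(3)[OF W] by auto
qed

lemma (in mod_hom) image_submodule:
  assumes "submodule R W M"
  shows "submodule R (f ` W) N"
proof -
  interpret W: submodule R W M by fact
  have WM: "w \<in> carrier M" if "w \<in> W" for w using that W.subset by auto
  show ?thesis
  proof (unfold_locales)
    show "f ` W \<subseteq> carrier N" using WM by auto
    show "\<zero>\<^bsub>N\<^esub> \<in> f ` W" using W.zero_closed f0_is_0 by (metis imageI)
    fix v w assume "v \<in> f ` W" "w \<in> f ` W"
    then obtain x y where "x \<in> W" "y \<in> W" "v = f x" "w = f y" by auto
    then show "v \<oplus>\<^bsub>N\<^esub> w \<in> f ` W" using WM W.m_closed f_add by (metis imageI)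
  next
    fix c v assume c: "c \<in> carrier R" and "v \<in> f ` W"
    then obtain x where "x \<in> W" "v = f x" by auto
    then show "c \<odot>\<^bsub>N\<^esub> v \<in> f ` W" using WM W.smult_closed c f_smult by (metis imageI)
  qed
qed

lemma (in mod_hom) preimage_submodule:
  assumes "submodule R W N"
  shows "submodule R {v \<in> carrier M. f v \<in> W} M"
proof -
  interpret W: submodule R W N by fact
  show ?thesis by unfold_locales auto
qed

lemma linear_image_fin_dim:
  assumes V': "vectorspace K V'" and T: "T \<in> module_hom K V V'" and W: "fin_dim_subspace K V W"
  shows "fin_dim_subspace K V' (T ` W)"
    "vectorspace.dim K (V'\<lparr>carrier := T ` W\<rparr>) \<le> vectorspace.dim K (V\<lparr>carrier := W\<rparr>)"
proof -
  interpret V: vectorspace K V using fin_dim_subspaceD(1)[OF W] .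
  interpret V': vectorspace K V' by fact
  interpret T: mod_hom K V V' T
    by unfold_locales (rule T)
  obtain B where B: "finite B" "B \<subseteq> W" "W = module.span K V B"
    "card B = vectorspace.dim K (V\<lparr>carrier := W\<rparr>)" by (rule fin_dim_subspaceE[OF W])
  have BV: "B \<subseteq> carrier V" using B(2) fin_dim_subspaceD(3)[OF W] by auto
  have TB: "T ` B \<subseteq> carrier V'" using BV by auto
  have "V.span B \<subseteq> {v \<in> carrier V. T v \<in> V'.span (T ` B)}"
    apply (rule V.span_is_subset)
    using BV V'.in_own_span[OF TB] T.preimage_submodule[OF V'.span_is_submodule[OF TB]] by auto
  then have "T ` W \<subseteq> V'.span (T ` B)" using B(3) by auto
  note * = fin_dim_subspaceI[OF V' T.image_submodule[OF fin_dim_subspaceD(2)[OF W]] finite_imageI[OF B(1)] TB this]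
  show "fin_dim_subspace K V' (T ` W)" by (rule *(1))
  show "vectorspace.dim K (V'\<lparr>carrier := T ` W\<rparr>) \<le> vectorspace.dim K (V\<lparr>carrier := W\<rparr>)"
    using *(2) card_image_le[OF B(1), of T] B(4) by simp
qed

lemma linear_kernel_dim:
  assumes V': "vectorspace K V'" and T: "T \<in> module_hom K V V'"
    and W: "fin_dim_subspace K V W"
    and U: "fin_dim_subspace K V' U" "T ` W \<subseteq> U"
  shows "fin_dim_subspace K V {w \<in> W. T w = \<zero>\<^bsub>V'\<^esub>}"
    "vectorspace.dim K (V\<lparr>carrier := W\<rparr>) \<le>
     vectorspace.dim K (V\<lparr>carrier := {w \<in> W. T w = \<zero>\<^bsub>V'\<^esub>}\<rparr>) + vectorspace.dim K (V'\<lparr>carrier := U\<rparr>)"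
proof -
  interpret V: vectorspace K V using fin_dim_subspaceD(1)[OF W] .
  interpret V': vectorspace K V' by fact
  interpret T: mod_hom K V V' T by unfold_locales (rule T)
  have subW: "VectorSpace.subspace K W V" and fd: "vectorspace.fin_dim K (V\<lparr>carrier := W\<rparr>)"
    using W by (auto simp: fin_dim_subspace_def)
  interpret W: vectorspace K "V\<lparr>carrier := W\<rparr>" by (rule V.subspace_is_vs[OF subW])
  have WV: "W \<subseteq> carrier V" by (rule fin_dim_subspaceD(3)[OF W])
  have "T \<in> module_hom K (V\<lparr>carrier := W\<rparr>) V'"
    using T WV unfolding module_hom_def by (auto simp: subset_iff)
  then interpret TW: linear_map K "V\<lparr>carrier := W\<rparr>" V' T
    by (intro linear_map.intro mod_hom.intro mod_hom_axioms.intro) unfold_locales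
  have ker: "TW.kerT = {w \<in> W. T w = \<zero>\<^bsub>V'\<^esub>}" unfolding TW.ker_def by simp
  have im: "TW.imT = T ` W" unfolding TW.im_def by simp
  have sub: "submodule K {w \<in> W. T w = \<zero>\<^bsub>V'\<^esub>} V"
  proof -
    interpret W: submodule K W V by (rule fin_dim_subspaceD(2)[OF W])
    show ?thesis using W.subset by unfold_locales (auto simp: subset_iff)
  qed
  show "fin_dim_subspace K V {w \<in> W. T w = \<zero>\<^bsub>V'\<^esub>}"
    by (rule fin_dim_subspace_subset(1)[OF W sub]) auto
  have "vectorspace.dim K (V'\<lparr>carrier := T ` W\<rparr>) \<le> vectorspace.dim K (V'\<lparr>carrier := U\<rparr>)"
    by (rule fin_dim_subspace_subset(2)[OF U(1) T.image_submodule[OF fin_dim_subspaceD(2)[OF W]] U(2)])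
  with TW.rank_nullity[OF fd] show "vectorspace.dim K (V\<lparr>carrier := W\<rparr>) \<le>
     vectorspace.dim K (V\<lparr>carrier := {w \<in> W. T w = \<zero>\<^bsub>V'\<^esub>}\<rparr>) + vectorspace.dim K (V'\<lparr>carrier := U\<rparr>)"
    unfolding ker im by simp
qed

text \<open>The map \<open>w \<mapsto> (T b w)\<^sub>b\<close> embeds \<open>W\<close> into a power of \<open>U\<close>. Rank-nullity, applied to one \<open>T b\<close> after the
  other, gives the bound without forming the power.\<close>

lemma dim_le_separating:
  assumes V': "vectorspace K V'"
    and W: "fin_dim_subspace K V W" and U: "fin_dim_subspace K V' U"
    and T: "\<And>b. b \<in> set bs \<Longrightarrow> T b \<in> module_hom K V V'"
      "\<And>b w. b \<in> set bs \<Longrightarrow> w \<in> W \<Longrightarrow> T b w \<in> U"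
    and sep: "\<And>w. w \<in> W \<Longrightarrow> (\<And>b. b \<in> set bs \<Longrightarrow> T b w = \<zero>\<^bsub>V'\<^esub>) \<Longrightarrow> w = \<zero>\<^bsub>V\<^esub>"
  shows "vectorspace.dim K (V\<lparr>carrier := W\<rparr>) \<le> length bs * vectorspace.dim K (V'\<lparr>carrier := U\<rparr>)"
  using W T sep
proof (induction bs arbitrary: W)
  case Nil
  interpret V: vectorspace K V using fin_dim_subspaceD(1)[OF Nil.prems(1)] .
  have "W \<subseteq> V.span {}" using Nil.prems(4) V.span_empty by auto
  from fin_dim_subspaceI(2)[OF V.vectorspace_axioms fin_dim_subspaceD(2)[OF Nil.prems(1)] _ _ this]
  show ?case by simp
next
  case (Cons b bs)
  let ?W = "{w \<in> W. T b w = \<zero>\<^bsub>V'\<^esub>}"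
  have Tb: "T b \<in> module_hom K V V'" "T b ` W \<subseteq> U" using Cons.prems(2,3) by auto
  note k = linear_kernel_dim[OF V' Tb(1) Cons.prems(1) U Tb(2)]
  have "vectorspace.dim K (V\<lparr>carrier := ?W\<rparr>) \<le> length bs * vectorspace.dim K (V'\<lparr>carrier := U\<rparr>)"
  proof (rule Cons.IH[OF k(1)])
    fix w assume "w \<in> ?W" and "\<And>b. b \<in> set bs \<Longrightarrow> T b w = \<zero>\<^bsub>V'\<^esub>"
    then show "w = \<zero>\<^bsub>V\<^esub>" by (intro Cons.prems(4)) auto
  qed (use Cons.prems(2,3) in auto)
  with k(2) show ?case by simp
qed

section \<open>Left modules\<close>

context left_module
begin

lemma smult_l_null [simp]: "x \<in> carrier M \<Longrightarrow> \<zero>\<^bsub>A\<^esub> \<odot>\<^bsub>M\<^esub> x = \<zero>\<^bsub>M\<^esub>"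
  using smult_l_distr[of "\<zero>\<^bsub>A\<^esub>" "\<zero>\<^bsub>A\<^esub>" x] by (metis A.zero_closed A.l_zero M.add.r_cancel_one' smult_closed)

lemma smult_r_null [simp]: "a \<in> carrier A \<Longrightarrow> a \<odot>\<^bsub>M\<^esub> \<zero>\<^bsub>M\<^esub> = \<zero>\<^bsub>M\<^esub>"
  using smult_r_distr[of a "\<zero>\<^bsub>M\<^esub>" "\<zero>\<^bsub>M\<^esub>"] by (metis M.zero_closed M.l_zero M.add.r_cancel_one' smult_closed)

lemma smult_l_minus:
  assumes "a \<in> carrier A" "x \<in> carrier M" shows "(\<ominus>\<^bsub>A\<^esub> a) \<odot>\<^bsub>M\<^esub> x = \<ominus>\<^bsub>M\<^esub> (a \<odot>\<^bsub>M\<^esub> x)"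
proof -
  have "(\<ominus>\<^bsub>A\<^esub> a) \<odot>\<^bsub>M\<^esub> x \<oplus>\<^bsub>M\<^esub> a \<odot>\<^bsub>M\<^esub> x = \<zero>\<^bsub>M\<^esub>"
    using assms smult_l_distr[of "\<ominus>\<^bsub>A\<^esub> a" a x] by (simp add: A.l_neg)
  then show ?thesis using assms by (simp add: M.minus_equality)
qed

lemma smult_r_minus:
  assumes "a \<in> carrier A" "x \<in> carrier M" shows "a \<odot>\<^bsub>M\<^esub> (\<ominus>\<^bsub>M\<^esub> x) = \<ominus>\<^bsub>M\<^esub> (a \<odot>\<^bsub>M\<^esub> x)"
proof -
  have "a \<odot>\<^bsub>M\<^esub> (\<ominus>\<^bsub>M\<^esub> x) \<oplus>\<^bsub>M\<^esub> a \<odot>\<^bsub>M\<^esub> x = \<zero>\<^bsub>M\<^esub>"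
    using assms smult_r_distr[of a "\<ominus>\<^bsub>M\<^esub> x" x] by (simp add: M.l_neg)
  then show ?thesis using assms by (simp add: M.minus_equality)
qed

lemma smult_r_diff:
  assumes "a \<in> carrier A" "x \<in> carrier M" "y \<in> carrier M"
  shows "a \<odot>\<^bsub>M\<^esub> (x \<ominus>\<^bsub>M\<^esub> y) = a \<odot>\<^bsub>M\<^esub> x \<ominus>\<^bsub>M\<^esub> a \<odot>\<^bsub>M\<^esub> y"
  using assms by (simp add: a_minus_def smult_r_distr smult_r_minus)

lemma smult_l_diff:
  assumes "a \<in> carrier A" "b \<in> carrier A" "x \<in> carrier M"
  shows "(a \<ominus>\<^bsub>A\<^esub> b) \<odot>\<^bsub>M\<^esub> x = a \<odot>\<^bsub>M\<^esub> x \<ominus>\<^bsub>M\<^esub> b \<odot>\<^bsub>M\<^esub> x"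
  using assms by (simp add: a_minus_def smult_l_distr smult_l_minus)

end

definition left_submodule ::
    "('a, 'x) ring_scheme \<Rightarrow> 'm set \<Rightarrow> ('a, 'm, 'z) module_scheme \<Rightarrow> bool" where
  "left_submodule A N M \<longleftrightarrow> N \<subseteq> carrier M \<and> \<zero>\<^bsub>M\<^esub> \<in> N \<and>
     (\<forall>x \<in> N. \<forall>y \<in> N. x \<oplus>\<^bsub>M\<^esub> y \<in> N) \<and> (\<forall>a \<in> carrier A. \<forall>x \<in> N. a \<odot>\<^bsub>M\<^esub> x \<in> N)"

lemma left_moduleI:
  assumes "ring A" "abelian_group M"
    "\<And>a x. \<lbrakk>a \<in> carrier A; x \<in> carrier M\<rbrakk> \<Longrightarrow> a \<odot>\<^bsub>M\<^esub> x \<in> carrier M"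
    "\<And>a b x. \<lbrakk>a \<in> carrier A; b \<in> carrier A; x \<in> carrier M\<rbrakk> \<Longrightarrow>
        (a \<oplus>\<^bsub>A\<^esub> b) \<odot>\<^bsub>M\<^esub> x = a \<odot>\<^bsub>M\<^esub> x \<oplus>\<^bsub>M\<^esub> b \<odot>\<^bsub>M\<^esub> x"
    "\<And>a x y. \<lbrakk>a \<in> carrier A; x \<in> carrier M; y \<in> carrier M\<rbrakk> \<Longrightarrow>
        a \<odot>\<^bsub>M\<^esub> (x \<oplus>\<^bsub>M\<^esub> y) = a \<odot>\<^bsub>M\<^esub> x \<oplus>\<^bsub>M\<^esub> a \<odot>\<^bsub>M\<^esub> y"
    "\<And>a b x. \<lbrakk>a \<in> carrier A; b \<in> carrier A; x \<in> carrier M\<rbrakk> \<Longrightarrow>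
        (a \<otimes>\<^bsub>A\<^esub> b) \<odot>\<^bsub>M\<^esub> x = a \<odot>\<^bsub>M\<^esub> (b \<odot>\<^bsub>M\<^esub> x)"
    "\<And>x. x \<in> carrier M \<Longrightarrow> \<one>\<^bsub>A\<^esub> \<odot>\<^bsub>M\<^esub> x = x"
  shows "left_module A M"
  by (intro left_module.intro left_module_axioms.intro assms)

context left_module
begin

lemma left_submodule_neg:
  assumes "left_submodule A N M" "x \<in> N" shows "\<ominus>\<^bsub>M\<^esub> x \<in> N"
proof -
  have x: "x \<in> carrier M" using assms by (auto simp: left_submodule_def)
  then have "(\<ominus>\<^bsub>A\<^esub> \<one>\<^bsub>A\<^esub>) \<odot>\<^bsub>M\<^esub> x = \<ominus>\<^bsub>M\<^esub> x" by (simp add: smult_l_minus)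
  moreover have "(\<ominus>\<^bsub>A\<^esub> \<one>\<^bsub>A\<^esub>) \<odot>\<^bsub>M\<^esub> x \<in> N" using assms by (auto simp: left_submodule_def)
  ultimately show ?thesis by simp
qed

lemma left_submodule_additive:
  assumes N: "left_submodule A N M" shows "abelian_subgroup N M"
proof (rule abelian_subgroupI3)
  show "additive_subgroup N M"
  proof (rule additive_subgroupI, rule subgroup.intro)
    show "N \<subseteq> carrier (add_monoid M)" using N by (auto simp: left_submodule_def)
    show "\<And>x y. x \<in> N \<Longrightarrow> y \<in> N \<Longrightarrow> x \<otimes>\<^bsub>add_monoid M\<^esub> y \<in> N" using N by (auto simp: left_submodule_def)
    show "\<one>\<^bsub>add_monoid M\<^esub> \<in> N" using N by (auto simp: left_submodule_def)
    show "\<And>x. x \<in> N \<Longrightarrow> inv\<^bsub>add_monoid M\<^esub> x \<in> N"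
      using left_submodule_neg[OF N] by (simp add: a_inv_def)
  qed
  show "abelian_group M" by (rule M.abelian_group_axioms)
qed

lemma left_submodule_module:
  assumes N: "left_submodule A N M" shows "left_module A (M\<lparr>carrier := N\<rparr>)"
proof (rule left_moduleI)
  have sub: "\<And>x. x \<in> N \<Longrightarrow> x \<in> carrier M" using N by (auto simp: left_submodule_def)
  show "ring A" by (rule A.ring_axioms)
  show "abelian_group (M\<lparr>carrier := N\<rparr>)"
  proof (rule abelian_groupI)
    fix x assume "x \<in> carrier (M\<lparr>carrier := N\<rparr>)"
    then show "\<exists>y\<in>carrier (M\<lparr>carrier := N\<rparr>). y \<oplus>\<^bsub>M\<lparr>carrier := N\<rparr>\<^esub> x = \<zero>\<^bsub>M\<lparr>carrier := N\<rparr>\<^esub>"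
      using left_submodule_neg[OF N, of x] sub M.l_neg by auto
  next
    fix x y assume "x \<in> carrier (M\<lparr>carrier := N\<rparr>)" "y \<in> carrier (M\<lparr>carrier := N\<rparr>)"
    then show "x \<oplus>\<^bsub>M\<lparr>carrier := N\<rparr>\<^esub> y = y \<oplus>\<^bsub>M\<lparr>carrier := N\<rparr>\<^esub> x"
      using sub by (simp add: M.a_comm)
  qed (use N in \<open>auto simp: left_submodule_def sub M.a_assoc\<close>)
qed (use N in \<open>auto simp: left_submodule_def subset_iff smult_l_distr smult_r_distr smult_assoc\<close>)

lemma coset_eq_iff:
  assumes N: "left_submodule A N M" and "x \<in> carrier M" "y \<in> carrier M"
  shows "N +>\<^bsub>M\<^esub> x = N +>\<^bsub>M\<^esub> y \<longleftrightarrow> x \<ominus>\<^bsub>M\<^esub> y \<in> N"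
proof -
  interpret N: abelian_subgroup N M by (rule left_submodule_additive[OF N])
  have "N +>\<^bsub>M\<^esub> x = N +>\<^bsub>M\<^esub> y \<longleftrightarrow> x \<in> N +>\<^bsub>M\<^esub> y"
    using N.a_repr_independence'[of x y] N.a_rcos_self[of x] assms(2,3) by auto
  then show ?thesis using N.a_rcos_module[OF assms(3,2)] by (simp add: a_minus_def)
qed

lemma smult_coset:
  assumes N: "left_submodule A N M" and a: "a \<in> carrier A" and x: "x \<in> carrier M"
  shows "a \<odot>\<^bsub>quot_module M N\<^esub> (N +>\<^bsub>M\<^esub> x) = N +>\<^bsub>M\<^esub> (a \<odot>\<^bsub>M\<^esub> x)"
proof -
  interpret N: abelian_subgroup N M by (rule left_submodule_additive[OF N])
  have "N +>\<^bsub>M\<^esub> (a \<odot>\<^bsub>M\<^esub> y) = N +>\<^bsub>M\<^esub> (a \<odot>\<^bsub>M\<^esub> x)" if "y \<in> N +>\<^bsub>M\<^esub> x" for y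
  proof -
    have y: "y \<in> carrier M" by (rule N.a_elemrcos_carrier[OF x that])
    have "y \<ominus>\<^bsub>M\<^esub> x \<in> N" using that N.a_rcos_module[OF x y] by (simp add: a_minus_def)
    then have "a \<odot>\<^bsub>M\<^esub> (y \<ominus>\<^bsub>M\<^esub> x) \<in> N" using N a by (auto simp: left_submodule_def)
    then show ?thesis using a x y by (simp add: coset_eq_iff[OF N] smult_r_diff)
  qed
  moreover have "x \<in> N +>\<^bsub>M\<^esub> x" by (rule N.a_rcos_self[OF x])
  ultimately have "(\<lambda>x. N +>\<^bsub>M\<^esub> (a \<odot>\<^bsub>M\<^esub> x)) ` (N +>\<^bsub>M\<^esub> x) = {N +>\<^bsub>M\<^esub> (a \<odot>\<^bsub>M\<^esub> x)}"
    by (metis (no_types, lifting) image_cong image_constant)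
  then show ?thesis by (simp add: quot_module_def)
qed

lemma quot_module_simps:
  assumes N: "left_submodule A N M"
  shows "carrier (quot_module M N) = (\<lambda>x. N +>\<^bsub>M\<^esub> x) ` carrier M"
    "\<zero>\<^bsub>quot_module M N\<^esub> = N +>\<^bsub>M\<^esub> \<zero>\<^bsub>M\<^esub>"
    "\<And>x y. \<lbrakk>x \<in> carrier M; y \<in> carrier M\<rbrakk> \<Longrightarrow>
      (N +>\<^bsub>M\<^esub> x) \<oplus>\<^bsub>quot_module M N\<^esub> (N +>\<^bsub>M\<^esub> y) = N +>\<^bsub>M\<^esub> (x \<oplus>\<^bsub>M\<^esub> y)"
proof -
  interpret N: abelian_subgroup N M by (rule left_submodule_additive[OF N])
  show "carrier (quot_module M N) = (\<lambda>x. N +>\<^bsub>M\<^esub> x) ` carrier M"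
    by (auto simp: quot_module_def A_RCOSETS_def')
  show "\<zero>\<^bsub>quot_module M N\<^esub> = N +>\<^bsub>M\<^esub> \<zero>\<^bsub>M\<^esub>"
    using M.a_coset_add_zero[OF N.a_subset] by (simp add: quot_module_def)
  show "\<And>x y. \<lbrakk>x \<in> carrier M; y \<in> carrier M\<rbrakk> \<Longrightarrow>
      (N +>\<^bsub>M\<^esub> x) \<oplus>\<^bsub>quot_module M N\<^esub> (N +>\<^bsub>M\<^esub> y) = N +>\<^bsub>M\<^esub> (x \<oplus>\<^bsub>M\<^esub> y)"
    by (simp add: quot_module_def N.a_rcos_sum)
qed

lemma quot_module:
  assumes N: "left_submodule A N M" shows "left_module A (quot_module M N)"
proof -
  note [simp] = quot_module_simps[OF N] smult_coset[OF N]
  show ?thesis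
  proof (rule left_moduleI)
    show "ring A" by (rule A.ring_axioms)
    show "abelian_group (quot_module M N)"
    proof (rule abelian_groupI)
      fix X assume "X \<in> carrier (quot_module M N)"
      then obtain x where x: "x \<in> carrier M" "X = N +>\<^bsub>M\<^esub> x" by auto
      show "\<exists>Y\<in>carrier (quot_module M N). Y \<oplus>\<^bsub>quot_module M N\<^esub> X = \<zero>\<^bsub>quot_module M N\<^esub>"
        by (rule bexI[of _ "N +>\<^bsub>M\<^esub> (\<ominus>\<^bsub>M\<^esub> x)"]) (use x in \<open>auto simp: M.l_neg\<close>)
    next
      fix X Y assume "X \<in> carrier (quot_module M N)" "Y \<in> carrier (quot_module M N)"
      then show "X \<oplus>\<^bsub>quot_module M N\<^esub> Y = Y \<oplus>\<^bsub>quot_module M N\<^esub> X"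
        by (auto simp: M.a_comm)
    qed (auto simp: M.a_assoc)
  qed (auto simp: smult_l_distr smult_r_distr smult_assoc)
qed

lemma quot_map_hom:
  assumes N: "left_submodule A N M"
  shows "(\<lambda>x. N +>\<^bsub>M\<^esub> x) \<in> module_hom A M (quot_module M N)"
  using quot_module_simps[OF N] smult_coset[OF N] by (auto simp: module_hom_def)

end

lemma hom_zero:
  assumes "left_module A M" "left_module A N" "T \<in> module_hom A M N"
  shows "T \<zero>\<^bsub>M\<^esub> = \<zero>\<^bsub>N\<^esub>"
proof -
  interpret M: left_module A M by fact
  interpret N: left_module A N by fact
  have "T \<zero>\<^bsub>M\<^esub> = T (\<zero>\<^bsub>A\<^esub> \<odot>\<^bsub>M\<^esub> \<zero>\<^bsub>M\<^esub>)" by simp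
  also have "\<dots> = \<zero>\<^bsub>A\<^esub> \<odot>\<^bsub>N\<^esub> T \<zero>\<^bsub>M\<^esub>"
    using module_hom_smult[OF assms(3) M.A.zero_closed M.M.zero_closed] by simp
  also have "\<dots> = \<zero>\<^bsub>N\<^esub>" using module_hom_closed[OF assms(3)] M.M.zero_closed N.smult_l_null by blast
  finally show ?thesis .
qed

lemma hom_kernel_submodule:
  assumes M: "left_module A M" and N: "left_module A N" and T: "T \<in> module_hom A M N"
  shows "left_submodule A {x \<in> carrier M. T x = \<zero>\<^bsub>N\<^esub>} M"
proof -
  interpret M: left_module A M by fact
  interpret N: left_module A N by fact
  show ?thesis using hom_zero[OF M N T] T
    by (auto simp: left_submodule_def module_hom_def)
qed

lemma hom_image_submodule:
  assumes M: "left_module A M" and N: "left_module A N" and T: "T \<in> module_hom A M N"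
  shows "left_submodule A (T ` carrier M) N"
proof -
  interpret M: left_module A M by fact
  interpret N: left_module A N by fact
  have "\<zero>\<^bsub>N\<^esub> \<in> T ` carrier M" using hom_zero[OF M N T] M.M.zero_closed by (metis imageI)
  moreover have "T x \<oplus>\<^bsub>N\<^esub> T y \<in> T ` carrier M" if "x \<in> carrier M" "y \<in> carrier M" for x y
    using module_hom_add[OF T that] that by (metis M.M.a_closed imageI)
  moreover have "a \<odot>\<^bsub>N\<^esub> T x \<in> T ` carrier M" if "a \<in> carrier A" "x \<in> carrier M" for a x
    using module_hom_smult[OF T that] that by (metis M.smult_closed imageI)
  ultimately show ?thesis using module_hom_closed[OF T] by (auto simp: left_submodule_def)
qed

definition prod_module :: "'i set \<Rightarrow> ('i \<Rightarrow> ('a, 'm, 'z) module_scheme) \<Rightarrow> ('a, 'i \<Rightarrow> 'm) module" where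
  "prod_module I L =
     \<lparr>carrier = (\<Pi>\<^sub>E i \<in> I. carrier (L i)), mult = undefined, one = undefined,
      zero = (\<lambda>i \<in> I. \<zero>\<^bsub>L i\<^esub>),
      add = (\<lambda>\<alpha> \<beta>. \<lambda>i \<in> I. \<alpha> i \<oplus>\<^bsub>L i\<^esub> \<beta> i),
      smult = (\<lambda>\<delta> \<alpha>. \<lambda>i \<in> I. \<delta> \<odot>\<^bsub>L i\<^esub> \<alpha> i)\<rparr>"

lemma prod_module_left_module:
  assumes A: "ring A" and L: "\<And>i. i \<in> I \<Longrightarrow> left_module A (L i)"
  shows "left_module A (prod_module I L)"
proof (rule left_moduleI)
  note ax = left_module.axioms(2)[OF L] 
  note ag = abelian_group.axioms(1)[OF ax]
  show "abelian_group (prod_module I L)"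
  proof (rule abelian_groupI)
    fix x assume x: "x \<in> carrier (prod_module I L)"
    show "\<exists>y\<in>carrier (prod_module I L). y \<oplus>\<^bsub>prod_module I L\<^esub> x = \<zero>\<^bsub>prod_module I L\<^esub>"
      by (rule bexI[of _ "\<lambda>i\<in>I. \<ominus>\<^bsub>L i\<^esub> x i"])
        (use x in \<open>auto simp: prod_module_def PiE_iff abelian_group.l_neg[OF ax] abelian_group.a_inv_closed[OF ax] intro!: restrict_ext\<close>)
  next
    fix x assume x: "x \<in> carrier (prod_module I L)"
    show "\<zero>\<^bsub>prod_module I L\<^esub> \<oplus>\<^bsub>prod_module I L\<^esub> x = x" 
      by (rule extensionalityI[of _ I]) (use x in \<open>auto simp: prod_module_def PiE_iff abelian_monoid.l_zero[OF ag]\<close>)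
  next
    fix x y assume "x \<in> carrier (prod_module I L)" "y \<in> carrier (prod_module I L)"
    then show "x \<oplus>\<^bsub>prod_module I L\<^esub> y = y \<oplus>\<^bsub>prod_module I L\<^esub> x"
      by (auto simp: prod_module_def PiE_iff abelian_monoid.a_comm[OF ag] intro!: restrict_ext)
  qed (auto simp: prod_module_def PiE_iff abelian_monoid.a_closed[OF ag] abelian_monoid.zero_closed[OF ag]
        abelian_monoid.a_assoc[OF ag] intro!: restrict_ext)
next
  fix x assume x: "x \<in> carrier (prod_module I L)"
  show "\<one>\<^bsub>A\<^esub> \<odot>\<^bsub>prod_module I L\<^esub> x = x"
    by (rule extensionalityI[of _ I]) (use x in \<open>auto simp: prod_module_def PiE_iff left_module.smult_one[OF L]\<close>)
qed (auto simp: prod_module_def PiE_iff A left_module.smult_closed[OF L] left_module.smult_l_distr[OF L]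
      left_module.smult_r_distr[OF L] left_module.smult_assoc[OF L] intro!: restrict_ext)

text \<open>Bases of the factors, included into the product, together span the product of the subspaces: a
  vector is the sum of its coordinates, which are added one index at a time.\<close>

lemma prod_module_fin_dim:
  assumes I: "finite I" and PV: "vectorspace K (prod_module I V)"
    and W: "\<And>i. i \<in> I \<Longrightarrow> fin_dim_subspace K (V i) (W i)"
  shows "fin_dim_subspace K (prod_module I V) (Pi\<^sub>E I W)"
    "vectorspace.dim K ((prod_module I V)\<lparr>carrier := Pi\<^sub>E I W\<rparr>)
       \<le> (\<Sum>i\<in>I. vectorspace.dim K ((V i)\<lparr>carrier := W i\<rparr>))"
proof -
  let ?P = "prod_module I V"
  interpret P: vectorspace K ?P by fact
  note WD = fin_dim_subspaceD[OF W]
  define \<iota> where "\<iota> i b = (\<lambda>j\<in>I. if j = i then b else \<zero>\<^bsub>V j\<^esub>)" for i b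
  have V0: "\<zero>\<^bsub>V j\<^esub> \<oplus>\<^bsub>V j\<^esub> \<zero>\<^bsub>V j\<^esub> = \<zero>\<^bsub>V j\<^esub>" "\<zero>\<^bsub>V j\<^esub> \<in> carrier (V j)"
    "\<And>c. c \<in> carrier K \<Longrightarrow> c \<odot>\<^bsub>V j\<^esub> \<zero>\<^bsub>V j\<^esub> = \<zero>\<^bsub>V j\<^esub>"
    "\<And>x. x \<in> carrier (V j) \<Longrightarrow> \<zero>\<^bsub>V j\<^esub> \<oplus>\<^bsub>V j\<^esub> x = x"
    "\<And>x. x \<in> carrier (V j) \<Longrightarrow> x \<oplus>\<^bsub>V j\<^esub> \<zero>\<^bsub>V j\<^esub> = x" if "j \<in> I" for j
  proof -
    interpret Vj: vectorspace K "V j" by (rule WD(1)[OF that])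
    show "\<zero>\<^bsub>V j\<^esub> \<oplus>\<^bsub>V j\<^esub> \<zero>\<^bsub>V j\<^esub> = \<zero>\<^bsub>V j\<^esub>" "\<zero>\<^bsub>V j\<^esub> \<in> carrier (V j)"
    "\<And>c. c \<in> carrier K \<Longrightarrow> c \<odot>\<^bsub>V j\<^esub> \<zero>\<^bsub>V j\<^esub> = \<zero>\<^bsub>V j\<^esub>"
    "\<And>x. x \<in> carrier (V j) \<Longrightarrow> \<zero>\<^bsub>V j\<^esub> \<oplus>\<^bsub>V j\<^esub> x = x"
    "\<And>x. x \<in> carrier (V j) \<Longrightarrow> x \<oplus>\<^bsub>V j\<^esub> \<zero>\<^bsub>V j\<^esub> = x" by auto
  qed
  have \<iota>: "\<iota> i \<in> module_hom K (V i) ?P" if "i \<in> I" for i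
    unfolding module_hom_def \<iota>_def prod_module_def using V0
    by (auto simp: PiE_iff intro!: restrict_ext)
  have "\<forall>i\<in>I. \<exists>B. finite B \<and> B \<subseteq> W i \<and> W i = module.span K (V i) B \<and>
    card B = vectorspace.dim K ((V i)\<lparr>carrier := W i\<rparr>)"
    using fin_dim_subspaceE[OF W] by metis
  then obtain B where B: "\<And>i. i \<in> I \<Longrightarrow> finite (B i)" "\<And>i. i \<in> I \<Longrightarrow> B i \<subseteq> W i"
      "\<And>i. i \<in> I \<Longrightarrow> W i = module.span K (V i) (B i)"
      "\<And>i. i \<in> I \<Longrightarrow> card (B i) = vectorspace.dim K ((V i)\<lparr>carrier := W i\<rparr>)" by metis
  define BB where "BB = (\<Union>i\<in>I. \<iota> i ` B i)"
  have BBc: "BB \<subseteq> carrier ?P"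
    using B(2) WD(3) module_hom_closed[OF \<iota>] unfolding BB_def by blast
  have finBB: "finite BB" unfolding BB_def using I B(1) by blast
  have "card BB \<le> (\<Sum>i\<in>I. card (\<iota> i ` B i))" unfolding BB_def by (rule card_UN_le[OF I])
  also have "\<dots> \<le> (\<Sum>i\<in>I. card (B i))" by (rule sum_mono) (simp add: B(1) card_image_le)
  finally have cardBB: "card BB \<le> (\<Sum>i\<in>I. vectorspace.dim K ((V i)\<lparr>carrier := W i\<rparr>))"
    using B(4) by simp
  interpret S: submodule K "P.span BB" ?P by (rule P.span_is_submodule[OF BBc])
  have \<iota>S: "\<iota> i w \<in> P.span BB" if i: "i \<in> I" and w: "w \<in> W i" for i w
  proof -
    interpret Vi: vectorspace K "V i" by (rule WD(1)[OF i])
    interpret T: mod_hom K "V i" ?P "\<iota> i" by unfold_locales (rule \<iota>[OF i])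
    have "Vi.span (B i) \<subseteq> {v \<in> carrier (V i). \<iota> i v \<in> P.span BB}"
    proof (rule Vi.span_is_subset)
      have "\<iota> i b \<in> P.span BB" if "b \<in> B i" for b
        using P.in_own_span[OF BBc] that i by (auto simp: BB_def)
      then show "B i \<subseteq> {v \<in> carrier (V i). \<iota> i v \<in> P.span BB}" using B(2)[OF i] WD(3)[OF i] by auto
    qed (rule T.preimage_submodule[OF P.span_is_submodule[OF BBc]])
    then show ?thesis using B(3)[OF i] w by auto
  qed
  have span: "x \<in> P.span BB" if "J \<subseteq> I" "x \<in> Pi\<^sub>E I W" "\<And>i. i \<in> I - J \<Longrightarrow> x i = \<zero>\<^bsub>V i\<^esub>" for J x
    using finite_subset[OF that(1) I] that
  proof (induction J arbitrary: x rule: finite_induct)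
    case empty
    have "x = \<zero>\<^bsub>?P\<^esub>"
      by (rule extensionalityI[of _ I]) (use empty in \<open>auto simp: prod_module_def PiE_iff\<close>)
    then show ?case by simp
  next
    case (insert j J)
    have j: "j \<in> I" using insert.prems(1) by simp
    define y where "y = x(j := \<zero>\<^bsub>V j\<^esub>)"
    have xW: "x i \<in> W i" "x i \<in> carrier (V i)" if "i \<in> I" for i
      using insert.prems(2) that WD(3)[OF that] by auto
    have xe: "x \<in> extensional I" using insert.prems(2) by (simp add: PiE_def)
    have W0: "\<zero>\<^bsub>V j\<^esub> \<in> W j" using WD(2)[OF j] by (simp add: submodule_def)
    have "y \<in> P.span BB"
      by (rule insert.IH) (use insert.prems insert.hyps(2) j W0 in \<open>auto simp: y_def PiE_iff extensional_def\<close>)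
    moreover have "\<iota> j (x j) \<in> P.span BB" by (rule \<iota>S[OF j xW(1)[OF j]])
    ultimately have "\<iota> j (x j) \<oplus>\<^bsub>?P\<^esub> y \<in> P.span BB" by simp
    moreover have "\<iota> j (x j) \<oplus>\<^bsub>?P\<^esub> y = x"
      by (rule extensionalityI[of _ I]) (use xW xe V0 in \<open>auto simp: prod_module_def \<iota>_def y_def\<close>)
    ultimately show ?case by simp
  qed
  have sub: "Pi\<^sub>E I W \<subseteq> P.span BB" using span[of I] by auto
  have sm: "submodule K (Pi\<^sub>E I W) ?P"
  proof (unfold_locales)
    show "Pi\<^sub>E I W \<subseteq> carrier ?P" using WD(3) by (auto simp: prod_module_def PiE_iff)
  qed (use WD(2) in \<open>auto simp: prod_module_def PiE_iff submodule_def\<close>)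
  show "fin_dim_subspace K ?P (Pi\<^sub>E I W)"
    "vectorspace.dim K (?P\<lparr>carrier := Pi\<^sub>E I W\<rparr>) \<le> (\<Sum>i\<in>I. vectorspace.dim K ((V i)\<lparr>carrier := W i\<rparr>))"
    using fin_dim_subspaceI[OF PV sm finBB BBc sub] cardBB by auto
qed

section \<open>Filtrations and Bernstein's inequality\<close>

lemma hom_vanish_span:
  assumes "vectorspace K V" "vectorspace K W" "T \<in> module_hom K V W"
    and B: "B \<subseteq> carrier V" "\<And>b. b \<in> B \<Longrightarrow> T b = \<zero>\<^bsub>W\<^esub>" and x: "x \<in> module.span K V B"
  shows "T x = \<zero>\<^bsub>W\<^esub>"
proof -
  interpret V: vectorspace K V by fact
  interpret W: vectorspace K W by fact
  interpret mod_hom K V W T by unfold_locales (rule assms(3))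
  have "V.span B \<subseteq> ker"
    by (rule V.span_is_subset[OF _ ker_is_submodule]) (use B in \<open>auto simp: ker_def\<close>)
  then show ?thesis using x by (auto simp: ker_def)
qed

text \<open>The noncommutative counterpart of \<^locale>\<open>algebra\<close>, with compatibility of scalars required on
  both sides.\<close>

locale field_algebra = V: vectorspace K A + A: ring A
  for K :: "('k, 'x) ring_scheme" and A :: "('k, 'a, 'y) module_scheme" +
  assumes smult_mult: "\<lbrakk>c \<in> carrier K; a \<in> carrier A; b \<in> carrier A\<rbrakk> \<Longrightarrow>
      (c \<odot>\<^bsub>A\<^esub> a) \<otimes>\<^bsub>A\<^esub> b = c \<odot>\<^bsub>A\<^esub> (a \<otimes>\<^bsub>A\<^esub> b)"
    and mult_smult: "\<lbrakk>c \<in> carrier K; a \<in> carrier A; b \<in> carrier A\<rbrakk> \<Longrightarrow>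
      a \<otimes>\<^bsub>A\<^esub> (c \<odot>\<^bsub>A\<^esub> b) = c \<odot>\<^bsub>A\<^esub> (a \<otimes>\<^bsub>A\<^esub> b)"
begin

lemma scalar_closed: "c \<in> carrier K \<Longrightarrow> c \<odot>\<^bsub>A\<^esub> \<one>\<^bsub>A\<^esub> \<in> carrier A"
  by (rule V.smult_closed) auto

lemma scalar_mult: "c \<in> carrier K \<Longrightarrow> a \<in> carrier A \<Longrightarrow> (c \<odot>\<^bsub>A\<^esub> \<one>\<^bsub>A\<^esub>) \<otimes>\<^bsub>A\<^esub> a = c \<odot>\<^bsub>A\<^esub> a"
  by (simp add: smult_mult)

lemma mult_scalar: "c \<in> carrier K \<Longrightarrow> a \<in> carrier A \<Longrightarrow> a \<otimes>\<^bsub>A\<^esub> (c \<odot>\<^bsub>A\<^esub> \<one>\<^bsub>A\<^esub>) = c \<odot>\<^bsub>A\<^esub> a"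
  by (simp add: mult_smult)

lemma restrict_scalars_simps [simp]:
  "carrier (restrict_scalars A N) = carrier N" "\<zero>\<^bsub>restrict_scalars A N\<^esub> = \<zero>\<^bsub>N\<^esub>"
  "add (restrict_scalars A N) = add N"
  "c \<odot>\<^bsub>restrict_scalars A N\<^esub> v = (c \<odot>\<^bsub>A\<^esub> \<one>\<^bsub>A\<^esub>) \<odot>\<^bsub>N\<^esub> v"
  by (simp_all add: restrict_scalars_def)

lemma restrict_scalars_vectorspace:
  assumes "left_module A N" shows "vectorspace K (restrict_scalars A N)"
proof -
  interpret N: left_module A N by fact
  show ?thesis
  proof (rule vectorspace.intro, rule moduleI)
    show "cring K" "field K" by unfold_locales
    show "abelian_group (restrict_scalars A N)"
    proof (rule abelian_groupI)
      fix x assume "x \<in> carrier (restrict_scalars A N)"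
      then show "\<exists>y\<in>carrier (restrict_scalars A N).
          y \<oplus>\<^bsub>restrict_scalars A N\<^esub> x = \<zero>\<^bsub>restrict_scalars A N\<^esub>"
        using N.M.l_neg N.M.a_inv_closed by auto
    next
      fix x y assume "x \<in> carrier (restrict_scalars A N)" "y \<in> carrier (restrict_scalars A N)"
      then show "x \<oplus>\<^bsub>restrict_scalars A N\<^esub> y = y \<oplus>\<^bsub>restrict_scalars A N\<^esub> x"
        by (simp add: N.M.a_comm)
    qed (simp_all add: N.M.a_assoc)
    fix a b x assume ab: "a \<in> carrier K" "b \<in> carrier K" and x: "x \<in> carrier (restrict_scalars A N)"
    show "(a \<otimes>\<^bsub>K\<^esub> b) \<odot>\<^bsub>restrict_scalars A N\<^esub> x = a \<odot>\<^bsub>restrict_scalars A N\<^esub> (b \<odot>\<^bsub>restrict_scalars A N\<^esub> x)"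
      using ab x scalar_closed scalar_mult[of a "b \<odot>\<^bsub>A\<^esub> \<one>\<^bsub>A\<^esub>"]
      by (simp add: N.smult_assoc[symmetric] V.smult_assoc1)
  qed (auto simp: scalar_closed N.smult_l_distr N.smult_r_distr V.smult_l_distr)
qed

lemma restrict_scalars_hom:
  assumes "T \<in> module_hom A M N"
  shows "T \<in> module_hom K (restrict_scalars A M) (restrict_scalars A N)"
  using assms scalar_closed by (auto simp: module_hom_def)

lemma restrict_scalars_submodule:
  assumes "left_module A M" "left_submodule A N M"
  shows "submodule K N (restrict_scalars A M)"
proof -
  interpret RM: vectorspace K "restrict_scalars A M" by (rule restrict_scalars_vectorspace[OF assms(1)])
  show ?thesis
    by unfold_locales (use assms(2) scalar_closed in \<open>auto simp: left_submodule_def\<close>)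
qed

lemma restrict_scalars_update:
  "restrict_scalars A (M\<lparr>carrier := N\<rparr>) = (restrict_scalars A M)\<lparr>carrier := N\<rparr>"
  by (simp add: restrict_scalars_def)

lemma restrict_scalars_prod:
  "restrict_scalars A (prod_module I L) = prod_module I (\<lambda>i. restrict_scalars A (L i))"
  by (simp add: restrict_scalars_def prod_module_def)

lemma act_hom:
  assumes "left_module A N" "v \<in> carrier N"
  shows "(\<lambda>a. a \<odot>\<^bsub>N\<^esub> v) \<in> module_hom K A (restrict_scalars A N)"
proof -
  interpret N: left_module A N by fact
  have "(c \<odot>\<^bsub>A\<^esub> a) \<odot>\<^bsub>N\<^esub> v = (c \<odot>\<^bsub>A\<^esub> \<one>\<^bsub>A\<^esub>) \<odot>\<^bsub>N\<^esub> (a \<odot>\<^bsub>N\<^esub> v)" if "c \<in> carrier K" "a \<in> carrier A" for c a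
    using that assms(2) by (simp add: N.smult_assoc[symmetric] scalar_closed scalar_mult)
  then show ?thesis using assms(2) by (auto simp: module_hom_def N.smult_l_distr)
qed

lemma act_hom_right:
  assumes "left_module A N" "a \<in> carrier A"
  shows "(\<lambda>v. a \<odot>\<^bsub>N\<^esub> v) \<in> module_hom K (restrict_scalars A N) (restrict_scalars A N)"
proof -
  interpret N: left_module A N by fact
  have "a \<odot>\<^bsub>N\<^esub> ((c \<odot>\<^bsub>A\<^esub> \<one>\<^bsub>A\<^esub>) \<odot>\<^bsub>N\<^esub> v) = (c \<odot>\<^bsub>A\<^esub> \<one>\<^bsub>A\<^esub>) \<odot>\<^bsub>N\<^esub> (a \<odot>\<^bsub>N\<^esub> v)"
    if "c \<in> carrier K" "v \<in> carrier N" for c v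
    using that assms(2) by (simp add: N.smult_assoc[symmetric] scalar_closed scalar_mult mult_scalar)
  then show ?thesis using assms(2) by (auto simp: module_hom_def N.smult_r_distr)
qed

end

lemma exhaustive_mono:
  assumes "exhaustive_fin_dim_sequence K V G" "i \<le> j" shows "G i \<subseteq> G j"
  using lift_Suc_mono_le[of G i j] assms by (auto simp: exhaustive_fin_dim_sequence_def)

lemma dim_at_mono:
  assumes G: "exhaustive_fin_dim_sequence K V G" and ij: "i \<le> j"
  shows "dim_at K V G i \<le> dim_at K V G j"
proof -
  have fd: "\<And>i. fin_dim_subspace K V (G i)" using G by (auto simp: exhaustive_fin_dim_sequence_def)
  show ?thesis unfolding dim_at_def
    by (rule fin_dim_subspace_subset(2)[OF fd fin_dim_subspaceD(2)[OF fd] exhaustive_mono[OF G ij]])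
qed

text \<open>An upper bound on the growth only: \<open>t\<close> may exceed the dimension of the filtration.\<close>

definition poly_growth ::
    "('k, 'x) ring_scheme \<Rightarrow> ('k, 'v, 'y) module_scheme \<Rightarrow> (nat \<Rightarrow> 'v set) \<Rightarrow> real \<Rightarrow> bool" where
  "poly_growth K V G t \<longleftrightarrow>
     (\<exists>C. \<forall>\<^sub>F i in sequentially. real (dim_at K V G i) \<le> C * real i powr t)"

lemma filtration_dim_nonneg: "0 \<le> filtration_dim K V G"
  unfolding filtration_dim_def by (rule Inf_greatest) auto

lemma filtration_dim_le:
  assumes "0 \<le> t" "poly_growth K V G t" shows "filtration_dim K V G \<le> ereal t"
  unfolding filtration_dim_def by (rule Inf_lower) (use assms in \<open>auto simp: poly_growth_def\<close>)

lemma filtration_dim_less: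
  assumes "filtration_dim K V G < c"
  obtains t where "0 \<le> t" "ereal t < c" "poly_growth K V G t"
  using assms unfolding filtration_dim_def Inf_less_iff poly_growth_def by auto

lemma poly_growth_scale:
  assumes "poly_growth K V G t" "0 < b" and le: "\<And>i. dim_at K W H i \<le> dim_at K V G (b * i)"
  shows "poly_growth K W H t"
proof -
  obtain C where "\<forall>\<^sub>F i in sequentially. real (dim_at K V G i) \<le> C * real i powr t"
    using assms(1) by (auto simp: poly_growth_def)
  then obtain n where n: "\<And>i. n \<le> i \<Longrightarrow> real (dim_at K V G i) \<le> C * real i powr t"
    by (auto simp: eventually_sequentially)
  have "real (dim_at K W H i) \<le> (C * real b powr t) * real i powr t" if "n \<le> i" for i
  proof -
    have "1 * i \<le> b * i" using assms(2) by (intro mult_le_mono) auto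
    then have bi: "n \<le> b * i" using that by linarith
    have "real (dim_at K W H i) \<le> real (dim_at K V G (b * i))" using le by simp
    also have "\<dots> \<le> C * real (b * i) powr t" by (rule n[OF bi])
    finally show ?thesis by (simp add: powr_mult mult.assoc)
  qed
  then show ?thesis unfolding poly_growth_def eventually_sequentially by blast
qed

lemma poly_growth_mono:
  assumes "poly_growth K V G t" "\<And>i. dim_at K W H i \<le> dim_at K V G i"
  shows "poly_growth K W H t"
  by (rule poly_growth_scale[OF assms(1), of 1]) (simp_all add: assms(2))

locale linearly_simple_algebra = field_algebra K A
  for K :: "('k, 'x) ring_scheme" and A :: "('k, 'a, 'y) module_scheme" +
  fixes F :: "nat \<Rightarrow> 'a set"
  assumes filt: "algebra_filtration K A F"
    and simple: "linearly_simple K A F"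
    and dim_finite: "filtration_dim K A F < \<infinity>"
begin

lemma filt_exhaustive: "exhaustive_fin_dim_sequence K A F"
  using filt by (simp add: algebra_filtration_def)

lemma filt_carrier: "a \<in> F i \<Longrightarrow> a \<in> carrier A"
  using filt_exhaustive by (auto simp: exhaustive_fin_dim_sequence_def)

lemma compatible_carrier: "compatible_filtration K A F N G \<Longrightarrow> v \<in> G i \<Longrightarrow> v \<in> carrier N"
  by (auto simp: compatible_filtration_def exhaustive_fin_dim_sequence_def)

text \<open>If \<open>\<delta> \<in> F\<^sup>i\<close> annihilates \<open>G\<^bsup>Ci + i\<^sub>0\<^esup>\<close>, then \<open>F\<^bsup>Ci\<^esup> \<delta> F\<^bsup>Ci\<^esup>\<close> annihilates \<open>x\<^sub>0 \<in> G\<^bsup>i\<^sub>0\<^esup>\<close>; by linear simplicity this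
  product contains \<open>1\<close> unless \<open>\<delta> = 0\<close>. So an element of \<open>F\<^sup>i\<close> is determined by its action on a basis of
  \<open>G\<^bsup>Ci + i\<^sub>0\<^esup>\<close>, whose values lie in \<open>G\<^bsup>(C + 1)i + i\<^sub>0\<^esup>\<close>. For \<open>i > 0\<close>, both
  indices are at most \<open>ci\<close> with \<open>c = C + 1 + i\<^sub>0\<close>.\<close>

lemma dim_le_square:
  assumes N: "left_module A N" and nz: "x0 \<in> G i0" "x0 \<noteq> \<zero>\<^bsub>N\<^esub>"
    and G: "compatible_filtration K A F N G"
  obtains c where "0 < c"
    "\<And>i. 0 < i \<Longrightarrow> dim_at K A F i \<le> dim_at K (restrict_scalars A N) G (c * i) * dim_at K (restrict_scalars A N) G (c * i)"
proof -
  interpret N: left_module A N by fact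
  let ?N = "restrict_scalars A N"
  have vsN: "vectorspace K ?N" by (rule restrict_scalars_vectorspace[OF N])
  have ex: "exhaustive_fin_dim_sequence K ?N G" and
    act: "\<And>i j a v. a \<in> F i \<Longrightarrow> v \<in> G j \<Longrightarrow> a \<odot>\<^bsub>N\<^esub> v \<in> G (i + j)"
    using G by (auto simp: compatible_filtration_def)
  have fdG: "\<And>i. fin_dim_subspace K ?N (G i)" using ex by (auto simp: exhaustive_fin_dim_sequence_def)
  have fdF: "\<And>i. fin_dim_subspace K A (F i)" using filt_exhaustive by (auto simp: exhaustive_fin_dim_sequence_def)
  note Gc = compatible_carrier[OF G]
  obtain C where C: "0 < C" and one: "\<And>i \<delta>. \<lbrakk>\<delta> \<in> F i; \<delta> \<noteq> \<zero>\<^bsub>A\<^esub>\<rbrakk> \<Longrightarrow> \<one>\<^bsub>A\<^esub> \<in> module.span K A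
           {a \<otimes>\<^bsub>A\<^esub> \<delta> \<otimes>\<^bsub>A\<^esub> b | a b. a \<in> F (C * i) \<and> b \<in> F (C * i)}"
    using simple unfolding linearly_simple_def by auto
  have main: "dim_at K A F i \<le> dim_at K ?N G (C * i + i0) * dim_at K ?N G (i + (C * i + i0))" for i
  proof -
    let ?U = "G (C * i + i0)"
    obtain B where B: "finite B" "B \<subseteq> ?U" "?U = module.span K ?N B"
      "card B = vectorspace.dim K (?N\<lparr>carrier := ?U\<rparr>)" by (rule fin_dim_subspaceE[OF fdG])
    obtain bs where bs: "set bs = B" "distinct bs" using finite_distinct_list[OF B(1)] by auto
    have "vectorspace.dim K (A\<lparr>carrier := F i\<rparr>) \<le>
        length bs * vectorspace.dim K (?N\<lparr>carrier := G (i + (C * i + i0))\<rparr>)"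
    proof (rule dim_le_separating[where T = "\<lambda>b a. a \<odot>\<^bsub>N\<^esub> b", OF vsN fdF fdG])
      fix b assume b: "b \<in> set bs"
      then show "(\<lambda>a. a \<odot>\<^bsub>N\<^esub> b) \<in> module_hom K A ?N"
        using bs(1) B(2) Gc by (intro act_hom[OF N]) auto
      show "\<And>w. w \<in> F i \<Longrightarrow> w \<odot>\<^bsub>N\<^esub> b \<in> G (i + (C * i + i0))" using act b bs(1) B(2) by auto
    next
      fix w assume w: "w \<in> F i" and kills: "\<And>b. b \<in> set bs \<Longrightarrow> w \<odot>\<^bsub>N\<^esub> b = \<zero>\<^bsub>?N\<^esub>"
      have wc: "w \<in> carrier A" by (rule filt_carrier[OF w])
      have U: "w \<odot>\<^bsub>N\<^esub> u = \<zero>\<^bsub>N\<^esub>" if "u \<in> ?U" for u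
      proof -
        have "B \<subseteq> carrier ?N" using B(2) Gc by auto
        moreover have "w \<odot>\<^bsub>N\<^esub> b = \<zero>\<^bsub>?N\<^esub>" if "b \<in> B" for b using kills that bs(1) by simp
        moreover have "u \<in> module.span K ?N B" using that B(3) by simp
        ultimately have "w \<odot>\<^bsub>N\<^esub> u = \<zero>\<^bsub>?N\<^esub>"
          by (rule hom_vanish_span[OF vsN vsN act_hom_right[OF N wc]])
        then show ?thesis by simp
      qed
      show "w = \<zero>\<^bsub>A\<^esub>"
      proof (rule ccontr)
        assume w0: "w \<noteq> \<zero>\<^bsub>A\<^esub>"
        have x0: "x0 \<in> carrier N" by (rule Gc[OF nz(1)])
        have "\<one>\<^bsub>A\<^esub> \<odot>\<^bsub>N\<^esub> x0 = \<zero>\<^bsub>?N\<^esub>"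
        proof (rule hom_vanish_span[OF V.vectorspace_axioms vsN act_hom[OF N x0] _ _ one[OF w w0]])
          show "{a \<otimes>\<^bsub>A\<^esub> w \<otimes>\<^bsub>A\<^esub> b |a b. a \<in> F (C * i) \<and> b \<in> F (C * i)} \<subseteq> carrier A"
            using filt_carrier wc by auto
          fix c assume "c \<in> {a \<otimes>\<^bsub>A\<^esub> w \<otimes>\<^bsub>A\<^esub> b |a b. a \<in> F (C * i) \<and> b \<in> F (C * i)}"
          then obtain a b where ab: "c = a \<otimes>\<^bsub>A\<^esub> w \<otimes>\<^bsub>A\<^esub> b" "a \<in> F (C * i)" "b \<in> F (C * i)" by auto
          then show "c \<odot>\<^bsub>N\<^esub> x0 = \<zero>\<^bsub>?N\<^esub>"
            using U[OF act[OF ab(3) nz(1)]] filt_carrier wc x0 by (simp add: N.smult_assoc)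
        qed
        then show False using nz(2) x0 by simp
      qed
    qed
    moreover have "length bs = vectorspace.dim K (?N\<lparr>carrier := ?U\<rparr>)"
      using distinct_card[OF bs(2)] bs(1) B(4) by simp
    ultimately show ?thesis by (simp add: dim_at_def)
  qed
  show thesis
  proof (rule that[of "C + 1 + i0"])
    fix i :: nat assume i: "0 < i"
    have "i0 \<le> i0 * i" using i by simp
    then have le: "C * i + i0 \<le> (C + 1 + i0) * i" "i + (C * i + i0) \<le> (C + 1 + i0) * i"
      unfolding add_mult_distrib by linarith+
    show "dim_at K A F i \<le> dim_at K ?N G ((C + 1 + i0) * i) * dim_at K ?N G ((C + 1 + i0) * i)"
      by (rule order_trans[OF main mult_le_mono[OF dim_at_mono[OF ex le(1)] dim_at_mono[OF ex le(2)]]])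
  qed simp
qed

lemma poly_growth_square:
  assumes N: "left_module A N" and nz: "carrier N \<noteq> {\<zero>\<^bsub>N\<^esub>}"
    and G: "compatible_filtration K A F N G" and t: "poly_growth K (restrict_scalars A N) G t"
  shows "poly_growth K A F (2 * t)"
proof -
  interpret N: left_module A N by fact
  let ?N = "restrict_scalars A N"
  obtain x0 where x0: "x0 \<in> carrier N" "x0 \<noteq> \<zero>\<^bsub>N\<^esub>" using nz N.M.zero_closed by auto
  have "(\<Union>i. G i) = carrier N" using G by (auto simp: compatible_filtration_def exhaustive_fin_dim_sequence_def)
  then obtain i0 where i0: "x0 \<in> G i0" using x0(1) by auto
  obtain c where c: "0 < c" and sq: "\<And>i. 0 < i \<Longrightarrow> dim_at K A F i \<le> dim_at K ?N G (c * i) * dim_at K ?N G (c * i)"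
    using dim_le_square[OF N i0 x0(2) G] by metis
  obtain C where "\<forall>\<^sub>F i in sequentially. real (dim_at K ?N G i) \<le> C * real i powr t"
    using t by (auto simp: poly_growth_def)
  then obtain n where n: "\<And>i. n \<le> i \<Longrightarrow> real (dim_at K ?N G i) \<le> C * real i powr t"
    by (auto simp: eventually_sequentially)
  have "real (dim_at K A F i) \<le> (C * real c powr t)\<^sup>2 * real i powr (2 * t)" if i: "max n 1 \<le> i" for i
  proof -
    have "i * 1 \<le> i * c" using c by (intro mult_le_mono) auto
    then have ci: "n \<le> c * i" using i by (metis max.boundedE mult.commute nat_mult_1_right order_trans)
    have "real (dim_at K A F i) \<le> (real (dim_at K ?N G (c * i)))\<^sup>2"
      using of_nat_mono[OF sq[of i], where 'a = real] i by (simp add: power2_eq_square)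
    also have "\<dots> \<le> (C * real (c * i) powr t)\<^sup>2" by (rule power_mono[OF n[OF ci]]) simp
    also have "real (c * i) powr t = real c powr t * real i powr t" by (simp add: powr_mult)
    also have "(C * (real c powr t * real i powr t))\<^sup>2 = (C * real c powr t)\<^sup>2 * real i powr (2 * t)"
      by (simp add: power2_eq_square powr_add[symmetric] algebra_simps)
    finally show ?thesis .
  qed
  then show ?thesis unfolding poly_growth_def eventually_sequentially by blast
qed

definition half_dim :: real where "half_dim = real_of_ereal (filtration_dim K A F) / 2"

lemma filtration_dim_eq: "filtration_dim K A F = ereal (2 * half_dim)"
  using dim_finite filtration_dim_nonneg[of K A F] unfolding half_dim_def
  by (cases "filtration_dim K A F") auto

lemma half_dim_nonneg: "0 \<le> half_dim"
  using filtration_dim_nonneg[of K A F] filtration_dim_eq by simp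

text \<open>A filtration of exponent \<open>t < d/2\<close> would bound the growth of \<open>F\<close> by the exponent \<open>2t < d\<close>.\<close>

theorem bernstein_inequality:
  assumes N: "left_module A N" and nz: "carrier N \<noteq> {\<zero>\<^bsub>N\<^esub>}"
    and G: "compatible_filtration K A F N G"
  shows "ereal half_dim \<le> filtration_dim K (restrict_scalars A N) G"
proof (rule ccontr)
  assume "\<not> ?thesis"
  then have "filtration_dim K (restrict_scalars A N) G < ereal half_dim" by simp
  then obtain t where t: "0 \<le> t" "ereal t < ereal half_dim" "poly_growth K (restrict_scalars A N) G t"
    by (rule filtration_dim_less)
  have "filtration_dim K A F \<le> ereal (2 * t)"
    using filtration_dim_le[OF _ poly_growth_square[OF N nz G t(3)]] t(1) by simp
  then show False using t(2) by (simp add: filtration_dim_eq)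
qed

text \<open>Bernstein's inequality supplies the lower bound on the dimension, so the growth condition forces the
  dimension to be exactly \<open>d/2\<close>, and its constant bounds the multiplicity. The zero module, holonomic
  by convention, carries the filtration by zero spaces.\<close>

lemma holonomic_iff:
  "holonomic K A F N \<longleftrightarrow> left_module A N \<and>
     (\<exists>G. compatible_filtration K A F N G \<and> poly_growth K (restrict_scalars A N) G half_dim)"
  (is "_ \<longleftrightarrow> ?R")
proof -
  let ?N = "restrict_scalars A N"
  have half: "filtration_dim K A F / 2 = ereal half_dim"
    by (simp add: filtration_dim_eq)
  show ?thesis
  proof
    assume h: "holonomic K A F N"
    then have N: "left_module A N" by (simp add: holonomic_def)
    interpret N: left_module A N by fact
    interpret VN: vectorspace K ?N by (rule restrict_scalars_vectorspace[OF N])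
    show ?R
    proof (cases "carrier N = {\<zero>\<^bsub>N\<^esub>}")
      case True
      have "submodule K {\<zero>\<^bsub>N\<^esub>} ?N"
        by unfold_locales (auto simp: scalar_closed)
      moreover have "{\<zero>\<^bsub>N\<^esub>} \<subseteq> VN.span {}" using VN.span_empty by simp
      ultimately have z: "fin_dim_subspace K ?N {\<zero>\<^bsub>N\<^esub>}"
        "vectorspace.dim K (?N\<lparr>carrier := {\<zero>\<^bsub>N\<^esub>}\<rparr>) \<le> card ({} :: 'b set)"
        using fin_dim_subspaceI[OF VN.vectorspace_axioms, of "{\<zero>\<^bsub>N\<^esub>}" "{}"] by auto
      have "compatible_filtration K A F N (\<lambda>i. {\<zero>\<^bsub>N\<^esub>})"
        using z(1) True filt_carrier by (auto simp: compatible_filtration_def exhaustive_fin_dim_sequence_def)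
      moreover have "poly_growth K ?N (\<lambda>i. {\<zero>\<^bsub>N\<^esub>}) half_dim"
        unfolding poly_growth_def dim_at_def by (rule exI[of _ 0]) (use z(2) in simp)
      ultimately show ?thesis using N by blast
    next
      case False
      then obtain G where G: "compatible_filtration K A F N G"
        "filtration_dim K ?N G = ereal half_dim" "filtration_mult K ?N G < \<infinity>"
        using h half by (auto simp: holonomic_def)
      obtain C where C: "filtration_mult K ?N G < ereal C"
        using less_PInf_Ex_of_nat[of "filtration_mult K ?N G"] G(3) by auto
      have "\<forall>\<^sub>F i in sequentially. ereal (real (dim_at K ?N G i) / real i powr half_dim) < ereal C"
        using Limsup_lessD[OF C[unfolded filtration_mult_def]] G(2) by simp
      then have "\<forall>\<^sub>F i in sequentially. real (dim_at K ?N G i) \<le> C * real i powr half_dim"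
        using eventually_gt_at_top[of 0] by eventually_elim (simp add: field_simps)
      then show ?thesis using N G(1) unfolding poly_growth_def by blast
    qed
  next
    assume ?R
    then obtain G where N: "left_module A N" and G: "compatible_filtration K A F N G"
      and t: "poly_growth K ?N G half_dim" by auto
    show "holonomic K A F N"
    proof (cases "carrier N = {\<zero>\<^bsub>N\<^esub>}")
      case True then show ?thesis using N by (simp add: holonomic_def)
    next
      case False
      have d: "filtration_dim K ?N G = ereal half_dim"
        using bernstein_inequality[OF N False G] filtration_dim_le[OF half_dim_nonneg t] by simp
      obtain C where "\<forall>\<^sub>F i in sequentially. real (dim_at K ?N G i) \<le> C * real i powr half_dim"
        using t by (auto simp: poly_growth_def)
      then have "\<forall>\<^sub>F i in sequentially. ereal (real (dim_at K ?N G i) / real i powr half_dim) \<le> ereal C"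
        using eventually_gt_at_top[of 0] by eventually_elim (simp add: field_simps)
      then have "filtration_mult K ?N G \<le> ereal C"
        unfolding filtration_mult_def d by (intro Limsup_bounded) simp
      then have "filtration_mult K ?N G < \<infinity>" by (rule le_less_trans) simp
      then show ?thesis using N G d half by (auto simp: holonomic_def)
    qed
  qed
qed

lemma holonomic_submodule:
  assumes M: "holonomic K A F M" and N: "left_submodule A N M"
  shows "holonomic K A F (M\<lparr>carrier := N\<rparr>)"
proof -
  obtain G where lm: "left_module A M" and G: "compatible_filtration K A F M G"
    and t: "poly_growth K (restrict_scalars A M) G half_dim" using M holonomic_iff by blast
  interpret M: left_module A M by fact
  let ?M = "restrict_scalars A M" and ?N = "restrict_scalars A (M\<lparr>carrier := N\<rparr>)"
  have fdG: "\<And>i. fin_dim_subspace K ?M (G i)" and ex: "(\<Union>i. G i) = carrier M" and mono: "\<And>i. G i \<subseteq> G (Suc i)"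
    using G by (auto simp: compatible_filtration_def exhaustive_fin_dim_sequence_def)
  have lmN: "left_module A (M\<lparr>carrier := N\<rparr>)" by (rule M.left_submodule_module[OF N])
  have vsN: "vectorspace K ?N" by (rule restrict_scalars_vectorspace[OF lmN])
  have NM: "N \<subseteq> carrier M" using N by (simp add: left_submodule_def)
  have smN: "submodule K N ?M" by (rule restrict_scalars_submodule[OF lm N])
  have sm: "submodule K (G i \<inter> N) ?M" for i
    using fin_dim_subspaceD(2)[OF fdG[of i]] smN by (auto simp: submodule_def)
  have sm': "submodule K (G i \<inter> N) ?N" for i
    using sm[of i] vsN by (auto simp: submodule_def vectorspace_def restrict_scalars_update)
  have fd: "fin_dim_subspace K ?N (G i \<inter> N)" for i
    using fin_dim_subspace_subset(1)[OF fdG sm] sm'[of i] vsN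
    by (auto simp: fin_dim_subspace_def VectorSpace.subspace_def restrict_scalars_update)
  have comp: "compatible_filtration K A F (M\<lparr>carrier := N\<rparr>) (\<lambda>i. G i \<inter> N)"
    unfolding compatible_filtration_def exhaustive_fin_dim_sequence_def
    using fd mono ex NM G N filt_carrier by (auto simp: compatible_filtration_def left_submodule_def)
  have "dim_at K ?N (\<lambda>i. G i \<inter> N) i \<le> dim_at K ?M G i" for i
    using fin_dim_subspace_subset(2)[OF fdG sm] by (simp add: dim_at_def restrict_scalars_update)
  from poly_growth_mono[OF t this] show ?thesis using lmN comp holonomic_iff by blast
qed

lemma holonomic_surj_image:
  assumes M: "holonomic K A F M" and N: "left_module A N"
    and T: "T \<in> module_hom A M N" "T ` carrier M = carrier N"
  shows "holonomic K A F N"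
proof -
  obtain G where lm: "left_module A M" and G: "compatible_filtration K A F M G"
    and t: "poly_growth K (restrict_scalars A M) G half_dim" using M holonomic_iff by blast
  let ?M = "restrict_scalars A M" and ?N = "restrict_scalars A N"
  have fdG: "\<And>i. fin_dim_subspace K ?M (G i)" and ex: "(\<Union>i. G i) = carrier M" and mono: "\<And>i. G i \<subseteq> G (Suc i)"
    and act: "\<And>i j a v. a \<in> F i \<Longrightarrow> v \<in> G j \<Longrightarrow> a \<odot>\<^bsub>M\<^esub> v \<in> G (i + j)"
    using G by (auto simp: compatible_filtration_def exhaustive_fin_dim_sequence_def)
  note fd = linear_image_fin_dim[OF restrict_scalars_vectorspace[OF N] restrict_scalars_hom[OF T(1)] fdG]
  have "a \<odot>\<^bsub>N\<^esub> T v \<in> T ` G (i + j)" if "a \<in> F i" "v \<in> G j" for a v i j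
    using module_hom_smult[OF T(1) filt_carrier[OF that(1)] compatible_carrier[OF G that(2)]] act[OF that]
    by (metis imageI)
  then have comp: "compatible_filtration K A F N (\<lambda>i. T ` G i)"
    unfolding compatible_filtration_def exhaustive_fin_dim_sequence_def
    using fd(1) image_mono[OF mono, of T] ex T(2) by (auto simp: image_UN[symmetric] simp del: image_subset_iff)
  have "dim_at K ?N (\<lambda>i. T ` G i) i \<le> dim_at K ?M G i" for i
    using fd(2) by (simp add: dim_at_def)
  from poly_growth_mono[OF t this] show ?thesis using N comp holonomic_iff by blast
qed

lemma holonomic_prod:
  assumes I: "finite I" and L: "\<And>i. i \<in> I \<Longrightarrow> holonomic K A F (L i)"
  shows "holonomic K A F (prod_module I L)"
proof -
  have "\<forall>i\<in>I. \<exists>G. left_module A (L i) \<and> compatible_filtration K A F (L i) G \<and>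
      poly_growth K (restrict_scalars A (L i)) G half_dim" using L holonomic_iff by blast
  then obtain G where lm: "\<And>i. i \<in> I \<Longrightarrow> left_module A (L i)"
    and G: "\<And>i. i \<in> I \<Longrightarrow> compatible_filtration K A F (L i) (G i)"
    and t: "\<And>i. i \<in> I \<Longrightarrow> poly_growth K (restrict_scalars A (L i)) (G i) half_dim" by metis
  have lmP: "left_module A (prod_module I L)" by (rule prod_module_left_module[OF A.ring_axioms lm])
  let ?P = "restrict_scalars A (prod_module I L)"
  have P: "?P = prod_module I (\<lambda>i. restrict_scalars A (L i))" by (rule restrict_scalars_prod)
  have vsP: "vectorspace K (prod_module I (\<lambda>i. restrict_scalars A (L i)))"
    using restrict_scalars_vectorspace[OF lmP] P by simp
  have ex: "\<And>i. i \<in> I \<Longrightarrow> exhaustive_fin_dim_sequence K (restrict_scalars A (L i)) (G i)"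
    using G by (auto simp: compatible_filtration_def)
  have fdG: "\<And>i n. i \<in> I \<Longrightarrow> fin_dim_subspace K (restrict_scalars A (L i)) (G i n)"
    and un: "\<And>i. i \<in> I \<Longrightarrow> (\<Union>n. G i n) = carrier (L i)"
    using ex by (auto simp: exhaustive_fin_dim_sequence_def)
  note fd = prod_module_fin_dim[OF I vsP fdG, folded P]
  define H where "H n = (\<Pi>\<^sub>E i\<in>I. G i n)" for n
  have exh: "(\<Union>n. H n) = carrier (prod_module I L)"
  proof (intro equalityI subsetI)
    fix x assume "x \<in> (\<Union>n. H n)"
    then show "x \<in> carrier (prod_module I L)" using un by (fastforce simp: H_def prod_module_def PiE_iff)
  next
    fix x assume x: "x \<in> carrier (prod_module I L)"
    then have "\<forall>i\<in>I. \<exists>n. x i \<in> G i n" using un by (fastforce simp: prod_module_def PiE_iff)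
    then obtain n where n: "\<And>i. i \<in> I \<Longrightarrow> x i \<in> G i (n i)" by metis
    have "x i \<in> G i (Max (insert 0 (n ` I)))" if "i \<in> I" for i
      using exhaustive_mono[OF ex[OF that], of "n i" "Max (insert 0 (n ` I))"] n[OF that] I that by auto
    then have "x \<in> H (Max (insert 0 (n ` I)))" using x by (auto simp: H_def prod_module_def PiE_iff)
    then show "x \<in> (\<Union>n. H n)" by blast
  qed
  have comp: "compatible_filtration K A F (prod_module I L) H"
    unfolding compatible_filtration_def exhaustive_fin_dim_sequence_def
  proof (intro conjI allI ballI)
    fix n show "fin_dim_subspace K ?P (H n)" unfolding H_def by (rule fd(1))
    show "H n \<subseteq> H (Suc n)" using ex unfolding H_def exhaustive_fin_dim_sequence_def
      by (intro PiE_mono) auto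
  next
    show "(\<Union>i. H i) = carrier ?P" using exh by simp
  next
    fix n m a v assume a: "a \<in> F n" and v: "v \<in> H m"
    have "a \<odot>\<^bsub>L i\<^esub> v i \<in> G i (n + m)" if "i \<in> I" for i
      using G[OF that] a PiE_mem[OF v[unfolded H_def] that] by (simp add: compatible_filtration_def)
    then show "a \<odot>\<^bsub>prod_module I L\<^esub> v \<in> H (n + m)" by (simp add: H_def prod_module_def)
  qed
  have "\<forall>i\<in>I. \<exists>C. \<forall>\<^sub>F n in sequentially. real (dim_at K (restrict_scalars A (L i)) (G i) n) \<le> C * real n powr half_dim"
    using t unfolding poly_growth_def by blast
  then obtain C where C: "\<And>i. i \<in> I \<Longrightarrow> \<forall>\<^sub>F n in sequentially.
      real (dim_at K (restrict_scalars A (L i)) (G i) n) \<le> C i * real n powr half_dim" by metis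
  have "\<forall>\<^sub>F n in sequentially. \<forall>i\<in>I. real (dim_at K (restrict_scalars A (L i)) (G i) n) \<le> C i * real n powr half_dim"
    using C by (simp add: eventually_ball_finite_distrib[OF I])
  then have "\<forall>\<^sub>F n in sequentially. real (dim_at K ?P H n) \<le> (\<Sum>i\<in>I. C i) * real n powr half_dim"
  proof eventually_elim
    case (elim n)
    have "dim_at K ?P H n \<le> (\<Sum>i\<in>I. dim_at K (restrict_scalars A (L i)) (G i) n)"
      using fd(2) by (simp add: dim_at_def H_def)
    then have "real (dim_at K ?P H n) \<le> (\<Sum>i\<in>I. real (dim_at K (restrict_scalars A (L i)) (G i) n))"
      by (simp flip: of_nat_sum)
    also have "\<dots> \<le> (\<Sum>i\<in>I. C i * real n powr half_dim)" by (rule sum_mono) (use elim in auto)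
    finally show ?case by (simp add: sum_distrib_right)
  qed
  then have "poly_growth K ?P H half_dim" unfolding poly_growth_def by blast
  then show ?thesis using lmP comp holonomic_iff by blast
qed

end

section \<open>Localization by Ore fractions\<close>

locale diff_op_module = Alg: algebra K R + Mod: left_module "diff_ops K R" M
  for K :: "('k, 'x) ring_scheme" and R :: "('k, 'r, 'y) module_scheme"
    and M :: "('r \<Rightarrow> 'r, 'm, 'z) module_scheme"
begin

abbreviation D where "D \<equiv> diff_ops K R"
abbreviation Op where "Op n \<equiv> diff_ops_le K R n"
abbreviation pw where "pw f u \<equiv> mult_op R (f [^]\<^bsub>R\<^esub> (u :: nat))"

lemma diff_ops_simps:
  "mult D = compose (carrier R)" "add D = add (End_algebra K R)"
  "\<one>\<^bsub>D\<^esub> = \<one>\<^bsub>End_algebra K R\<^esub>" "\<zero>\<^bsub>D\<^esub> = \<zero>\<^bsub>End_algebra K R\<^esub>" "carrier D = (\<Union>i. Op i)"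
  by (simp_all add: diff_ops_def End_algebra_def)

lemma mult_op_End: "r \<in> carrier R \<Longrightarrow> mult_op R r \<in> carrier (End_algebra K R)"
  by (auto simp: End_algebra_def mult_op_def module_hom_def Alg.r_distr
      Alg.m_comm[of r] Alg.smult_assoc2)

lemma Op_End: "Op n \<subseteq> carrier (End_algebra K R)"
  by (cases n) (auto simp: mult_op_End)

lemma Op_closed: "\<delta> \<in> Op n \<Longrightarrow> \<delta> \<in> carrier D"
  by (auto simp: diff_ops_simps)

lemma End_of_D: "\<delta> \<in> carrier D \<Longrightarrow> \<delta> \<in> carrier (End_algebra K R)"
  using Op_End by (auto simp: diff_ops_simps)

lemma diff_order: "\<delta> \<in> carrier D \<Longrightarrow> \<delta> \<in> Op (diff_order K R \<delta>)"
  unfolding diff_order_def by (rule LeastI_ex) (auto simp: diff_ops_simps)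

lemma mult_op_closed [simp, intro]: "r \<in> carrier R \<Longrightarrow> mult_op R r \<in> carrier D"
  by (rule Op_closed[of _ 0]) simp

lemma mult_op_mult: "r \<in> carrier R \<Longrightarrow> s \<in> carrier R \<Longrightarrow>
    mult_op R r \<otimes>\<^bsub>D\<^esub> mult_op R s = mult_op R (r \<otimes>\<^bsub>R\<^esub> s)"
  by (auto simp: diff_ops_simps mult_op_def compose_def Alg.m_assoc intro!: restrict_ext)

lemma mult_op_one: "mult_op R \<one>\<^bsub>R\<^esub> = \<one>\<^bsub>D\<^esub>"
  by (auto simp: diff_ops_simps End_algebra_def mult_op_def intro!: restrict_ext)

lemma pw_closed [simp, intro]: "f \<in> carrier R \<Longrightarrow> pw f u \<in> carrier D"
  by simp

lemma pw_add: "f \<in> carrier R \<Longrightarrow> pw f u \<otimes>\<^bsub>D\<^esub> pw f v = pw f (u + v)"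
  by (simp add: mult_op_mult Alg.nat_pow_mult)

lemma pw_0 [simp]: "pw f 0 = \<one>\<^bsub>D\<^esub>"
  by (simp add: mult_op_one)

text \<open>Negation in a record refers to its carrier, so negation of endomorphisms and negation in \<open>D\<close> must be
  identified before commutators can be computed inside the ring \<open>D\<close>.\<close>

lemma End_neg:
  assumes d: "\<delta> \<in> carrier D" shows "a_inv (End_algebra K R) \<delta> = \<ominus>\<^bsub>D\<^esub> \<delta>"
proof -
  let ?E = "End_algebra K R"
  have vals: "\<phi> x \<in> carrier R" if "\<phi> \<in> carrier ?E" "x \<in> carrier R" for \<phi> x
    using that by (auto simp: End_algebra_def module_hom_def)
  have ext: "\<phi> \<in> extensional (carrier R)" if "\<phi> \<in> carrier ?E" for \<phi>
    using that by (auto simp: End_algebra_def)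
  have n: "\<ominus>\<^bsub>D\<^esub> \<delta> \<in> carrier ?E" using d by (simp add: End_of_D)
  have e: "\<delta> \<in> carrier ?E" by (rule End_of_D[OF d])
  have nd: "\<ominus>\<^bsub>D\<^esub> \<delta> \<oplus>\<^bsub>?E\<^esub> \<delta> = \<zero>\<^bsub>?E\<^esub>" "\<delta> \<oplus>\<^bsub>?E\<^esub> \<ominus>\<^bsub>D\<^esub> \<delta> = \<zero>\<^bsub>?E\<^esub>"
    using Mod.A.l_neg[OF d] Mod.A.r_neg[OF d] by (simp_all add: diff_ops_simps)
  have uniq: "\<phi> = \<ominus>\<^bsub>D\<^esub> \<delta>" if \<phi>: "\<phi> \<in> carrier ?E" "\<delta> \<oplus>\<^bsub>?E\<^esub> \<phi> = \<zero>\<^bsub>?E\<^esub>" for \<phi>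
  proof (rule extensionalityI[OF ext[OF \<phi>(1)] ext[OF n]])
    fix x assume x: "x \<in> carrier R"
    have "\<delta> x \<oplus>\<^bsub>R\<^esub> \<phi> x = \<zero>\<^bsub>R\<^esub>" "\<delta> x \<oplus>\<^bsub>R\<^esub> (\<ominus>\<^bsub>D\<^esub> \<delta>) x = \<zero>\<^bsub>R\<^esub>"
      using fun_cong[OF \<phi>(2), of x] fun_cong[OF nd(2), of x] x by (simp_all add: End_algebra_def)
    then show "\<phi> x = (\<ominus>\<^bsub>D\<^esub> \<delta>) x"
      using vals[OF \<phi>(1) x] vals[OF n x] vals[OF e x] Alg.minus_equality Alg.a_comm by metis
  qed
  show ?thesis unfolding a_inv_def[of ?E] m_inv_def
  proof (rule the_equality)
    show "\<ominus>\<^bsub>D\<^esub> \<delta> \<in> carrier (add_monoid ?E) \<and> \<delta> \<otimes>\<^bsub>add_monoid ?E\<^esub> \<ominus>\<^bsub>D\<^esub> \<delta> = \<one>\<^bsub>add_monoid ?E\<^esub> \<and>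
        \<ominus>\<^bsub>D\<^esub> \<delta> \<otimes>\<^bsub>add_monoid ?E\<^esub> \<delta> = \<one>\<^bsub>add_monoid ?E\<^esub>" using n nd by simp
    fix \<phi> assume "\<phi> \<in> carrier (add_monoid ?E) \<and> \<delta> \<otimes>\<^bsub>add_monoid ?E\<^esub> \<phi> = \<one>\<^bsub>add_monoid ?E\<^esub> \<and>
        \<phi> \<otimes>\<^bsub>add_monoid ?E\<^esub> \<delta> = \<one>\<^bsub>add_monoid ?E\<^esub>"
    then show "\<phi> = \<ominus>\<^bsub>D\<^esub> \<delta>" using uniq[of \<phi>] by simp
  qed
qed

lemma commutator_eq:
  assumes "\<delta> \<in> carrier D" "\<epsilon> \<in> carrier D"
  shows "commutator (End_algebra K R) \<delta> \<epsilon> = \<delta> \<otimes>\<^bsub>D\<^esub> \<epsilon> \<ominus>\<^bsub>D\<^esub> \<epsilon> \<otimes>\<^bsub>D\<^esub> \<delta>"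
proof -
  have "mult (End_algebra K R) = mult D" by (simp add: diff_ops_simps End_algebra_def)
  then show ?thesis using assms End_neg[of "\<epsilon> \<otimes>\<^bsub>D\<^esub> \<delta>"]
    by (simp add: commutator_def a_minus_def) (simp add: diff_ops_simps)
qed

lemma Op_Suc_commutator:
  assumes "\<delta> \<in> Op (Suc n)" "r \<in> carrier R"
  shows "commutator (End_algebra K R) \<delta> (mult_op R r) \<in> Op n"
    "\<delta> \<otimes>\<^bsub>D\<^esub> mult_op R r \<ominus>\<^bsub>D\<^esub> mult_op R r \<otimes>\<^bsub>D\<^esub> \<delta> \<in> Op n"
proof -
  show 1: "commutator (End_algebra K R) \<delta> (mult_op R r) \<in> Op n" using assms by simp
  show "\<delta> \<otimes>\<^bsub>D\<^esub> mult_op R r \<ominus>\<^bsub>D\<^esub> mult_op R r \<otimes>\<^bsub>D\<^esub> \<delta> \<in> Op n"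
    using 1 commutator_eq[OF Op_closed[OF assms(1)] mult_op_closed[OF assms(2)]] by simp
qed

lemma Op_0_commute: "\<delta> \<in> Op 0 \<Longrightarrow> r \<in> carrier R \<Longrightarrow> \<delta> \<otimes>\<^bsub>D\<^esub> mult_op R r = mult_op R r \<otimes>\<^bsub>D\<^esub> \<delta>"
  by (auto simp: mult_op_mult Alg.m_comm)

text \<open>If \<open>X f\<^sup>s = 0\<close>, then \<open>[X, f\<^sup>s] = - f\<^sup>s X\<close> is also annihilated by \<open>f\<^sup>s\<close> on the right, and it has smaller
  order. So a power of \<open>f\<close> annihilates \<open>f\<^sup>s X\<close> from the left by induction.\<close>

lemma ore_torsion:
  assumes f: "f \<in> carrier R" and "X \<in> Op n" "X \<otimes>\<^bsub>D\<^esub> pw f s = \<zero>\<^bsub>D\<^esub>"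
  shows "\<exists>k. pw f k \<otimes>\<^bsub>D\<^esub> X = \<zero>\<^bsub>D\<^esub>"
  using assms(2,3)
proof (induction n arbitrary: X)
  case 0
  then show ?case using Op_0_commute[OF 0(1), of "f [^]\<^bsub>R\<^esub> s"] f by auto
next
  case (Suc n)
  let ?p = "pw f s"
  have X: "X \<in> carrier D" and p: "?p \<in> carrier D" using Op_closed[OF Suc.prems(1)] f by auto
  define Y where "Y = X \<otimes>\<^bsub>D\<^esub> ?p \<ominus>\<^bsub>D\<^esub> ?p \<otimes>\<^bsub>D\<^esub> X"
  have Y: "Y \<in> Op n" unfolding Y_def by (rule Op_Suc_commutator(2)[OF Suc.prems(1)]) (simp add: f)
  have Y_eq: "Y = \<ominus>\<^bsub>D\<^esub> (?p \<otimes>\<^bsub>D\<^esub> X)"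
    unfolding Y_def Suc.prems(2) using X p by (simp add: a_minus_def)
  have "Y \<otimes>\<^bsub>D\<^esub> ?p = \<zero>\<^bsub>D\<^esub>"
    unfolding Y_eq using X p Suc.prems(2) by (simp add: Mod.A.l_minus Mod.A.m_assoc)
  from Suc.IH[OF Y this] obtain k where "pw f k \<otimes>\<^bsub>D\<^esub> Y = \<zero>\<^bsub>D\<^esub>" by blast
  then have "\<ominus>\<^bsub>D\<^esub> (pw f k \<otimes>\<^bsub>D\<^esub> (?p \<otimes>\<^bsub>D\<^esub> X)) = \<zero>\<^bsub>D\<^esub>"
    unfolding Y_eq using X p f by (simp add: Mod.A.r_minus)
  then have "pw f k \<otimes>\<^bsub>D\<^esub> (?p \<otimes>\<^bsub>D\<^esub> X) = \<zero>\<^bsub>D\<^esub>"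
    using X p f by (metis Mod.A.minus_minus Mod.A.minus_zero Mod.A.m_closed pw_closed)
  then have "pw f (k + s) \<otimes>\<^bsub>D\<^esub> X = \<zero>\<^bsub>D\<^esub>"
    using X p f by (simp add: pw_add[symmetric] Mod.A.m_assoc)
  then show ?case by blast
qed

text \<open>The recursion computes an Ore fraction: \<open>f\<^sup>m \<delta> = P f\<^sup>t\<close> reads \<open>\<delta> f\<^sup>-\<^sup>t = f\<^sup>-\<^sup>m P\<close>, and \<open>P\<close> is independent of
  \<open>v\<close>. If \<open>Q\<close> serves for the commutator, \<open>f\<^sup>m [\<delta>, f\<^sup>t] = Q f\<^sup>t\<close>, then
  \<open>(f\<^sup>m \<delta> - Q) f\<^sup>t = f\<^sup>m \<delta> f\<^sup>t - f\<^sup>m [\<delta>, f\<^sup>t] = f\<^bsup>m + t\<^esup> \<delta>\<close>.\<close>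

lemma loc_act_fraction:
  assumes f: "f \<in> carrier R" and "\<delta> \<in> Op n"
  shows "\<exists>m. \<exists>P \<in> carrier D. pw f m \<otimes>\<^bsub>D\<^esub> \<delta> = P \<otimes>\<^bsub>D\<^esub> pw f t \<and>
    (\<forall>v \<in> carrier M. loc_act K R M f n \<delta> (v, t) = (P \<odot>\<^bsub>M\<^esub> v, m))"
  using assms(2)
proof (induction n arbitrary: \<delta>)
  case 0
  show ?case
    by (rule exI[of _ t], rule bexI[of _ \<delta>])
      (use Op_0_commute[OF 0, of "f [^]\<^bsub>R\<^esub> t"] f Op_closed[OF 0] in auto)
next
  case (Suc n)
  let ?p = "pw f t"
  have d: "\<delta> \<in> carrier D" and p: "?p \<in> carrier D" using Op_closed[OF Suc.prems] f by auto
  have ft: "f [^]\<^bsub>R\<^esub> t \<in> carrier R" using f by simp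
  define C where "C = commutator (End_algebra K R) \<delta> ?p"
  have C: "C \<in> Op n" "C = \<delta> \<otimes>\<^bsub>D\<^esub> ?p \<ominus>\<^bsub>D\<^esub> ?p \<otimes>\<^bsub>D\<^esub> \<delta>"
    unfolding C_def using Op_Suc_commutator(1)[OF Suc.prems ft] commutator_eq[OF d p] by auto
  from Suc.IH[OF C(1)] obtain m P where P: "P \<in> carrier D" "pw f m \<otimes>\<^bsub>D\<^esub> C = P \<otimes>\<^bsub>D\<^esub> ?p"
    and l: "\<And>v. v \<in> carrier M \<Longrightarrow> loc_act K R M f n C (v, t) = (P \<odot>\<^bsub>M\<^esub> v, m)" by blast
  let ?P = "pw f m \<otimes>\<^bsub>D\<^esub> \<delta> \<ominus>\<^bsub>D\<^esub> P"
  have q: "pw f m \<in> carrier D" using f by simp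
  have "?P \<otimes>\<^bsub>D\<^esub> ?p = pw f m \<otimes>\<^bsub>D\<^esub> (\<delta> \<otimes>\<^bsub>D\<^esub> ?p) \<ominus>\<^bsub>D\<^esub> pw f m \<otimes>\<^bsub>D\<^esub> C"
    unfolding P(2) using P(1) d p q by (simp add: a_minus_def Mod.A.l_distr Mod.A.m_assoc Mod.A.l_minus)
  also have "\<dots> = pw f m \<otimes>\<^bsub>D\<^esub> (?p \<otimes>\<^bsub>D\<^esub> \<delta>)"
  proof -
    define a b where "a = \<delta> \<otimes>\<^bsub>D\<^esub> ?p" and "b = ?p \<otimes>\<^bsub>D\<^esub> \<delta>"
    have ab: "a \<in> carrier D" "b \<in> carrier D" using d p by (auto simp: a_def b_def)
    have "a \<ominus>\<^bsub>D\<^esub> (a \<ominus>\<^bsub>D\<^esub> b) = b"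
      using ab by (simp add: a_minus_def Mod.A.minus_add Mod.A.a_assoc[symmetric] Mod.A.r_neg)
    moreover have "pw f m \<otimes>\<^bsub>D\<^esub> a \<ominus>\<^bsub>D\<^esub> pw f m \<otimes>\<^bsub>D\<^esub> (a \<ominus>\<^bsub>D\<^esub> b) = pw f m \<otimes>\<^bsub>D\<^esub> (a \<ominus>\<^bsub>D\<^esub> (a \<ominus>\<^bsub>D\<^esub> b))"
      using ab q by (simp add: a_minus_def Mod.A.r_distr Mod.A.r_minus)
    ultimately show ?thesis by (simp add: C(2) a_def b_def)
  qed
  also have "\<dots> = pw f (m + t) \<otimes>\<^bsub>D\<^esub> \<delta>"
    using d p q f by (simp add: pw_add[symmetric] Mod.A.m_assoc)
  finally have eq: "pw f (m + t) \<otimes>\<^bsub>D\<^esub> \<delta> = ?P \<otimes>\<^bsub>D\<^esub> ?p" ..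
  have "loc_act K R M f (Suc n) \<delta> (v, t) = (?P \<odot>\<^bsub>M\<^esub> v, m + t)" if v: "v \<in> carrier M" for v
    using l[OF v] v d q P(1)
    by (simp add: C_def[symmetric] ring_act_def Mod.smult_l_diff Mod.smult_assoc)
  then show ?case using eq P(1) d q by (intro exI[of _ "m + t"] bexI[of _ ?P]) auto
qed

lemma ore:
  assumes "f \<in> carrier R" "\<delta> \<in> carrier D"
  obtains m P where "P \<in> carrier D" "pw f m \<otimes>\<^bsub>D\<^esub> \<delta> = P \<otimes>\<^bsub>D\<^esub> pw f t"
  using loc_act_fraction[OF assms(1) diff_order[OF assms(2)], of t] by blast

lemma pw_smult: "f \<in> carrier R \<Longrightarrow> v \<in> carrier M \<Longrightarrow>
    pw f a \<odot>\<^bsub>M\<^esub> (pw f b \<odot>\<^bsub>M\<^esub> v) = pw f (a + b) \<odot>\<^bsub>M\<^esub> v"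
  by (simp add: Mod.smult_assoc[symmetric] pw_add)

lemma pw_smult_0 [simp]: "v \<in> carrier M \<Longrightarrow> mult_op R \<one>\<^bsub>R\<^esub> \<odot>\<^bsub>M\<^esub> v = v"
  by (simp add: mult_op_one)

lemma loc_rel_iff:
  assumes "f \<in> carrier R"
  shows "((v, t), (w, s)) \<in> loc_rel R M f \<longleftrightarrow> v \<in> carrier M \<and> w \<in> carrier M \<and>
     (\<exists>u. pw f (u + s) \<odot>\<^bsub>M\<^esub> v = pw f (u + t) \<odot>\<^bsub>M\<^esub> w)"
  by (auto simp: loc_rel_def ring_act_def pw_smult[OF assms])

lemma pw_raise:
  assumes f: "f \<in> carrier R" and v: "v \<in> carrier M" "w \<in> carrier M"
    and eq: "pw f a \<odot>\<^bsub>M\<^esub> v = pw f b \<odot>\<^bsub>M\<^esub> w" and a: "a' = k + a" and b: "b' = k + b"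
  shows "pw f a' \<odot>\<^bsub>M\<^esub> v = pw f b' \<odot>\<^bsub>M\<^esub> w"
  unfolding a b pw_smult[OF f v(1), symmetric] pw_smult[OF f v(2), symmetric] by (simp add: eq)

lemma loc_rel_equiv:
  assumes f: "f \<in> carrier R"
  shows "equiv (carrier M \<times> UNIV) (loc_rel R M f)"
proof (rule equivI)
  show "loc_rel R M f \<subseteq> (carrier M \<times> UNIV) \<times> (carrier M \<times> UNIV)"
    by (auto simp: loc_rel_def)
  show "refl_on (carrier M \<times> UNIV) (loc_rel R M f)"
    by (auto simp: refl_on_def loc_rel_iff[OF f])
  show "sym (loc_rel R M f)"
    by (auto simp: sym_def loc_rel_iff[OF f]) metis
  show "trans (loc_rel R M f)"
  proof (rule transI, clarify)
    fix v t w s x r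
    assume "((v, t), (w, s)) \<in> loc_rel R M f" "((w, s), (x, r)) \<in> loc_rel R M f"
    then obtain u u' where c: "v \<in> carrier M" "w \<in> carrier M" "x \<in> carrier M"
      and 1: "pw f (u + s) \<odot>\<^bsub>M\<^esub> v = pw f (u + t) \<odot>\<^bsub>M\<^esub> w"
      and 2: "pw f (u' + r) \<odot>\<^bsub>M\<^esub> w = pw f (u' + s) \<odot>\<^bsub>M\<^esub> x"
      by (auto simp: loc_rel_iff[OF f])
    have "pw f ((u + u' + s) + r) \<odot>\<^bsub>M\<^esub> v = pw f (u + t + u' + r) \<odot>\<^bsub>M\<^esub> w"
      by (rule pw_raise[OF f c(1,2) 1, where k = "u' + r"]) auto
    also have "\<dots> = pw f ((u + u' + s) + t) \<odot>\<^bsub>M\<^esub> x"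
      by (rule pw_raise[OF f c(2,3) 2, where k = "u + t"]) auto
    finally show "((v, t), (x, r)) \<in> loc_rel R M f" using c by (auto simp: loc_rel_iff[OF f])
  qed
qed

abbreviation frac where "frac f v t \<equiv> loc_frac R M f (v, t)"

lemma frac_eq_iff:
  assumes "f \<in> carrier R" "v \<in> carrier M" "w \<in> carrier M"
  shows "frac f v t = frac f w s \<longleftrightarrow> (\<exists>u. pw f (u + s) \<odot>\<^bsub>M\<^esub> v = pw f (u + t) \<odot>\<^bsub>M\<^esub> w)"
proof -
  have "frac f v t = frac f w s \<longleftrightarrow> ((v, t), (w, s)) \<in> loc_rel R M f"
    unfolding loc_frac_def using assms by (intro eq_equiv_class_iff[OF loc_rel_equiv]) auto
  then show ?thesis using assms loc_rel_iff by auto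
qed

lemma frac_mem_iff:
  assumes "f \<in> carrier R" "v \<in> carrier M"
  shows "(w, s) \<in> frac f v t \<longleftrightarrow> w \<in> carrier M \<and> frac f v t = frac f w s"
  using assms frac_eq_iff[OF assms, of w t s] by (auto simp: loc_frac_def loc_rel_iff)

lemma frac_raise:
  assumes "f \<in> carrier R" "v \<in> carrier M"
  shows "frac f (pw f k \<odot>\<^bsub>M\<^esub> v) (t + k) = frac f v t"
  unfolding frac_eq_iff[OF assms(1) Mod.smult_closed[OF pw_closed[OF assms(1)] assms(2)] assms(2)]
  by (rule exI[of _ 0]) (simp add: pw_smult[OF assms] add.commute)

lemma carrier_localization:
  "f \<in> carrier R \<Longrightarrow> carrier (localization K R M f) = {frac f v t | v t. v \<in> carrier M}"
  by (auto simp: localization_def quotient_def loc_frac_def)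

lemma frac_closed [intro]: "f \<in> carrier R \<Longrightarrow> v \<in> carrier M \<Longrightarrow> frac f v t \<in> carrier (localization K R M f)"
  by (auto simp: carrier_localization)

text \<open>Identities between finitely many elements of the localization need be checked only for fractions
  with one denominator, where addition is addition of numerators.\<close>

lemma common_denominator:
  assumes f: "f \<in> carrier R" and X: "finite XX" "XX \<subseteq> carrier (localization K R M f)"
  shows "\<exists>t. \<forall>X \<in> XX. \<exists>v \<in> carrier M. X = frac f v t"
  using X
  proof (induction XX rule: finite_induct)
    case (insert X XX)
    then obtain t where t: "\<And>X. X \<in> XX \<Longrightarrow> \<exists>v \<in> carrier M. X = frac f v t" by auto
    obtain v s where v: "v \<in> carrier M" "X = frac f v s" using insert.prems f by (auto simp: carrier_localization)
    have "\<exists>w\<in>carrier M. Y = frac f w (s + t)" if "Y \<in> insert X XX" for Y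
    proof (cases "Y \<in> XX")
      case False
      then have "Y = X" using that by simp
      then show ?thesis using frac_raise[OF f v(1), of t s] v f by (intro bexI[of _ "pw f t \<odot>\<^bsub>M\<^esub> v"]) auto
    next
      case True
      then obtain w where "w \<in> carrier M" "Y = frac f w t" using t by blast
      then show ?thesis using frac_raise[OF f, of w s t] f
        by (intro bexI[of _ "pw f s \<odot>\<^bsub>M\<^esub> w"]) (auto simp: add.commute)
    qed
    then show ?case by blast
  qed auto

lemma frac_add_general:
  assumes f: "f \<in> carrier R" and v: "v \<in> carrier M" and w: "w \<in> carrier M"
  shows "frac f v t \<oplus>\<^bsub>localization K R M f\<^esub> frac f w s =
    frac f (pw f s \<odot>\<^bsub>M\<^esub> v \<oplus>\<^bsub>M\<^esub> pw f t \<odot>\<^bsub>M\<^esub> w) (s + t)"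
proof -
  let ?c = "frac f (pw f s \<odot>\<^bsub>M\<^esub> v \<oplus>\<^bsub>M\<^esub> pw f t \<odot>\<^bsub>M\<^esub> w) (s + t)"
  let ?S = "{loc_frac R M f (ring_act R M (f [^]\<^bsub>R\<^esub> s') v' \<oplus>\<^bsub>M\<^esub> ring_act R M (f [^]\<^bsub>R\<^esub> t') w', s' + t')
          | v' t' w' s'. (v', t') \<in> frac f v t \<and> (w', s') \<in> frac f w s}"
  have "frac f (pw f s' \<odot>\<^bsub>M\<^esub> v' \<oplus>\<^bsub>M\<^esub> pw f t' \<odot>\<^bsub>M\<^esub> w') (s' + t') = ?c"
    if "(v', t') \<in> frac f v t" "(w', s') \<in> frac f w s" for v' t' w' s'
  proof -
    have c: "v' \<in> carrier M" "w' \<in> carrier M" and e: "frac f v t = frac f v' t'" "frac f w s = frac f w' s'"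
      using that f v w by (auto simp: frac_mem_iff)
    obtain u where u: "pw f (u + t') \<odot>\<^bsub>M\<^esub> v = pw f (u + t) \<odot>\<^bsub>M\<^esub> v'" using e(1) frac_eq_iff[OF f v c(1)] by auto
    obtain u' where u': "pw f (u' + s') \<odot>\<^bsub>M\<^esub> w = pw f (u' + s) \<odot>\<^bsub>M\<^esub> w'" using e(2) frac_eq_iff[OF f w c(2)] by auto
    have 1: "pw f (u + u' + (s + t) + s') \<odot>\<^bsub>M\<^esub> v' = pw f (u + u' + (s' + t') + s) \<odot>\<^bsub>M\<^esub> v"
      by (rule pw_raise[OF f c(1) v u[symmetric], where k = "u' + s + s'"]) auto
    have 2: "pw f (u + u' + (s + t) + t') \<odot>\<^bsub>M\<^esub> w' = pw f (u + u' + (s' + t') + t) \<odot>\<^bsub>M\<^esub> w"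
      by (rule pw_raise[OF f c(2) w u'[symmetric], where k = "u + t + t'"]) auto
    have "\<exists>k. pw f (k + (s + t)) \<odot>\<^bsub>M\<^esub> (pw f s' \<odot>\<^bsub>M\<^esub> v' \<oplus>\<^bsub>M\<^esub> pw f t' \<odot>\<^bsub>M\<^esub> w')
       = pw f (k + (s' + t')) \<odot>\<^bsub>M\<^esub> (pw f s \<odot>\<^bsub>M\<^esub> v \<oplus>\<^bsub>M\<^esub> pw f t \<odot>\<^bsub>M\<^esub> w)"
      by (rule exI[of _ "u + u'"])
        (use c v w f 1 2 in \<open>simp add: Mod.smult_r_distr pw_smult\<close>)
    then show ?thesis using c v w f by (subst frac_eq_iff) auto
  qed
  then have "?S \<subseteq> {?c}" by (auto simp: ring_act_def)
  moreover have "?c \<in> ?S"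
    by (intro CollectI exI[of _ v] exI[of _ t] exI[of _ w] exI[of _ s])
      (use v w f in \<open>simp add: ring_act_def frac_mem_iff\<close>)
  ultimately have "?S = {?c}" by blast
  then show ?thesis by (simp add: localization_def)
qed

lemma frac_add:
  assumes f: "f \<in> carrier R" and v: "v \<in> carrier M" and w: "w \<in> carrier M"
  shows "frac f v t \<oplus>\<^bsub>localization K R M f\<^esub> frac f w t = frac f (v \<oplus>\<^bsub>M\<^esub> w) t"
  using frac_add_general[OF assms, of t t] frac_raise[OF f, of "v \<oplus>\<^bsub>M\<^esub> w" t t] assms
  by (simp add: Mod.smult_r_distr)

lemma frac_zero: "f \<in> carrier R \<Longrightarrow> frac f \<zero>\<^bsub>M\<^esub> t = \<zero>\<^bsub>localization K R M f\<^esub>"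
  by (simp add: localization_def frac_eq_iff)

text \<open>The Ore property gives \<open>f\<^bsup>q + n\<^esup> P = Z f\<^bsup>u + s\<^esup>\<close> with \<open>u\<close> taken from the equality of the fractions.
  Then \<open>Z f\<^bsup>u + t\<^esup>\<close> and \<open>f\<^bsup>q + m\<^esup> Q\<close> agree after multiplication by \<open>f\<^sup>s\<close> on the right, hence after
  multiplication by a power of \<open>f\<close> on the left, and applying them to \<open>w\<close> compares the two numerators.\<close>

lemma frac_act_well_defined:
  assumes f: "f \<in> carrier R" and d: "\<delta> \<in> carrier D"
    and P: "P \<in> carrier D" "pw f m \<otimes>\<^bsub>D\<^esub> \<delta> = P \<otimes>\<^bsub>D\<^esub> pw f t"
    and Q: "Q \<in> carrier D" "pw f n \<otimes>\<^bsub>D\<^esub> \<delta> = Q \<otimes>\<^bsub>D\<^esub> pw f s"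
    and v: "v \<in> carrier M" "w \<in> carrier M" "frac f v t = frac f w s"
  shows "frac f (P \<odot>\<^bsub>M\<^esub> v) m = frac f (Q \<odot>\<^bsub>M\<^esub> w) n"
proof -
  note [simp] = Mod.A.m_assoc
  obtain u where u: "pw f (u + s) \<odot>\<^bsub>M\<^esub> v = pw f (u + t) \<odot>\<^bsub>M\<^esub> w" using v f frac_eq_iff by metis
  obtain q Z where Z: "Z \<in> carrier D" "pw f q \<otimes>\<^bsub>D\<^esub> (pw f n \<otimes>\<^bsub>D\<^esub> P) = Z \<otimes>\<^bsub>D\<^esub> pw f (u + s)"
    using P(1) f by (rule_tac ore[OF f, of "pw f n \<otimes>\<^bsub>D\<^esub> P" "u + s"]) auto
  define X where "X = Z \<otimes>\<^bsub>D\<^esub> pw f (u + t) \<ominus>\<^bsub>D\<^esub> pw f (q + m) \<otimes>\<^bsub>D\<^esub> Q"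
  have X: "X \<in> carrier D" using Z(1) Q(1) f by (simp add: X_def)
  have "Z \<otimes>\<^bsub>D\<^esub> pw f (u + t) \<otimes>\<^bsub>D\<^esub> pw f s = Z \<otimes>\<^bsub>D\<^esub> pw f (u + s) \<otimes>\<^bsub>D\<^esub> pw f t"
    using Z(1) f by (simp add: pw_add ac_simps)
  also have "\<dots> = pw f (q + n) \<otimes>\<^bsub>D\<^esub> (P \<otimes>\<^bsub>D\<^esub> pw f t)"
    unfolding Z(2)[symmetric] using P(1) f by (simp flip: pw_add)
  also have "\<dots> = pw f (q + m) \<otimes>\<^bsub>D\<^esub> (pw f n \<otimes>\<^bsub>D\<^esub> \<delta>)"
    unfolding P(2)[symmetric] using d f
    by (simp add: Mod.A.m_assoc[symmetric] pw_add ac_simps del: Mod.A.m_assoc)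
  finally have "Z \<otimes>\<^bsub>D\<^esub> pw f (u + t) \<otimes>\<^bsub>D\<^esub> pw f s = pw f (q + m) \<otimes>\<^bsub>D\<^esub> Q \<otimes>\<^bsub>D\<^esub> pw f s"
    unfolding Q(2) using Q(1) f by simp
  then have "X \<otimes>\<^bsub>D\<^esub> pw f s = \<zero>\<^bsub>D\<^esub>" unfolding X_def using Z(1) Q(1) f
    by (simp add: a_minus_def Mod.A.l_distr Mod.A.l_minus Mod.A.r_neg del: Mod.A.m_assoc)
  then obtain k where "pw f k \<otimes>\<^bsub>D\<^esub> X = \<zero>\<^bsub>D\<^esub>" using ore_torsion[OF f diff_order[OF X]] by blast
  then have k: "pw f k \<odot>\<^bsub>M\<^esub> (X \<odot>\<^bsub>M\<^esub> w) = \<zero>\<^bsub>M\<^esub>"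
    using X v f by (simp flip: Mod.smult_assoc)
  have Xw: "X \<odot>\<^bsub>M\<^esub> w = Z \<odot>\<^bsub>M\<^esub> (pw f (u + t) \<odot>\<^bsub>M\<^esub> w) \<ominus>\<^bsub>M\<^esub> pw f (q + m) \<odot>\<^bsub>M\<^esub> (Q \<odot>\<^bsub>M\<^esub> w)"
    unfolding X_def using Z(1) Q(1) v f by (simp add: Mod.smult_l_diff Mod.smult_assoc)
  have "Z \<odot>\<^bsub>M\<^esub> (pw f (u + t) \<odot>\<^bsub>M\<^esub> w) = (Z \<otimes>\<^bsub>D\<^esub> pw f (u + s)) \<odot>\<^bsub>M\<^esub> v"
    unfolding u[symmetric] using Z(1) v f by (simp add: Mod.smult_assoc)
  also have "\<dots> = pw f (q + n) \<odot>\<^bsub>M\<^esub> (P \<odot>\<^bsub>M\<^esub> v)"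
    unfolding Z(2)[symmetric] using P(1) v f by (simp add: Mod.smult_assoc pw_smult)
  finally have "pw f k \<odot>\<^bsub>M\<^esub> (pw f (q + n) \<odot>\<^bsub>M\<^esub> (P \<odot>\<^bsub>M\<^esub> v)) = pw f k \<odot>\<^bsub>M\<^esub> (pw f (q + m) \<odot>\<^bsub>M\<^esub> (Q \<odot>\<^bsub>M\<^esub> w))"
    using k v P(1) Q(1) f unfolding Xw by (simp add: Mod.smult_r_diff)
  then have "pw f ((k + q) + n) \<odot>\<^bsub>M\<^esub> (P \<odot>\<^bsub>M\<^esub> v) = pw f ((k + q) + m) \<odot>\<^bsub>M\<^esub> (Q \<odot>\<^bsub>M\<^esub> w)"
    using v P(1) Q(1) f by (simp add: pw_smult ac_simps)
  then show ?thesis using v P(1) Q(1) f by (subst frac_eq_iff) auto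
qed

text \<open>All that is used about the action from here on: any Ore fraction for \<open>\<delta> f\<^sup>-\<^sup>t\<close> may be used to compute
  \<open>\<delta>(v/f\<^sup>t)\<close>.\<close>

lemma frac_act:
  assumes f: "f \<in> carrier R" and d: "\<delta> \<in> carrier D"
    and P: "P \<in> carrier D" "pw f m \<otimes>\<^bsub>D\<^esub> \<delta> = P \<otimes>\<^bsub>D\<^esub> pw f t" and v: "v \<in> carrier M"
  shows "\<delta> \<odot>\<^bsub>localization K R M f\<^esub> frac f v t = frac f (P \<odot>\<^bsub>M\<^esub> v) m"
proof -
  let ?h = "\<lambda>p. loc_frac R M f (loc_act K R M f (diff_order K R \<delta>) \<delta> p)"
  have "?h (w, s) = frac f (P \<odot>\<^bsub>M\<^esub> v) m" if "(w, s) \<in> frac f v t" for w s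
  proof -
    have w: "w \<in> carrier M" "frac f v t = frac f w s" using that f v by (auto simp: frac_mem_iff)
    obtain n Q where Q: "Q \<in> carrier D" "pw f n \<otimes>\<^bsub>D\<^esub> \<delta> = Q \<otimes>\<^bsub>D\<^esub> pw f s"
      "loc_act K R M f (diff_order K R \<delta>) \<delta> (w, s) = (Q \<odot>\<^bsub>M\<^esub> w, n)"
      using loc_act_fraction[OF f diff_order[OF d], of s] w(1) by blast
    show ?thesis using frac_act_well_defined[OF f d P Q(1,2) v w] Q(3) by simp
  qed
  then have "?h ` frac f v t \<subseteq> {frac f (P \<odot>\<^bsub>M\<^esub> v) m}" by auto
  moreover have "(v, t) \<in> frac f v t" using f v by (simp add: frac_mem_iff)
  ultimately have "?h ` frac f v t = {frac f (P \<odot>\<^bsub>M\<^esub> v) m}" by blast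
  then show ?thesis by (simp add: localization_def)
qed

text \<open>Each axiom comes from an identity between Ore fractions. For sums, \<open>f\<^sup>m a = P f\<^sup>t\<close> and \<open>f\<^sup>n b = Q f\<^sup>t\<close> give
  \<open>f\<^bsup>m + n\<^esup> (a + b) = (f\<^sup>n P + f\<^sup>m Q) f\<^sup>t\<close>; for products, \<open>f\<^sup>m b = P f\<^sup>t\<close> and \<open>f\<^sup>n a = Q f\<^sup>m\<close> give
  \<open>f\<^sup>n (a b) = (Q P) f\<^sup>t\<close>.\<close>

lemma localization_left_module:
  assumes f: "f \<in> carrier R" shows "left_module D (localization K R M f)"
proof (rule left_moduleI)
  let ?L = "localization K R M f"
  note cd = common_denominator[OF f]
  note frac_act = frac_act[OF f] and frac_add = frac_add[OF f]
  have two: "\<exists>v\<in>carrier M. \<exists>w\<in>carrier M. \<exists>t. X = frac f v t \<and> Y = frac f w t"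
    if "X \<in> carrier ?L" "Y \<in> carrier ?L" for X Y
  proof -
    have "\<exists>t. \<forall>Z \<in> {X, Y}. \<exists>v \<in> carrier M. Z = frac f v t"
      by (rule cd) (simp_all add: that)
    then obtain t where t: "\<forall>Z \<in> {X, Y}. \<exists>v \<in> carrier M. Z = frac f v t" ..
    obtain v where v: "v \<in> carrier M" "X = frac f v t" using bspec[OF t, of X] by auto
    obtain w where w: "w \<in> carrier M" "Y = frac f w t" using bspec[OF t, of Y] by auto
    show ?thesis using v w by (intro bexI[of _ v] bexI[of _ w] exI[of _ t]) simp_all
  qed
  have one: "\<exists>v\<in>carrier M. \<exists>t. X = frac f v t" if "X \<in> carrier ?L" for X
    using that f by (auto simp: carrier_localization)
  show "ring D" by (rule Mod.A.ring_axioms)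
  show "abelian_group ?L"
  proof (rule abelian_groupI)
    fix X Y assume "X \<in> carrier ?L" "Y \<in> carrier ?L"
    then show "X \<oplus>\<^bsub>?L\<^esub> Y \<in> carrier ?L" "X \<oplus>\<^bsub>?L\<^esub> Y = Y \<oplus>\<^bsub>?L\<^esub> X"
      using two[of X Y] f frac_add by (auto simp: Mod.M.a_comm frac_closed)
  next
    show "\<zero>\<^bsub>?L\<^esub> \<in> carrier ?L" using frac_zero[OF f, of 0] frac_closed[OF f, of "\<zero>\<^bsub>M\<^esub>" 0] by simp
  next
    fix X Y Z assume "X \<in> carrier ?L" "Y \<in> carrier ?L" "Z \<in> carrier ?L"
    then obtain t where "\<forall>W \<in> {X, Y, Z}. \<exists>v \<in> carrier M. W = frac f v t"
      using cd[of "{X, Y, Z}"] by blast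
    then obtain x y z where "x \<in> carrier M" "y \<in> carrier M" "z \<in> carrier M"
      "X = frac f x t" "Y = frac f y t" "Z = frac f z t" by auto
    then show "(X \<oplus>\<^bsub>?L\<^esub> Y) \<oplus>\<^bsub>?L\<^esub> Z = X \<oplus>\<^bsub>?L\<^esub> (Y \<oplus>\<^bsub>?L\<^esub> Z)" using frac_add by (simp add: Mod.M.a_assoc)
  next
    fix X assume "X \<in> carrier ?L"
    then obtain v t where v: "v \<in> carrier M" "X = frac f v t" using one by blast
    show "\<zero>\<^bsub>?L\<^esub> \<oplus>\<^bsub>?L\<^esub> X = X" using frac_zero[OF f, of t] frac_add[of "\<zero>\<^bsub>M\<^esub>" v t] v by simp
    show "\<exists>Y\<in>carrier ?L. Y \<oplus>\<^bsub>?L\<^esub> X = \<zero>\<^bsub>?L\<^esub>"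
      using frac_zero[OF f, of t] frac_add[of "\<ominus>\<^bsub>M\<^esub> v" v t] v f
      by (intro bexI[of _ "frac f (\<ominus>\<^bsub>M\<^esub> v) t"]) (auto simp: Mod.M.l_neg)
  qed
next
  let ?L = "localization K R M f"
  fix a X assume a: "a \<in> carrier D" and "X \<in> carrier ?L"
  then obtain v t where v: "v \<in> carrier M" "X = frac f v t" using f by (auto simp: carrier_localization)
  obtain m P where P: "P \<in> carrier D" "pw f m \<otimes>\<^bsub>D\<^esub> a = P \<otimes>\<^bsub>D\<^esub> pw f t" by (rule ore[OF f a])
  show "a \<odot>\<^bsub>?L\<^esub> X \<in> carrier ?L" using frac_act[OF f a P v(1)] v P(1) f by auto
  fix b assume b: "b \<in> carrier D"
  obtain n Q where Q: "Q \<in> carrier D" "pw f n \<otimes>\<^bsub>D\<^esub> b = Q \<otimes>\<^bsub>D\<^esub> pw f t" by (rule ore[OF f b])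
  let ?S = "pw f n \<otimes>\<^bsub>D\<^esub> P \<oplus>\<^bsub>D\<^esub> pw f m \<otimes>\<^bsub>D\<^esub> Q"
  have "pw f (m + n) \<otimes>\<^bsub>D\<^esub> (a \<oplus>\<^bsub>D\<^esub> b) = pw f n \<otimes>\<^bsub>D\<^esub> (pw f m \<otimes>\<^bsub>D\<^esub> a) \<oplus>\<^bsub>D\<^esub> pw f m \<otimes>\<^bsub>D\<^esub> (pw f n \<otimes>\<^bsub>D\<^esub> b)"
    using a b f by (simp add: Mod.A.m_assoc[symmetric] pw_add Mod.A.r_distr add.commute)
  also have "\<dots> = ?S \<otimes>\<^bsub>D\<^esub> pw f t"
    unfolding P(2) Q(2) using P(1) Q(1) f by (simp add: Mod.A.m_assoc Mod.A.l_distr)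
  finally have S: "pw f (m + n) \<otimes>\<^bsub>D\<^esub> (a \<oplus>\<^bsub>D\<^esub> b) = ?S \<otimes>\<^bsub>D\<^esub> pw f t" .
  have "(a \<oplus>\<^bsub>D\<^esub> b) \<odot>\<^bsub>?L\<^esub> X = frac f (?S \<odot>\<^bsub>M\<^esub> v) (m + n)"
    unfolding v(2) by (rule frac_act[OF f _ _ S v(1)]) (use a b P(1) Q(1) f in auto)
  also have "\<dots> = frac f (pw f n \<odot>\<^bsub>M\<^esub> (P \<odot>\<^bsub>M\<^esub> v)) (m + n) \<oplus>\<^bsub>?L\<^esub> frac f (pw f m \<odot>\<^bsub>M\<^esub> (Q \<odot>\<^bsub>M\<^esub> v)) (n + m)"
    using P(1) Q(1) v f by (simp add: add.commute[of n m] frac_add Mod.smult_l_distr Mod.smult_assoc)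
  also have "\<dots> = a \<odot>\<^bsub>?L\<^esub> X \<oplus>\<^bsub>?L\<^esub> b \<odot>\<^bsub>?L\<^esub> X"
    using P Q v f a b by (simp add: frac_raise frac_act)
  finally show "(a \<oplus>\<^bsub>D\<^esub> b) \<odot>\<^bsub>?L\<^esub> X = a \<odot>\<^bsub>?L\<^esub> X \<oplus>\<^bsub>?L\<^esub> b \<odot>\<^bsub>?L\<^esub> X" .
next
  let ?L = "localization K R M f"
  fix a X Y assume a: "a \<in> carrier D" and XY: "X \<in> carrier ?L" "Y \<in> carrier ?L"
  obtain t where "\<forall>W \<in> {X, Y}. \<exists>v \<in> carrier M. W = frac f v t"
    using common_denominator[OF f, of "{X, Y}"] XY by blast
  then obtain x y where x: "x \<in> carrier M" "y \<in> carrier M" "X = frac f x t" "Y = frac f y t" by auto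
  obtain m P where P: "P \<in> carrier D" "pw f m \<otimes>\<^bsub>D\<^esub> a = P \<otimes>\<^bsub>D\<^esub> pw f t" by (rule ore[OF f a])
  show "a \<odot>\<^bsub>?L\<^esub> (X \<oplus>\<^bsub>?L\<^esub> Y) = a \<odot>\<^bsub>?L\<^esub> X \<oplus>\<^bsub>?L\<^esub> a \<odot>\<^bsub>?L\<^esub> Y"
    using x P(1) f by (simp add: frac_add frac_act[OF f a P] Mod.smult_r_distr)
next
  let ?L = "localization K R M f"
  fix a b X assume a: "a \<in> carrier D" and b: "b \<in> carrier D" and "X \<in> carrier ?L"
  then obtain v t where v: "v \<in> carrier M" "X = frac f v t" using f by (auto simp: carrier_localization)
  obtain m P where P: "P \<in> carrier D" "pw f m \<otimes>\<^bsub>D\<^esub> b = P \<otimes>\<^bsub>D\<^esub> pw f t" by (rule ore[OF f b])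
  obtain n Q where Q: "Q \<in> carrier D" "pw f n \<otimes>\<^bsub>D\<^esub> a = Q \<otimes>\<^bsub>D\<^esub> pw f m" by (rule ore[OF f a])
  have QP: "pw f n \<otimes>\<^bsub>D\<^esub> (a \<otimes>\<^bsub>D\<^esub> b) = (Q \<otimes>\<^bsub>D\<^esub> P) \<otimes>\<^bsub>D\<^esub> pw f t"
    using a b f P Q by (simp add: Mod.A.m_assoc[symmetric]) (simp add: Mod.A.m_assoc)
  have "(a \<otimes>\<^bsub>D\<^esub> b) \<odot>\<^bsub>?L\<^esub> X = frac f ((Q \<otimes>\<^bsub>D\<^esub> P) \<odot>\<^bsub>M\<^esub> v) n"
    unfolding v(2) by (rule frac_act[OF f _ _ QP v(1)]) (use a b P(1) Q(1) in auto)
  also have "\<dots> = a \<odot>\<^bsub>?L\<^esub> (b \<odot>\<^bsub>?L\<^esub> X)"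
    using v P(1) Q(1) by (simp add: frac_act[OF f b P] frac_act[OF f a Q] Mod.smult_assoc)
  finally show "(a \<otimes>\<^bsub>D\<^esub> b) \<odot>\<^bsub>?L\<^esub> X = a \<odot>\<^bsub>?L\<^esub> (b \<odot>\<^bsub>?L\<^esub> X)" .
next
  let ?L = "localization K R M f"
  fix X assume "X \<in> carrier ?L"
  then obtain v t where v: "v \<in> carrier M" "X = frac f v t" using f by (auto simp: carrier_localization)
  show "\<one>\<^bsub>D\<^esub> \<odot>\<^bsub>?L\<^esub> X = X"
    using frac_act[OF f, of "\<one>\<^bsub>D\<^esub>" "\<one>\<^bsub>D\<^esub>" t t v] v f by simp
qed

end

section \<open>Localizations of holonomic modules\<close>

context diff_op_module
begin

lemma diff_ops_field_algebra:
  assumes "vectorspace K D" shows "field_algebra K D"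
proof -
  interpret VD: vectorspace K D by fact
  have val: "\<delta> x \<in> carrier R" "c \<in> carrier K \<Longrightarrow> \<delta> (c \<odot>\<^bsub>R\<^esub> x) = c \<odot>\<^bsub>R\<^esub> \<delta> x"
    if "\<delta> \<in> carrier D" "x \<in> carrier R" for \<delta> x c
    using End_of_D[OF that(1)] that(2) by (auto simp: End_algebra_def module_hom_def)
  have sm: "c \<odot>\<^bsub>D\<^esub> \<delta> = (\<lambda>x \<in> carrier R. c \<odot>\<^bsub>R\<^esub> \<delta> x)" for c \<delta>
    by (simp add: diff_ops_def End_algebra_def)
  show ?thesis
  proof (intro field_algebra.intro field_algebra_axioms.intro)
    show "vectorspace K D" "ring D" by unfold_locales
    fix c a b assume "c \<in> carrier K" "a \<in> carrier D" "b \<in> carrier D"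
    then show "c \<odot>\<^bsub>D\<^esub> a \<otimes>\<^bsub>D\<^esub> b = c \<odot>\<^bsub>D\<^esub> (a \<otimes>\<^bsub>D\<^esub> b)" "a \<otimes>\<^bsub>D\<^esub> (c \<odot>\<^bsub>D\<^esub> b) = c \<odot>\<^bsub>D\<^esub> (a \<otimes>\<^bsub>D\<^esub> b)"
      by (auto simp: sm diff_ops_simps(1) compose_def val intro!: restrict_ext)
  qed
qed

end

locale dominated_diff_op_module = diff_op_module K R M + LS: linearly_simple_algebra K "diff_ops K R" F
  for K :: "('k, 'x) ring_scheme" and R :: "('k, 'r, 'y) module_scheme"
    and M :: "('r \<Rightarrow> 'r, 'm, 'z) module_scheme" and F +
  assumes dominated: "linearly_dominated_by_order K R F"
begin

lemma F_mult: "a \<in> F i \<Longrightarrow> b \<in> F j \<Longrightarrow> a \<otimes>\<^bsub>D\<^esub> b \<in> F (i + j)"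
  using LS.filt by (auto simp: algebra_filtration_def)

lemma F_submodule: "submodule K (F i) D"
  using LS.filt_exhaustive fin_dim_subspaceD(2) by (auto simp: exhaustive_fin_dim_sequence_def)

lemma F_diff:
  assumes "a \<in> F i" "b \<in> F i" shows "a \<ominus>\<^bsub>D\<^esub> b \<in> F i"
proof -
  interpret S: submodule K "F i" D by (rule F_submodule)
  have b: "b \<in> carrier D" by (rule LS.filt_carrier[OF assms(2)])
  have "(\<ominus>\<^bsub>K\<^esub> \<one>\<^bsub>K\<^esub>) \<odot>\<^bsub>D\<^esub> b = \<ominus>\<^bsub>D\<^esub> b" by (rule LS.V.smult_minus_1[OF b])
  then have "\<ominus>\<^bsub>D\<^esub> b \<in> F i" using S.smult_closed[OF _ assms(2), of "\<ominus>\<^bsub>K\<^esub> \<one>\<^bsub>K\<^esub>"] by simp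
  then show ?thesis unfolding a_minus_def using S.m_closed[OF assms(1)] by simp
qed

lemma pw_F:
  assumes f: "f \<in> carrier R" "mult_op R f \<in> F a" shows "pw f k \<in> F (a * k)"
proof (induction k)
  case 0
  have "\<one>\<^bsub>K\<^esub> \<odot>\<^bsub>D\<^esub> \<one>\<^bsub>D\<^esub> \<in> F 0" using LS.filt unfolding algebra_filtration_def by blast
  then show ?case by (simp add: mult_op_one)
next
  case (Suc k)
  have "pw f (Suc k) = pw f k \<otimes>\<^bsub>D\<^esub> mult_op R f" using f by (simp add: mult_op_mult)
  then show ?case using F_mult[OF Suc f(2)] by (simp add: add.commute)
qed

text \<open>The fraction produced by the recursion has denominator exponent \<open>(n + 1) t\<close>, too large for a linear
  filtration. Clearing one factor \<open>f\<close> at a time by \<open>f \<delta> = \<delta> f - [\<delta>, f]\<close> raises the exponent only by the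
  order \<open>n\<close>. The induction is on \<open>n\<close>, which decreases for the commutator, and then on \<open>t\<close>.\<close>

lemma ore_growth:
  assumes f: "f \<in> carrier R" "mult_op R f \<in> F a"
  shows "\<delta> \<in> Op n \<Longrightarrow> \<delta> \<in> F i \<Longrightarrow> \<exists>P \<in> F (i + a * n). pw f (t + n) \<otimes>\<^bsub>D\<^esub> \<delta> = P \<otimes>\<^bsub>D\<^esub> pw f t"
proof (induction n arbitrary: \<delta> i t)
  case 0
  then show ?case using Op_0_commute[OF 0(1), of "f [^]\<^bsub>R\<^esub> t"] f by (intro bexI[of _ \<delta>]) auto
next
  case (Suc n)
  note n_IH = Suc.IH and op = Suc.prems(1) and fi = Suc.prems(2)
  have d: "\<delta> \<in> carrier D" by (rule Op_closed[OF op])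
  have mf: "mult_op R f \<in> carrier D" using f by simp
  show ?case
  proof (induction t)
    case 0
    have "pw f (Suc n) \<otimes>\<^bsub>D\<^esub> \<delta> \<in> F (a * Suc n + i)" by (rule F_mult[OF pw_F[OF f] fi])
    then show ?case using d f by (intro bexI[of _ "pw f (Suc n) \<otimes>\<^bsub>D\<^esub> \<delta>"]) (simp_all add: add.commute mult_op_one)
  next
    case (Suc t)
    then obtain P where P: "P \<in> F (i + a * Suc n)" "pw f (t + Suc n) \<otimes>\<^bsub>D\<^esub> \<delta> = P \<otimes>\<^bsub>D\<^esub> pw f t" by blast
    define C where "C = \<delta> \<otimes>\<^bsub>D\<^esub> mult_op R f \<ominus>\<^bsub>D\<^esub> mult_op R f \<otimes>\<^bsub>D\<^esub> \<delta>"
    have C1: "C \<in> Op n" unfolding C_def by (rule Op_Suc_commutator(2)[OF op f(1)])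
    have C2: "C \<in> F (i + a)" unfolding C_def
      using F_diff[OF F_mult[OF fi f(2)]] F_mult[OF f(2) fi] by (simp add: add.commute)
    obtain Q where Q: "Q \<in> F (i + a + a * n)" "pw f (Suc t + n) \<otimes>\<^bsub>D\<^esub> C = Q \<otimes>\<^bsub>D\<^esub> pw f (Suc t)"
      using n_IH[OF C1 C2] by blast
    have Q1: "Q \<in> F (i + a * Suc n)" using Q(1) by (simp add: add.assoc)
    have Pc: "P \<in> carrier D" and Qc: "Q \<in> carrier D" using LS.filt_carrier P(1) Q(1) by blast+
    have Cc: "C \<in> carrier D" by (rule Op_closed[OF C1])
    have fd: "mult_op R f \<otimes>\<^bsub>D\<^esub> \<delta> = \<delta> \<otimes>\<^bsub>D\<^esub> mult_op R f \<ominus>\<^bsub>D\<^esub> C"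
      unfolding C_def using d mf by (simp add: a_minus_def Mod.A.minus_add Mod.A.a_assoc[symmetric] Mod.A.r_neg)
    have pS: "pw f (Suc m) = pw f m \<otimes>\<^bsub>D\<^esub> mult_op R f" for m using f by (simp add: mult_op_mult)
    have tn: "t + Suc n = Suc t + n" by simp
    \<comment> \<open>\<open>f\<^bsup>t + 1 + n + 1\<^esup> \<delta> = f\<^bsup>t + n + 1\<^esup> (\<delta> f - [\<delta>, f])\<close>, and both terms are known by induction.\<close>
    have "pw f (Suc t + Suc n) \<otimes>\<^bsub>D\<^esub> \<delta> = pw f (t + Suc n) \<otimes>\<^bsub>D\<^esub> (mult_op R f \<otimes>\<^bsub>D\<^esub> \<delta>)"
      using d mf f(1) by (simp only: add_Suc pS Mod.A.m_assoc pw_closed)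
    also have "\<dots> = (pw f (t + Suc n) \<otimes>\<^bsub>D\<^esub> \<delta>) \<otimes>\<^bsub>D\<^esub> mult_op R f \<ominus>\<^bsub>D\<^esub> pw f (Suc t + n) \<otimes>\<^bsub>D\<^esub> C"
      unfolding fd tn using d mf Cc f(1)
      by (simp add: a_minus_def Mod.A.r_distr Mod.A.r_minus Mod.A.m_assoc del: nat_pow_Suc)
    also have "\<dots> = P \<otimes>\<^bsub>D\<^esub> pw f (Suc t) \<ominus>\<^bsub>D\<^esub> Q \<otimes>\<^bsub>D\<^esub> pw f (Suc t)"
      unfolding P(2) Q(2) pS[of t] using Pc mf f(1) by (simp only: Mod.A.m_assoc pw_closed)
    also have "\<dots> = (P \<ominus>\<^bsub>D\<^esub> Q) \<otimes>\<^bsub>D\<^esub> pw f (Suc t)"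
      using Pc Qc f(1) pw_closed[OF f(1), of "Suc t"]
      by (simp only: a_minus_def Mod.A.l_distr Mod.A.l_minus Mod.A.a_inv_closed)
    finally show ?case using F_diff[OF P(1) Q1] by blast
  qed
qed

lemma frac_hom:
  assumes f: "f \<in> carrier R"
  shows "(\<lambda>v. frac f v s) \<in> module_hom K (restrict_scalars D M) (restrict_scalars D (localization K R M f))"
proof -
  have "frac f ((c \<odot>\<^bsub>D\<^esub> \<one>\<^bsub>D\<^esub>) \<odot>\<^bsub>M\<^esub> v) s = (c \<odot>\<^bsub>D\<^esub> \<one>\<^bsub>D\<^esub>) \<odot>\<^bsub>localization K R M f\<^esub> frac f v s"
    if c: "c \<in> carrier K" and v: "v \<in> carrier M" for c v
    using frac_act[OF f LS.scalar_closed[OF c] LS.scalar_closed[OF c] _ v, of s s]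
      LS.scalar_mult[OF c pw_closed[OF f]] LS.mult_scalar[OF c pw_closed[OF f]] by simp
  then show ?thesis using f by (auto simp: module_hom_def frac_add)
qed

text \<open>The subspaces \<open>H\<^sup>i = f\<^bsup>-Ci\<^esup> G\<^bsup>bi\<^esup>\<close> with \<open>b = 1 + aC\<close> filter \<open>M\<^sub>f\<close>. If \<open>\<delta> \<in> F\<^sup>i\<close>, then \<open>\<delta>\<close> has order at most
  \<open>Ci\<close>, so it sends \<open>f\<^bsup>-Cj\<^esup> G\<^bsup>bj\<^esup>\<close> into \<open>f\<^bsup>-C(i + j)\<^esup> F\<^bsup>i + aCi\<^esup> G\<^bsup>bj\<^esup> \<subseteq> H\<^bsup>i + j\<^esup>\<close>; this computation
  dictates the choice of \<open>b\<close>.\<close>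

theorem localization_holonomic:
  assumes f: "f \<in> carrier R" and M: "holonomic K D F M"
  shows "holonomic K D F (localization K R M f)"
proof -
  let ?L = "localization K R M f"
  obtain G where G: "compatible_filtration K D F M G" and t: "poly_growth K (restrict_scalars D M) G LS.half_dim"
    using M LS.holonomic_iff by blast
  have exG: "exhaustive_fin_dim_sequence K (restrict_scalars D M) G"
    and act: "\<And>i j a v. a \<in> F i \<Longrightarrow> v \<in> G j \<Longrightarrow> a \<odot>\<^bsub>M\<^esub> v \<in> G (i + j)"
    using G by (auto simp: compatible_filtration_def)
  have fdG: "\<And>i. fin_dim_subspace K (restrict_scalars D M) (G i)" and un: "(\<Union>i. G i) = carrier M"
    using exG by (auto simp: exhaustive_fin_dim_sequence_def)
  note Gc = LS.compatible_carrier[OF G]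
  have Gm: "i \<le> j \<Longrightarrow> v \<in> G i \<Longrightarrow> v \<in> G j" for i j v using exhaustive_mono[OF exG] by blast
  obtain C where C: "0 < C" "\<And>i. F i \<subseteq> Op (C * i)" using dominated by (auto simp: linearly_dominated_by_order_def)
  have "mult_op R f \<in> (\<Union>i. F i)"
    using LS.filt_exhaustive mult_op_closed[OF f] by (simp add: exhaustive_fin_dim_sequence_def)
  then obtain a where a: "mult_op R f \<in> F a" by blast
  define b where "b = 1 + a * C"
  define H where "H i = (\<lambda>v. frac f v (C * i)) ` G (b * i)" for i
  have L: "left_module D ?L" by (rule localization_left_module[OF f])
  note fd = linear_image_fin_dim[OF LS.restrict_scalars_vectorspace[OF L] frac_hom[OF f] fdG]
  \<comment> \<open>Rewriting \<open>v/f\<^sup>s\<close> with denominator \<open>f\<^bsup>Ci\<^esup>\<close> costs at most \<open>aCi\<close> in the filtration.\<close>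
  have shift: "frac f v s \<in> H i" if v: "v \<in> G j" and s: "s \<le> C * i" and j: "j + a * (C * i) \<le> b * i" for v s i j
  proof -
    have "pw f (C * i - s) \<odot>\<^bsub>M\<^esub> v \<in> G (a * (C * i - s) + j)" by (rule act[OF pw_F[OF f a] v])
    moreover have "a * (C * i - s) \<le> a * (C * i)" by (intro mult_le_mono) auto
    then have "a * (C * i - s) + j \<le> b * i" using j by linarith
    ultimately have "pw f (C * i - s) \<odot>\<^bsub>M\<^esub> v \<in> G (b * i)" using Gm by blast
    moreover have "frac f v s = frac f (pw f (C * i - s) \<odot>\<^bsub>M\<^esub> v) (C * i)"
      using frac_raise[OF f Gc[OF v], of "C * i - s" s] s by simp
    ultimately show ?thesis unfolding H_def by blast
  qed
  have "compatible_filtration K D F ?L H"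
    unfolding compatible_filtration_def exhaustive_fin_dim_sequence_def
  proof (intro conjI allI ballI)
    fix i show "fin_dim_subspace K (restrict_scalars D ?L) (H i)" unfolding H_def by (rule fd(1))
  next
    fix i show "H i \<subseteq> H (Suc i)"
    proof
      fix X assume "X \<in> H i"
      then obtain v where v: "v \<in> G (b * i)" "X = frac f v (C * i)" by (auto simp: H_def)
      have "pw f C \<odot>\<^bsub>M\<^esub> v \<in> G (a * C + b * i)" by (rule act[OF pw_F[OF f a] v(1)])
      then have "pw f C \<odot>\<^bsub>M\<^esub> v \<in> G (b * Suc i)" by (rule Gm[rotated]) (simp add: b_def)
      moreover have "X = frac f (pw f C \<odot>\<^bsub>M\<^esub> v) (C * Suc i)"
        using frac_raise[OF f Gc[OF v(1)], of C "C * i"] v(2) by (simp add: add.commute)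
      ultimately show "X \<in> H (Suc i)" unfolding H_def by blast
    qed
  next
    show "(\<Union>i. H i) = carrier (restrict_scalars D ?L)"
    proof (intro equalityI subsetI)
      fix X assume "X \<in> (\<Union>i. H i)"
      then show "X \<in> carrier (restrict_scalars D ?L)" using f Gc by (auto simp: H_def)
    next
      fix X assume "X \<in> carrier (restrict_scalars D ?L)"
      then obtain v s where v: "v \<in> carrier M" "X = frac f v s" using f by (auto simp: carrier_localization)
      then obtain j where j: "v \<in> G j" using un by blast
      define i where "i = j + s"
      have "1 * i \<le> C * i" using C(1) by (intro mult_le_mono) auto
      moreover have "s \<le> i" by (simp add: i_def)
      ultimately have "s \<le> C * i" by linarith
      moreover have "j + a * (C * i) \<le> b * i" by (simp add: b_def add_mult_distrib i_def mult.assoc)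
      ultimately have "X \<in> H i" unfolding v(2) by (rule shift[OF j])
      then show "X \<in> (\<Union>i. H i)" by blast
    qed
  next
    fix i j \<delta> X assume d: "\<delta> \<in> F i" and "X \<in> H j"
    then obtain v where v: "v \<in> G (b * j)" "X = frac f v (C * j)" by (auto simp: H_def)
    obtain P where P: "P \<in> F (i + a * (C * i))" "pw f (C * j + C * i) \<otimes>\<^bsub>D\<^esub> \<delta> = P \<otimes>\<^bsub>D\<^esub> pw f (C * j)"
      using ore_growth[OF f a _ d, of "C * i" "C * j"] C(2) d by blast
    have "\<delta> \<odot>\<^bsub>?L\<^esub> X = frac f (P \<odot>\<^bsub>M\<^esub> v) (C * j + C * i)"
      unfolding v(2) by (rule frac_act[OF f LS.filt_carrier[OF d] LS.filt_carrier[OF P(1)] P(2) Gc[OF v(1)]])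
    moreover have "P \<odot>\<^bsub>M\<^esub> v \<in> G (b * (i + j))"
      using act[OF P(1) v(1)] by (simp add: b_def algebra_simps)
    moreover have "C * j + C * i = C * (i + j)" by (simp add: algebra_simps)
    ultimately show "\<delta> \<odot>\<^bsub>?L\<^esub> X \<in> H (i + j)" unfolding H_def by auto
  qed
  moreover have "poly_growth K (restrict_scalars D ?L) H LS.half_dim"
    by (rule poly_growth_scale[OF t, of b]) (use fd(2) in \<open>simp_all add: b_def dim_at_def H_def\<close>)
  ultimately show ?thesis using L LS.holonomic_iff by blast
qed

end

section \<open>The Cech complex\<close>

text \<open>Removing one index \<open>x\<close> from \<open>T\<close> removes the terms \<open>b x i\<close> and \<open>b i x\<close>, which cancel.\<close>

lemma (in abelian_group) finsum_antisymmetric: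
  assumes "finite T" "\<And>i k. i \<in> T \<Longrightarrow> k \<in> T \<Longrightarrow> i \<noteq> k \<Longrightarrow> b i k \<in> carrier G"
    "\<And>i k. i \<in> T \<Longrightarrow> k \<in> T \<Longrightarrow> i \<noteq> k \<Longrightarrow> b i k \<oplus> b k i = \<zero>"
  shows "finsum G (\<lambda>i. finsum G (b i) (T - {i})) T = \<zero>"
  using assms
proof (induction T rule: finite_induct)
  case empty then show ?case by simp
next
  case (insert x T)
  note c = insert.prems(1)
  have bx: "b x \<in> T \<rightarrow> carrier G" "(\<lambda>i. b i x) \<in> T \<rightarrow> carrier G" using c insert.hyps(2) by auto
  have inner: "(\<lambda>i. finsum G (b i) (T - {i})) \<in> T \<rightarrow> carrier G" using c by (auto intro!: finsum_closed)
  have split: "finsum G (b i) (insert x T - {i}) = b i x \<oplus> finsum G (b i) (T - {i})" if "i \<in> T" for i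
  proof -
    have "insert x T - {i} = insert x (T - {i})" using that insert.hyps by auto
    then show ?thesis using c that insert.hyps by (auto intro!: finsum_insert)
  qed
  have outer: "(\<lambda>i. finsum G (b i) (insert x T - {i})) \<in> T \<rightarrow> carrier G" using c by (auto intro!: finsum_closed)
  have hd: "finsum G (b x) (insert x T - {x}) = finsum G (b x) T"
    using insert.hyps(2) by (simp add: insert_Diff_if)
  have hdc: "finsum G (b x) (insert x T - {x}) \<in> carrier G" unfolding hd using bx by simp
  have "finsum G (\<lambda>i. finsum G (b i) (insert x T - {i})) (insert x T) =
    finsum G (b x) (insert x T - {x}) \<oplus> finsum G (\<lambda>i. finsum G (b i) (insert x T - {i})) T"
    by (rule finsum_insert[OF insert.hyps outer hdc])
  also have "finsum G (\<lambda>i. finsum G (b i) (insert x T - {i})) T =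
      finsum G (\<lambda>i. b i x \<oplus> finsum G (b i) (T - {i})) T"
    by (rule finsum_cong') (use split bx inner in auto)
  also have "\<dots> = finsum G (\<lambda>i. b i x) T \<oplus> finsum G (\<lambda>i. finsum G (b i) (T - {i})) T"
    by (rule finsum_addf[OF bx(2) inner])
  also have "finsum G (\<lambda>i. finsum G (b i) (T - {i})) T = \<zero>"
    by (rule insert.IH) (use insert.prems in auto)
  finally have "finsum G (\<lambda>i. finsum G (b i) (insert x T - {i})) (insert x T) =
      finsum G (b x) T \<oplus> finsum G (\<lambda>i. b i x) T"
    unfolding hd using bx by simp
  also have "\<dots> = finsum G (\<lambda>i. b x i \<oplus> b i x) T" by (rule finsum_addf[symmetric, OF bx])
  also have "\<dots> = finsum G (\<lambda>i. \<zero>) T"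
    by (rule finsum_cong') (use insert.prems(2) insert.hyps(2) in auto)
  finally show ?case by simp
qed

lemma (in abelian_group) signed_closed [simp]: "x \<in> carrier G \<Longrightarrow> signed G n x \<in> carrier G"
  by (simp add: signed_def)

lemma (in abelian_group) signed_add:
  "x \<in> carrier G \<Longrightarrow> y \<in> carrier G \<Longrightarrow> signed G n (x \<oplus> y) = signed G n x \<oplus> signed G n y"
  by (simp add: signed_def minus_add)

lemma (in abelian_group) signed_signed:
  "x \<in> carrier G \<Longrightarrow> signed G m (signed G n x) = signed G (m + n) x"
  by (simp add: signed_def)

lemma signed_hom:
  assumes M: "left_module A M" and N: "left_module A N" and T: "T \<in> module_hom A M N" and x: "x \<in> carrier M"
  shows "T (signed M n x) = signed N n (T x)"
proof -
  interpret M: left_module A M by fact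
  interpret N: left_module A N by fact
  have Tc: "y \<in> carrier M \<Longrightarrow> T y \<in> carrier N" for y using module_hom_closed[OF T] by auto
  have "T (\<ominus>\<^bsub>M\<^esub> x) \<oplus>\<^bsub>N\<^esub> T x = \<zero>\<^bsub>N\<^esub>"
    using module_hom_add[OF T, of "\<ominus>\<^bsub>M\<^esub> x" x] hom_zero[OF M N T] x by (simp add: M.M.l_neg)
  then have "\<ominus>\<^bsub>N\<^esub> T x = T (\<ominus>\<^bsub>M\<^esub> x)" using Tc x by (intro N.M.minus_equality) auto
  then show ?thesis by (simp add: signed_def)
qed

lemma (in left_module) signed_smult:
  "a \<in> carrier A \<Longrightarrow> x \<in> carrier M \<Longrightarrow> signed M n (a \<odot>\<^bsub>M\<^esub> x) = a \<odot>\<^bsub>M\<^esub> signed M n x"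
  by (simp add: signed_def smult_r_minus)

lemma (in left_module) finsum_smult:
  assumes "a \<in> carrier A" "g \<in> I \<rightarrow> carrier M"
  shows "a \<odot>\<^bsub>M\<^esub> finsum M g I = finsum M (\<lambda>i. a \<odot>\<^bsub>M\<^esub> g i) I"
  using assms
proof (induction I rule: infinite_finite_induct)
  case (insert i I)
  then have "(\<lambda>i. a \<odot>\<^bsub>M\<^esub> g i) \<in> I \<rightarrow> carrier M" by auto
  with insert show ?case by (simp add: smult_r_distr Pi_iff)
qed auto

lemma hom_finsum:
  assumes M: "left_module A M" and N: "left_module A N" and T: "T \<in> module_hom A M N"
    and g: "g \<in> I \<rightarrow> carrier M"
  shows "T (finsum M g I) = finsum N (\<lambda>i. T (g i)) I"
proof -
  interpret M: left_module A M by fact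
  interpret N: left_module A N by fact
  have Tc: "y \<in> carrier M \<Longrightarrow> T y \<in> carrier N" for y using module_hom_closed[OF T] by auto
  show ?thesis using g
  proof (induction I rule: infinite_finite_induct)
    case (insert i I)
    then have "(\<lambda>i. T (g i)) \<in> I \<rightarrow> carrier N" using Tc by auto
    with insert show ?case using Tc by (simp add: Pi_iff module_hom_add[OF T])
  qed (simp_all add: hom_zero[OF M N T])
qed

context diff_op_module
begin

abbreviation Loc where "Loc f \<equiv> localization K R M f"

lemma pw_mult: "g \<in> carrier R \<Longrightarrow> h \<in> carrier R \<Longrightarrow> pw (g \<otimes>\<^bsub>R\<^esub> h) n = pw g n \<otimes>\<^bsub>D\<^esub> pw h n"
  by (simp add: mult_op_mult Alg.nat_pow_distrib)

lemma pw_comm: "g \<in> carrier R \<Longrightarrow> h \<in> carrier R \<Longrightarrow> pw g a \<otimes>\<^bsub>D\<^esub> pw h b = pw h b \<otimes>\<^bsub>D\<^esub> pw g a"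
  by (simp add: mult_op_mult Alg.m_comm)

lemma pw_smult_comm: "g \<in> carrier R \<Longrightarrow> h \<in> carrier R \<Longrightarrow> v \<in> carrier M \<Longrightarrow>
    pw g a \<odot>\<^bsub>M\<^esub> (pw h b \<odot>\<^bsub>M\<^esub> v) = pw h b \<odot>\<^bsub>M\<^esub> (pw g a \<odot>\<^bsub>M\<^esub> v)"
  by (simp add: Mod.smult_assoc[symmetric] pw_comm[of g h])

lemma pw_mult_smult: "g \<in> carrier R \<Longrightarrow> h \<in> carrier R \<Longrightarrow> v \<in> carrier M \<Longrightarrow>
    pw (g \<otimes>\<^bsub>R\<^esub> h) n \<odot>\<^bsub>M\<^esub> v = pw g n \<odot>\<^bsub>M\<^esub> (pw h n \<odot>\<^bsub>M\<^esub> v)"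
  by (simp add: pw_mult Mod.smult_assoc del: Alg.nat_pow_distrib)

lemma loc_map_frac:
  assumes g: "g \<in> carrier R" and h: "h \<in> carrier R" and v: "v \<in> carrier M"
  shows "loc_map R M g h (frac g v t) = frac (g \<otimes>\<^bsub>R\<^esub> h) (pw h t \<odot>\<^bsub>M\<^esub> v) t"
proof -
  let ?h = "\<lambda>(v, t). loc_frac R M (g \<otimes>\<^bsub>R\<^esub> h) (ring_act R M (h [^]\<^bsub>R\<^esub> t) v, t)"
  have "?h (w, s) = frac (g \<otimes>\<^bsub>R\<^esub> h) (pw h t \<odot>\<^bsub>M\<^esub> v) t" if "(w, s) \<in> frac g v t" for w s
  proof -
    have w: "w \<in> carrier M" "frac g v t = frac g w s" using that g v by (auto simp: frac_mem_iff)
    obtain u where u: "pw g (u + s) \<odot>\<^bsub>M\<^esub> v = pw g (u + t) \<odot>\<^bsub>M\<^esub> w"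
      using w frac_eq_iff[OF g v w(1)] by auto
    have "pw (g \<otimes>\<^bsub>R\<^esub> h) (u + t) \<odot>\<^bsub>M\<^esub> (pw h s \<odot>\<^bsub>M\<^esub> w) = pw h (u + t + s) \<odot>\<^bsub>M\<^esub> (pw g (u + t) \<odot>\<^bsub>M\<^esub> w)"
      using g h w by (simp only: pw_mult_smult pw_smult pw_smult_comm[of g h] Mod.smult_closed pw_closed)
    also have "\<dots> = pw h (u + s + t) \<odot>\<^bsub>M\<^esub> (pw g (u + s) \<odot>\<^bsub>M\<^esub> v)"
      unfolding u by (simp add: ac_simps)
    also have "\<dots> = pw (g \<otimes>\<^bsub>R\<^esub> h) (u + s) \<odot>\<^bsub>M\<^esub> (pw h t \<odot>\<^bsub>M\<^esub> v)"
      using g h v by (simp only: pw_mult_smult pw_smult pw_smult_comm[of g h] Mod.smult_closed pw_closed)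
    finally show ?thesis
      using g h v w by (auto simp: ring_act_def frac_eq_iff)
  qed
  then have "?h ` frac g v t \<subseteq> {frac (g \<otimes>\<^bsub>R\<^esub> h) (pw h t \<odot>\<^bsub>M\<^esub> v) t}" by auto
  moreover have "(v, t) \<in> frac g v t" using g v by (simp add: frac_mem_iff)
  ultimately have "?h ` frac g v t = {frac (g \<otimes>\<^bsub>R\<^esub> h) (pw h t \<odot>\<^bsub>M\<^esub> v) t}" by blast
  then show ?thesis by (simp add: loc_map_def)
qed

text \<open>If \<open>g\<^sup>m \<delta> = P g\<^sup>t\<close> and \<open>h\<^sup>k P = Q h\<^sup>t\<close>, then \<open>(g h)\<^bsup>m + k\<^esup> \<delta> = (h\<^sup>m g\<^sup>k Q) (g h)\<^sup>t\<close>. So an Ore fraction for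
  \<open>\<delta>\<close> with respect to \<open>g h\<close> is obtained from one with respect to \<open>g\<close>, and both sides of the linearity
  equation can be computed.\<close>

lemma loc_map_hom:
  assumes g: "g \<in> carrier R" and h: "h \<in> carrier R"
  shows "loc_map R M g h \<in> module_hom D (Loc g) (Loc (g \<otimes>\<^bsub>R\<^esub> h))"
proof -
  let ?T = "loc_map R M g h"
  have gh: "g \<otimes>\<^bsub>R\<^esub> h \<in> carrier R" using g h by simp
  note frac = loc_map_frac[OF g h]
  have ph: "pw h n \<odot>\<^bsub>M\<^esub> v \<in> carrier M" if "v \<in> carrier M" for n v using that h by simp
  have cl: "?T X \<in> carrier (Loc (g \<otimes>\<^bsub>R\<^esub> h))" if X: "X \<in> carrier (Loc g)" for X
  proof -
    obtain v t where v: "v \<in> carrier M" "X = frac g v t" using X g by (auto simp: carrier_localization)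
    show ?thesis unfolding v(2) frac[OF v(1)] by (rule frac_closed[OF gh ph[OF v(1)]])
  qed
  have ad: "?T (X \<oplus>\<^bsub>Loc g\<^esub> Y) = ?T X \<oplus>\<^bsub>Loc (g \<otimes>\<^bsub>R\<^esub> h)\<^esub> ?T Y"
    if XY: "X \<in> carrier (Loc g)" "Y \<in> carrier (Loc g)" for X Y
  proof -
    have "\<exists>t. \<forall>Z \<in> {X, Y}. \<exists>v \<in> carrier M. Z = frac g v t"
      by (rule common_denominator[OF g]) (simp_all add: XY)
    then obtain t where t: "\<forall>Z \<in> {X, Y}. \<exists>v \<in> carrier M. Z = frac g v t" ..
    obtain v where v: "v \<in> carrier M" "X = frac g v t" using bspec[OF t, of X] by auto
    obtain w where w: "w \<in> carrier M" "Y = frac g w t" using bspec[OF t, of Y] by auto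
    show ?thesis using v w g h gh
      by (simp add: frac_add frac ph Mod.smult_r_distr)
  qed
  have sm: "?T (\<delta> \<odot>\<^bsub>Loc g\<^esub> X) = \<delta> \<odot>\<^bsub>Loc (g \<otimes>\<^bsub>R\<^esub> h)\<^esub> ?T X"
    if d: "\<delta> \<in> carrier D" and X: "X \<in> carrier (Loc g)" for \<delta> X
  proof -
    obtain v t where v: "v \<in> carrier M" "X = frac g v t" using X g by (auto simp: carrier_localization)
    obtain m P where P: "P \<in> carrier D" "pw g m \<otimes>\<^bsub>D\<^esub> \<delta> = P \<otimes>\<^bsub>D\<^esub> pw g t" by (rule ore[OF g d])
    obtain k Q where Q: "Q \<in> carrier D" "pw h k \<otimes>\<^bsub>D\<^esub> P = Q \<otimes>\<^bsub>D\<^esub> pw h t" by (rule ore[OF h P(1)])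
    let ?a = "pw h m \<otimes>\<^bsub>D\<^esub> pw g k"
    let ?S = "?a \<otimes>\<^bsub>D\<^esub> Q"
    have ca: "?a \<in> carrier D" "pw g m \<in> carrier D" "pw h k \<in> carrier D" "pw g t \<in> carrier D" "pw h t \<in> carrier D"
      "pw g k \<in> carrier D" "pw h m \<in> carrier D" using g h by auto
    have "pw (g \<otimes>\<^bsub>R\<^esub> h) (m + k) = (pw g k \<otimes>\<^bsub>D\<^esub> pw g m) \<otimes>\<^bsub>D\<^esub> (pw h m \<otimes>\<^bsub>D\<^esub> pw h k)"
      using g h by (simp only: pw_mult pw_add add.commute)
    also have "\<dots> = ?a \<otimes>\<^bsub>D\<^esub> (pw h k \<otimes>\<^bsub>D\<^esub> pw g m)"
      using g h by (simp add: mult_op_mult Alg.m_ac)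
    finally have "pw (g \<otimes>\<^bsub>R\<^esub> h) (m + k) \<otimes>\<^bsub>D\<^esub> \<delta> = ?a \<otimes>\<^bsub>D\<^esub> (pw h k \<otimes>\<^bsub>D\<^esub> (pw g m \<otimes>\<^bsub>D\<^esub> \<delta>))"
      using d ca by (simp only: Mod.A.m_assoc Mod.A.m_closed)
    also have "\<dots> = ?a \<otimes>\<^bsub>D\<^esub> ((pw h k \<otimes>\<^bsub>D\<^esub> P) \<otimes>\<^bsub>D\<^esub> pw g t)"
      unfolding P(2) using P(1) ca by (simp only: Mod.A.m_assoc Mod.A.m_closed)
    also have "\<dots> = ?S \<otimes>\<^bsub>D\<^esub> (pw h t \<otimes>\<^bsub>D\<^esub> pw g t)"
      unfolding Q(2) using Q(1) ca by (simp only: Mod.A.m_assoc Mod.A.m_closed)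
    also have "\<dots> = ?S \<otimes>\<^bsub>D\<^esub> pw (g \<otimes>\<^bsub>R\<^esub> h) t"
      using g h by (simp only: pw_mult pw_comm[of h g])
    finally have eq: "pw (g \<otimes>\<^bsub>R\<^esub> h) (m + k) \<otimes>\<^bsub>D\<^esub> \<delta> = ?S \<otimes>\<^bsub>D\<^esub> pw (g \<otimes>\<^bsub>R\<^esub> h) t" .
    have Sc: "?S \<in> carrier D" using ca Q(1) by simp
    have Pv: "P \<odot>\<^bsub>M\<^esub> v \<in> carrier M" using P(1) v by simp
    have "\<delta> \<odot>\<^bsub>Loc (g \<otimes>\<^bsub>R\<^esub> h)\<^esub> ?T X = frac (g \<otimes>\<^bsub>R\<^esub> h) (?S \<odot>\<^bsub>M\<^esub> (pw h t \<odot>\<^bsub>M\<^esub> v)) (m + k)"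
      unfolding v(2) frac[OF v(1)] by (rule frac_act[OF gh d Sc eq ph[OF v(1)]])
    also have "?S \<odot>\<^bsub>M\<^esub> (pw h t \<odot>\<^bsub>M\<^esub> v) = ?a \<odot>\<^bsub>M\<^esub> ((Q \<otimes>\<^bsub>D\<^esub> pw h t) \<odot>\<^bsub>M\<^esub> v)"
      using ca Q(1) v(1) by (simp only: Mod.smult_assoc Mod.smult_closed)
    also have "\<dots> = pw (g \<otimes>\<^bsub>R\<^esub> h) k \<odot>\<^bsub>M\<^esub> (pw h m \<odot>\<^bsub>M\<^esub> (P \<odot>\<^bsub>M\<^esub> v))"
      unfolding Q(2)[symmetric] using ca P(1) v(1) g h
      by (simp only: Mod.smult_assoc Mod.smult_closed pw_mult_smult)
        (simp only: pw_smult pw_smult_comm[of h g] Mod.smult_closed add.commute)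
    also have "frac (g \<otimes>\<^bsub>R\<^esub> h) (pw (g \<otimes>\<^bsub>R\<^esub> h) k \<odot>\<^bsub>M\<^esub> (pw h m \<odot>\<^bsub>M\<^esub> (P \<odot>\<^bsub>M\<^esub> v))) (m + k)
        = frac (g \<otimes>\<^bsub>R\<^esub> h) (pw h m \<odot>\<^bsub>M\<^esub> (P \<odot>\<^bsub>M\<^esub> v)) m"
      by (rule frac_raise[OF gh ph[OF Pv]])
    also have "\<dots> = ?T (\<delta> \<odot>\<^bsub>Loc g\<^esub> X)"
      unfolding v(2) frac_act[OF g d P v(1)] by (rule frac[OF Pv, symmetric])
    finally show ?thesis by simp
  qed
  show ?thesis using cl ad sm by (auto simp: module_hom_def)
qed

lemma loc_map_comm:
  assumes g: "g \<in> carrier R" and h: "h \<in> carrier R" and l: "l \<in> carrier R" and X: "X \<in> carrier (Loc g)"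
  shows "loc_map R M (g \<otimes>\<^bsub>R\<^esub> h) l (loc_map R M g h X) = loc_map R M (g \<otimes>\<^bsub>R\<^esub> l) h (loc_map R M g l X)"
proof -
  obtain v t where v: "v \<in> carrier M" "X = frac g v t" using X g by (auto simp: carrier_localization)
  have "g \<otimes>\<^bsub>R\<^esub> h \<otimes>\<^bsub>R\<^esub> l = g \<otimes>\<^bsub>R\<^esub> l \<otimes>\<^bsub>R\<^esub> h" using g h l by (simp add: Alg.m_ac)
  then show ?thesis using g h l v
    by (simp add: loc_map_frac pw_smult_comm[of l h])
qed

context
  fixes fs assumes fs: "set fs \<subseteq> carrier R"
begin

abbreviation cp where "cp \<equiv> cech_prod R fs"
abbreviation LL where "LL S \<equiv> Loc (cp S)"
abbreviation CC where "CC \<equiv> cech_module K R M fs"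

lemma fs_nth: "i < length fs \<Longrightarrow> fs ! i \<in> carrier R"
  using fs nth_mem by blast

lemma cp_closed: "S \<subseteq> {..<length fs} \<Longrightarrow> cp S \<in> carrier R"
  unfolding cech_prod_def using fs_nth by (intro Alg.finprod_closed) auto

lemma cp_remove:
  assumes "T \<subseteq> {..<length fs}" "i \<in> T" shows "cp (T - {i}) \<otimes>\<^bsub>R\<^esub> fs ! i = cp T"
proof -
  have fin: "finite T" using assms(1) finite_subset by blast
  have "cp (insert i (T - {i})) = fs ! i \<otimes>\<^bsub>R\<^esub> cp (T - {i})"
    unfolding cech_prod_def using assms fin fs_nth by (intro Alg.finprod_insert) auto
  then show ?thesis using assms cp_closed[of "T - {i}"] fs_nth
    by (simp add: insert_absorb Alg.m_comm subset_iff)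
qed

lemma cech_module_eq: "CC j = prod_module (cech_index fs j) LL"
  by (simp add: cech_module_def prod_module_def Let_def)

lemma cech_indexD:
  assumes "S \<in> cech_index fs j"
  shows "S \<subseteq> {..<length fs}" "finite S" "cp S \<in> carrier R"
  using assms finite_subset[of S "{..<length fs}"] cp_closed by (auto simp: cech_index_def)

lemma cech_index_remove: "T \<in> cech_index fs (Suc j) \<Longrightarrow> i \<in> T \<Longrightarrow> T - {i} \<in> cech_index fs j"
  using cech_indexD(2)[of T "Suc j"] by (auto simp: cech_index_def card_Diff_singleton)

lemma cech_left_module: "left_module D (CC j)"
  unfolding cech_module_eq
  by (rule prod_module_left_module[OF Mod.A.ring_axioms localization_left_module[OF cech_indexD(3)]])

abbreviation face where "face T i \<equiv> loc_map R M (cp (T - {i})) (fs ! i)"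

lemma face_hom:
  assumes "T \<subseteq> {..<length fs}" "i \<in> T"
  shows "face T i \<in> module_hom D (LL (T - {i})) (LL T)"
  using loc_map_hom[of "cp (T - {i})" "fs ! i"] cp_remove[OF assms] cp_closed[of "T - {i}"] fs_nth assms
  by (auto simp: subset_iff)

lemma face_comm:
  assumes T: "T \<subseteq> {..<length fs}" and ik: "i \<in> T" "k \<in> T" "i \<noteq> k"
    and X: "X \<in> carrier (LL (T - {i} - {k}))"
  shows "face T i (face (T - {i}) k X) = face T k (face (T - {k}) i X)"
proof -
  let ?U = "T - {i} - {k}"
  have U: "T - {k} - {i} = ?U" by auto
  have c: "cp ?U \<in> carrier R" "fs ! i \<in> carrier R" "fs ! k \<in> carrier R"
    using cp_closed[of ?U] fs_nth T ik by auto
  have k: "cp ?U \<otimes>\<^bsub>R\<^esub> fs ! k = cp (T - {i})" by (rule cp_remove) (use T ik in auto)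
  have i: "cp ?U \<otimes>\<^bsub>R\<^esub> fs ! i = cp (T - {k})" by (rule cp_remove[of "T - {k}" i, unfolded U]) (use T ik in auto)
  show ?thesis using loc_map_comm[OF c(1,3,2) X] by (simp only: k i U)
qed

definition cech_term where
  "cech_term \<alpha> T i = signed (LL T) (card {k \<in> T. k < i}) (face T i (\<alpha> (T - {i})))"

lemma cech_diff_eq: "T \<in> cech_index fs (Suc j) \<Longrightarrow>
    cech_diff K R M fs j \<alpha> T = finsum (LL T) (cech_term \<alpha> T) T"
  by (simp add: cech_diff_def Let_def cech_term_def[abs_def])

lemma cech_mem: "\<alpha> \<in> carrier (CC j) \<Longrightarrow> S \<in> cech_index fs j \<Longrightarrow> \<alpha> S \<in> carrier (LL S)"
  unfolding cech_module_eq by (auto simp: prod_module_def)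

lemma cech_term_hom:
  assumes T: "T \<in> cech_index fs (Suc j)" "i \<in> T"
  shows "(\<lambda>\<alpha>. cech_term \<alpha> T i) \<in> module_hom D (CC j) (LL T)"
proof -
  interpret L: left_module D "LL T" by (rule localization_left_module[OF cech_indexD(3)[OF T(1)]])
  note h = face_hom[OF cech_indexD(1)[OF T(1)] T(2)]
  have mem: "\<alpha> (T - {i}) \<in> carrier (LL (T - {i}))" if "\<alpha> \<in> carrier (CC j)" for \<alpha>
    by (rule cech_mem[OF that cech_index_remove[OF T]])
  have fc: "face T i (\<alpha> (T - {i})) \<in> carrier (LL T)" if "\<alpha> \<in> carrier (CC j)" for \<alpha>
    using module_hom_closed[OF h] mem[OF that] by blast
  have "cech_term (\<alpha> \<oplus>\<^bsub>CC j\<^esub> \<beta>) T i = cech_term \<alpha> T i \<oplus>\<^bsub>LL T\<^esub> cech_term \<beta> T i"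
    if "\<alpha> \<in> carrier (CC j)" "\<beta> \<in> carrier (CC j)" for \<alpha> \<beta>
    using mem[OF that(1)] mem[OF that(2)] fc[OF that(1)] fc[OF that(2)] cech_index_remove[OF T]
    by (simp add: cech_term_def cech_module_eq prod_module_def module_hom_add[OF h] L.M.signed_add)
  moreover have "cech_term (a \<odot>\<^bsub>CC j\<^esub> \<alpha>) T i = a \<odot>\<^bsub>LL T\<^esub> cech_term \<alpha> T i"
    if "\<alpha> \<in> carrier (CC j)" "a \<in> carrier D" for \<alpha> a
    using mem[OF that(1)] fc[OF that(1)] cech_index_remove[OF T] that(2)
    by (simp add: cech_term_def cech_module_eq prod_module_def module_hom_smult[OF h] L.signed_smult)
  moreover have "cech_term \<alpha> T i \<in> carrier (LL T)" if "\<alpha> \<in> carrier (CC j)" for \<alpha>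
    using fc[OF that] by (simp add: cech_term_def)
  ultimately show ?thesis by (simp add: module_hom_def)
qed

lemma cech_diff_hom: "cech_diff K R M fs j \<in> module_hom D (CC j) (CC (Suc j))"
proof -
  let ?d = "cech_diff K R M fs j"
  have comp: "finsum (LL T) (cech_term \<alpha> T) T \<in> carrier (LL T)"
    "finsum (LL T) (cech_term (\<alpha> \<oplus>\<^bsub>CC j\<^esub> \<beta>) T) T =
      finsum (LL T) (cech_term \<alpha> T) T \<oplus>\<^bsub>LL T\<^esub> finsum (LL T) (cech_term \<beta> T) T"
    "a \<in> carrier D \<Longrightarrow> finsum (LL T) (cech_term (a \<odot>\<^bsub>CC j\<^esub> \<alpha>) T) T =
      a \<odot>\<^bsub>LL T\<^esub> finsum (LL T) (cech_term \<alpha> T) T"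
    if \<alpha>: "\<alpha> \<in> carrier (CC j)" and \<beta>: "\<beta> \<in> carrier (CC j)" and T: "T \<in> cech_index fs (Suc j)" for \<alpha> \<beta> T a
  proof -
    interpret L: left_module D "LL T" by (rule localization_left_module[OF cech_indexD(3)[OF T]])
    note h = cech_term_hom[OF T]
    have c: "cech_term \<alpha> T \<in> T \<rightarrow> carrier (LL T)" if "\<alpha> \<in> carrier (CC j)" for \<alpha>
      using module_hom_closed[OF h] that by blast
    show "finsum (LL T) (cech_term \<alpha> T) T \<in> carrier (LL T)" by (rule L.M.finsum_closed[OF c[OF \<alpha>]])
    have "finsum (LL T) (cech_term (\<alpha> \<oplus>\<^bsub>CC j\<^esub> \<beta>) T) T =
      finsum (LL T) (\<lambda>i. cech_term \<alpha> T i \<oplus>\<^bsub>LL T\<^esub> cech_term \<beta> T i) T"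
      by (rule L.M.finsum_cong') (use c[OF \<alpha>] c[OF \<beta>] module_hom_add[OF h \<alpha> \<beta>] in auto)
    also have "\<dots> = finsum (LL T) (cech_term \<alpha> T) T \<oplus>\<^bsub>LL T\<^esub> finsum (LL T) (cech_term \<beta> T) T"
      by (rule L.M.finsum_addf[OF c[OF \<alpha>] c[OF \<beta>]])
    finally show "finsum (LL T) (cech_term (\<alpha> \<oplus>\<^bsub>CC j\<^esub> \<beta>) T) T =
      finsum (LL T) (cech_term \<alpha> T) T \<oplus>\<^bsub>LL T\<^esub> finsum (LL T) (cech_term \<beta> T) T" .
    assume a: "a \<in> carrier D"
    have "finsum (LL T) (cech_term (a \<odot>\<^bsub>CC j\<^esub> \<alpha>) T) T = finsum (LL T) (\<lambda>i. a \<odot>\<^bsub>LL T\<^esub> cech_term \<alpha> T i) T"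
      by (rule L.M.finsum_cong') (use c[OF \<alpha>] a module_hom_smult[OF h a \<alpha>] in auto)
    also have "\<dots> = a \<odot>\<^bsub>LL T\<^esub> finsum (LL T) (cech_term \<alpha> T) T"
      by (rule L.finsum_smult[OF a c[OF \<alpha>], symmetric])
    finally show "finsum (LL T) (cech_term (a \<odot>\<^bsub>CC j\<^esub> \<alpha>) T) T = a \<odot>\<^bsub>LL T\<^esub> finsum (LL T) (cech_term \<alpha> T) T" .
  qed
  have ext: "?d \<alpha> = (\<lambda>T \<in> cech_index fs (Suc j). finsum (LL T) (cech_term \<alpha> T) T)" for \<alpha>
    by (simp add: cech_diff_def Let_def cech_term_def[abs_def])
  have "?d \<alpha> \<in> carrier (CC (Suc j))" if "\<alpha> \<in> carrier (CC j)" for \<alpha>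
    unfolding ext cech_module_eq[of "Suc j"] using comp(1)[OF that that] by (simp add: prod_module_def)
  moreover have "?d (\<alpha> \<oplus>\<^bsub>CC j\<^esub> \<beta>) = ?d \<alpha> \<oplus>\<^bsub>CC (Suc j)\<^esub> ?d \<beta>"
    if "\<alpha> \<in> carrier (CC j)" "\<beta> \<in> carrier (CC j)" for \<alpha> \<beta>
    unfolding ext cech_module_eq[of "Suc j"] using comp(2)[OF that]
    by (auto simp: prod_module_def intro!: restrict_ext)
  moreover have "?d (a \<odot>\<^bsub>CC j\<^esub> \<alpha>) = a \<odot>\<^bsub>CC (Suc j)\<^esub> ?d \<alpha>"
    if "\<alpha> \<in> carrier (CC j)" "a \<in> carrier D" for \<alpha> a
    unfolding ext cech_module_eq[of "Suc j"] using comp(3)[OF that(1,1) _ that(2)]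
    by (auto simp: prod_module_def intro!: restrict_ext)
  ultimately show ?thesis by (simp add: module_hom_def)
qed

lemma card_below_remove:
  assumes "finite T" "i \<in> T" "i < k"
  shows "card {x \<in> T. x < k} = Suc (card {x \<in> T - {i}. x < (k :: nat)})"
proof -
  have "{x \<in> T. x < k} = insert i {x \<in> T - {i}. x < k}" using assms by auto
  then show ?thesis using assms by simp
qed

text \<open>The component at \<open>T\<close> is a sum over ordered pairs \<open>i \<noteq> k\<close> in \<open>T\<close>, where \<open>(i, k)\<close> and \<open>(k, i)\<close> contribute the
  same element up to sign. For \<open>i < k\<close>, removing \<open>i\<close> lowers the position of \<open>k\<close> by one, whereas removing
  \<open>k\<close> leaves the position of \<open>i\<close> unchanged, so the signs are opposite.\<close>

lemma cech_diff_diff: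
  assumes \<alpha>: "\<alpha> \<in> carrier (CC j)"
  shows "cech_diff K R M fs (Suc j) (cech_diff K R M fs j \<alpha>) = \<zero>\<^bsub>CC (Suc (Suc j))\<^esub>"
proof -
  let ?d = "cech_diff K R M fs"
  have zero: "?d (Suc j) (?d j \<alpha>) T = \<zero>\<^bsub>LL T\<^esub>" if T: "T \<in> cech_index fs (Suc (Suc j))" for T
  proof -
    note TD = cech_indexD[OF T]
    have lm: "left_module D (LL S)" if "S \<subseteq> T" for S
      using that TD(1) by (intro localization_left_module cp_closed) auto
    interpret L: left_module D "LL T" by (rule lm) simp
    define c where "c k = card {x \<in> T. x < k}" for k :: nat
    define c' where "c' i k = card {x \<in> T - {i}. x < k}" for i k :: nat
    \<comment> \<open>\<open>a i k\<close> is the unsigned contribution of the ordered pair, \<open>b i k\<close> the signed one.\<close>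
    define a where "a i k = face T i (face (T - {i}) k (\<alpha> (T - {i} - {k})))" for i k
    define b where "b i k = signed (LL T) (c i + c' i k) (a i k)" for i k
    have TiI: "T - {i} \<in> cech_index fs (Suc j)" if "i \<in> T" for i by (rule cech_index_remove[OF T that])
    have Tik: "\<alpha> (T - {i} - {k}) \<in> carrier (LL (T - {i} - {k}))" if "i \<in> T" "k \<in> T" "i \<noteq> k" for i k
      by (rule cech_mem[OF \<alpha> cech_index_remove[OF TiI]]) (use that in auto)
    have f1: "face T i \<in> module_hom D (LL (T - {i})) (LL T)" if "i \<in> T" for i by (rule face_hom[OF TD(1) that])
    have f2: "face (T - {i}) k (\<alpha> (T - {i} - {k})) \<in> carrier (LL (T - {i}))" if "i \<in> T" "k \<in> T" "i \<noteq> k" for i k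
      using module_hom_closed[OF face_hom[of "T - {i}" k]] Tik[OF that] TD(1) that by blast
    have a: "a i k \<in> carrier (LL T)" if "i \<in> T" "k \<in> T" "i \<noteq> k" for i k
      unfolding a_def using module_hom_closed[OF f1[OF that(1)]] f2[OF that] by blast
    have inner: "cech_term (?d j \<alpha>) T i = finsum (LL T) (b i) (T - {i})" if i: "i \<in> T" for i
    proof -
      interpret Li: left_module D "LL (T - {i})" by (rule lm) auto
      have ct: "cech_term \<alpha> (T - {i}) \<in> T - {i} \<rightarrow> carrier (LL (T - {i}))"
        using module_hom_closed[OF cech_term_hom[OF TiI[OF i]]] \<alpha> by blast
      have sb: "signed (LL T) (c i) (face T i (cech_term \<alpha> (T - {i}) k)) = b i k" if k: "k \<in> T - {i}" for k
      proof -
        have k': "k \<in> T" "i \<noteq> k" using k by auto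
        have "face T i (cech_term \<alpha> (T - {i}) k) = signed (LL T) (c' i k) (a i k)"
          unfolding cech_term_def a_def c'_def
          by (rule signed_hom[OF lm lm f1[OF i] f2[OF i k']]) auto
        then show ?thesis using a[OF i k'] by (simp add: b_def L.M.signed_signed)
      qed
      have sgn: "(\<lambda>x. signed (LL T) n x) \<in> module_hom D (LL T) (LL T)" for n
        by (auto simp: module_hom_def L.M.signed_add L.signed_smult)
      have fct: "(\<lambda>k. face T i (cech_term \<alpha> (T - {i}) k)) \<in> T - {i} \<rightarrow> carrier (LL T)"
        using module_hom_closed[OF f1[OF i]] ct by blast
      have "cech_term (?d j \<alpha>) T i = signed (LL T) (c i) (face T i (finsum (LL (T - {i})) (cech_term \<alpha> (T - {i})) (T - {i})))"
        using cech_diff_eq[OF TiI[OF i]] by (simp add: cech_term_def c_def)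
      also have "face T i (finsum (LL (T - {i})) (cech_term \<alpha> (T - {i})) (T - {i})) =
        finsum (LL T) (\<lambda>k. face T i (cech_term \<alpha> (T - {i}) k)) (T - {i})"
        by (rule hom_finsum[OF lm lm f1[OF i] ct]) auto
      also have "signed (LL T) (c i) \<dots> = finsum (LL T) (\<lambda>k. signed (LL T) (c i) (face T i (cech_term \<alpha> (T - {i}) k))) (T - {i})"
        by (rule hom_finsum[OF lm lm sgn fct]) auto
      also have "\<dots> = finsum (LL T) (b i) (T - {i})"
        by (rule L.M.finsum_cong') (use sb a i in \<open>auto simp: b_def\<close>)
      finally show ?thesis .
    qed
    have bc: "b i k \<in> carrier (LL T)" if "i \<in> T" "k \<in> T" "i \<noteq> k" for i k
      using a[OF that] by (simp add: b_def)
    have anti: "b i k \<oplus>\<^bsub>LL T\<^esub> b k i = \<zero>\<^bsub>LL T\<^esub>" if ik: "i \<in> T" "k \<in> T" "i < k" for i k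
    proof -
      have "a k i = a i k" using face_comm[OF TD(1), of i k "\<alpha> (T - {i} - {k})"] Tik[of i k] ik
        by (auto simp: a_def insert_commute Diff_insert[symmetric])
      moreover have "c k = Suc (c' i k)" unfolding c_def c'_def by (rule card_below_remove[OF TD(2) ik(1,3)])
      moreover have "c' k i = c i"
      proof -
        have "{x \<in> T - {k}. x < i} = {x \<in> T. x < i}" using ik by auto
        then show ?thesis by (simp add: c_def c'_def)
      qed
      ultimately show ?thesis using a[of i k] ik
        by (simp add: b_def signed_def L.M.l_neg L.M.r_neg)
    qed
    have anti': "b i k \<oplus>\<^bsub>LL T\<^esub> b k i = \<zero>\<^bsub>LL T\<^esub>" if "i \<in> T" "k \<in> T" "i \<noteq> k" for i k
      using anti[of i k] anti[of k i] that bc[of i k] bc[of k i] by (cases "i < k") (auto simp: L.M.a_comm)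
    have "?d (Suc j) (?d j \<alpha>) T = finsum (LL T) (cech_term (?d j \<alpha>) T) T" by (rule cech_diff_eq[OF T])
    also have "\<dots> = finsum (LL T) (\<lambda>i. finsum (LL T) (b i) (T - {i})) T"
      by (rule L.M.finsum_cong') (use inner bc in \<open>auto intro!: L.M.finsum_closed\<close>)
    also have "\<dots> = \<zero>\<^bsub>LL T\<^esub>" by (rule L.M.finsum_antisymmetric[OF TD(2) bc anti'])
    finally show ?thesis .
  qed
  show ?thesis
  proof (rule extensionalityI[of _ "cech_index fs (Suc (Suc j))"])
    show "?d (Suc j) (?d j \<alpha>) \<in> extensional (cech_index fs (Suc (Suc j)))" by (simp add: cech_diff_def)
    show "\<zero>\<^bsub>CC (Suc (Suc j))\<^esub> \<in> extensional (cech_index fs (Suc (Suc j)))"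
      by (simp add: cech_module_eq prod_module_def)
    fix T assume "T \<in> cech_index fs (Suc (Suc j))"
    then show "?d (Suc j) (?d j \<alpha>) T = \<zero>\<^bsub>CC (Suc (Suc j))\<^esub> T"
      using zero by (simp add: cech_module_eq prod_module_def)
  qed
qed

lemma cech_cocycles_submodule: "left_submodule D (cech_cocycles K R M fs j) (CC j)"
  unfolding cech_cocycles_def
  by (rule hom_kernel_submodule[OF cech_left_module cech_left_module cech_diff_hom])

text \<open>The inclusion into the cocycles is \<open>d \<circ> d = 0\<close>; it is what makes the cohomology a quotient module.\<close>

lemma cech_coboundaries_submodule:
  "left_submodule D (cech_coboundaries K R M fs j) ((CC j)\<lparr>carrier := cech_cocycles K R M fs j\<rparr>)"
proof -
  interpret C: left_module D "CC j" by (rule cech_left_module)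
  have "left_submodule D (cech_coboundaries K R M fs j) (CC j)"
  proof (cases j)
    case 0
    then show ?thesis using C.M.zero_closed C.smult_r_null C.M.l_zero
      by (auto simp: cech_coboundaries_def left_submodule_def)
  next
    case (Suc i)
    then show ?thesis
      using hom_image_submodule[OF cech_left_module cech_left_module cech_diff_hom[of i]]
      by (simp add: cech_coboundaries_def)
  qed
  moreover have "cech_coboundaries K R M fs j \<subseteq> cech_cocycles K R M fs j"
  proof (cases j)
    case 0
    then show ?thesis using cech_cocycles_submodule[of j] by (auto simp: cech_coboundaries_def left_submodule_def)
  next
    case (Suc i)
    then show ?thesis using cech_diff_diff[of _ i] module_hom_closed[OF cech_diff_hom[of i]]
      by (auto simp: cech_coboundaries_def cech_cocycles_def)
  qed
  ultimately show ?thesis by (simp add: left_submodule_def)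
qed

end

end

context dominated_diff_op_module
begin

theorem cech_cohomology_holonomic:
  assumes fs: "set fs \<subseteq> carrier R" and M: "holonomic K D F M"
  shows "holonomic K D F (cech_cohomology K R M fs j)"
proof -
  let ?C = "cech_module K R M fs j" and ?Z = "cech_cocycles K R M fs j" and ?B = "cech_coboundaries K R M fs j"
  let ?CZ = "?C\<lparr>carrier := ?Z\<rparr>"
  have "cech_index fs j \<subseteq> Pow {..<length fs}" by (auto simp: cech_index_def)
  then have fin: "finite (cech_index fs j)" by (rule finite_subset) simp
  have "holonomic K D F ?C" unfolding cech_module_eq[OF fs]
    by (rule LS.holonomic_prod[OF fin localization_holonomic[OF cech_indexD(3)[OF fs] M]])
  then have CZ: "holonomic K D F ?CZ" by (rule LS.holonomic_submodule[OF _ cech_cocycles_submodule[OF fs]])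
  then interpret CZ: left_module D ?CZ by (simp add: holonomic_def)
  note B = cech_coboundaries_submodule[OF fs, of j]
  show ?thesis unfolding cech_cohomology_def
    by (rule LS.holonomic_surj_image[OF CZ CZ.quot_module[OF B] CZ.quot_map_hom[OF B]])
      (simp add: CZ.quot_module_simps(1)[OF B])
qed

end

section \<open>Holonomicity of localization and local cohomology\<close>

theorem theorem4p6:
  fixes K :: "('k, 'x) ring_scheme"
    and R :: "('k, 'r, 'y) module_scheme"
    and F :: "nat \<Rightarrow> ('r \<Rightarrow> 'r) set"
    and M :: "('r \<Rightarrow> 'r, 'm, 'z) module_scheme"
  assumes "field K"
    and "algebra K R"
    and "algebra_filtration K (diff_ops K R) F"
    and "linearly_dominated_by_order K R F"
    and "linearly_simple K (diff_ops K R) F"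
    and "filtration_dim K (diff_ops K R) F < \<infinity>"
    and "0 < filtration_mult K (diff_ops K R) F"
    and "filtration_mult K (diff_ops K R) F < \<infinity>"
    and "holonomic K (diff_ops K R) F M"
  shows "(\<forall>f \<in> carrier R. holonomic K (diff_ops K R) F (localization K R M f)) \<and>
    (\<forall>I fs j. ideal I R \<and> set fs \<subseteq> carrier R \<and> I = genideal R (set fs) \<longrightarrow>
       holonomic K (diff_ops K R) F (cech_cohomology K R M fs j))"
proof -
  have "left_module (diff_ops K R) M" using assms(9) by (simp add: holonomic_def)
  then interpret M: diff_op_module K R M by (intro diff_op_module.intro assms(2))
  have "fin_dim_subspace K (diff_ops K R) (F 0)"
    using assms(3) unfolding algebra_filtration_def exhaustive_fin_dim_sequence_def by blast
  then have "field_algebra K (diff_ops K R)"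
    by (intro M.diff_ops_field_algebra fin_dim_subspaceD(1))
  then interpret dominated_diff_op_module K R M F
    using assms by (intro dominated_diff_op_module.intro dominated_diff_op_module_axioms.intro
      linearly_simple_algebra.intro linearly_simple_algebra_axioms.intro M.diff_op_module_axioms)
  show ?thesis using localization_holonomic cech_cohomology_holonomic assms(9) by blast
qed

end
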